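(* Let $n\geq1$. The column of $\hat{\Theta}(2n)$ indexed by $(1^n)$ is the all-ones vector. Let $\mu\in{\cal P}(2,n)$ with $|\mu|>0$. Then for every $\lambda\vdash n$, $$\hat{\theta}^{2\lambda}_{2(\mu,1^{n-|\mu|})}=\frac{1}{2^{\ell(\mu)}}\left\{\hat{\phi}^{2\lambda}_{(\mu,1^{2n-|\mu|})}-\sum_{\tau\in{\cal P}(2,|\mu|-1)}d^\tau_\mu(2n)\,\hat{\theta}^{2\lambda}_{2(\tau,1^{n-|\tau|})}\right\}.$$
   Context: Let $K_{2n}$ be the complete graph on $\{1,\ldots,2n\}$ and ${\cal M}_{2n}$ its set of perfect matchings. For $A,B\in{\cal M}_{2n}$, $d(A,B)$ is the partition of $2n$ whose parts are the numbers of vertices of the connected components of the graph with edge set $A\cup B$; it equals $2\nu$ for some $\nu\vdash n$. For $\nu\vdash n$, $N_{2\nu}(A)=\sum_{B:\,d(A,B)=2\nu}B$; these operators form a basis of ${\cal B}_{2n}=\mathrm{End}_{S_{2n}}({\mathbb C}[{\cal M}_{2n}])$, where $S_{2n}$ acts by relabelling vertices. It is known that ${\mathbb C}[{\cal M}_{2n}]\cong\bigoplus_{\lambda\vdash n}V^{2\lambda}$ multiplicity-free, where $V^\nu$ is the irreducible $S_{2n}$-module indexed by the Young diagram $\nu$ and $2\lambda$ doubles the row lengths of $\lambda$. $\hat{\theta}^{2\lambda}_{2\nu}$ is the scalar by which $N_{2\nu}$ acts on $V^{2\lambda}$, and $\hat{\Theta}(2n)=(\hat{\theta}^{2\lambda}_{2\nu})_{\lambda,\nu\vdash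 n}$. For $\rho\vdash 2n$, $\hat{\phi}^{2\lambda}_\rho$ is the scalar by which the class sum of cycle type $\rho$ acts on $V^{2\lambda}$. ${\cal P}(2)$ is the set of partitions with all parts $\geq2$ (including the empty partition $(0)$), ${\cal P}(2,m)=\{\tau\in{\cal P}(2):|\tau|\leq m\}$, $\ell(\mu)$ is the number of parts, and $(\mu,1^{r})$ is $\mu$ with $r$ parts equal to $1$ appended. For $\tau\in{\cal P}(2)$, $M_{2\tau}(2n)=N_{2(\tau,1^{n-|\tau|})}$ if $|\tau|\leq n$, and $0$ otherwise. For $\mu\in{\cal P}(2)$, $c_\mu(2n)\in{\mathbb C}[S_{2n}]$ is the sum of permutations whose cycles of length $\geq2$ have lengths $\mu$, and $f(\mu,2n)\in{\cal B}_{2n}$ is $x\mapsto c_\mu(2n)x$. The numbers $d^\tau_\mu(2n)$ are defined by $f(\mu,2n)=\sum_{\tau\in{\cal P}(2,n)}d^\tau_\mu(2n)M_{2\tau}(2n)$. *)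

theory Defs
  imports Complex_Main "HOL-Library.Multiset" "HOL-Combinatorics.Permutations"
begin

(* Vertices of K_{2n} are {0..<2n} (relabelled from {1..2n}). *)

type_synonym matching = "nat set set"
type_synonym vec = "matching \<Rightarrow> complex"   (* element of C[M_{2n}] as coefficient function *)

definition is_partition :: "nat multiset \<Rightarrow> nat \<Rightarrow> bool" where
  "is_partition \<nu> n \<longleftrightarrow> (\<forall>x\<in>#\<nu>. 0 < x) \<and> sum_mset \<nu> = n"

definition double :: "nat multiset \<Rightarrow> nat multiset" where
  "double \<nu> = image_mset (\<lambda>x. 2 * x) \<nu>"

definition pad1 :: "nat multiset \<Rightarrow> nat \<Rightarrow> nat multiset" where
  "pad1 \<mu> r = \<mu> + replicate_mset r 1"

definition P2 :: "nat \<Rightarrow> nat multiset set" where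
  "P2 m = {\<tau>. (\<forall>x\<in>#\<tau>. 2 \<le> x) \<and> sum_mset \<tau> \<le> m}"

definition matchings :: "nat \<Rightarrow> matching set" where
  "matchings n = {A. (\<forall>e\<in>A. card e = 2 \<and> e \<subseteq> {..<2*n}) \<and> (\<forall>v<2*n. \<exists>!e. e \<in> A \<and> v \<in> e)}"

definition supported :: "nat \<Rightarrow> vec \<Rightarrow> bool" where
  "supported n x \<longleftrightarrow> (\<forall>A. A \<notin> matchings n \<longrightarrow> x A = 0)"

definition conn :: "matching \<Rightarrow> matching \<Rightarrow> (nat \<times> nat) set" where
  "conn A B = rtrancl {(u,v). {u,v} \<in> A \<union> B}"

definition dmatch :: "nat \<Rightarrow> matching \<Rightarrow> matching \<Rightarrow> nat multiset" where
  "dmatch n A B = image_mset card (mset_set ({..<2*n} // conn A B))"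

(* N_{2 nu}, linearly extended: N(A) = sum of B with d(A,B) = 2 nu *)
definition Nop :: "nat \<Rightarrow> nat multiset \<Rightarrow> vec \<Rightarrow> vec" where
  "Nop n \<nu> x = (\<lambda>B. if B \<in> matchings n then
       (\<Sum>A\<in>matchings n. if dmatch n A B = double \<nu> then x A else 0) else 0)"

definition Mop :: "nat \<Rightarrow> nat multiset \<Rightarrow> vec \<Rightarrow> vec" where
  "Mop n \<tau> = (if sum_mset \<tau> \<le> n then Nop n (pad1 \<tau> (n - sum_mset \<tau>)) else (\<lambda>x. (\<lambda>_. 0)))"

definition act_m :: "(nat \<Rightarrow> nat) \<Rightarrow> matching \<Rightarrow> matching" where
  "act_m \<sigma> A = (\<lambda>e. \<sigma> ` e) ` A"

definition act :: "(nat \<Rightarrow> nat) \<Rightarrow> vec \<Rightarrow> vec" where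
  "act \<sigma> x = (\<lambda>B. x (act_m (inv \<sigma>) B))"

definition cycle_type :: "nat \<Rightarrow> (nat \<Rightarrow> nat) \<Rightarrow> nat multiset" where
  "cycle_type m \<sigma> = image_mset card (mset_set ({..<m} // {(x,y). \<exists>k. (\<sigma> ^^ k) x = y}))"

definition class_sum :: "nat \<Rightarrow> nat multiset \<Rightarrow> vec \<Rightarrow> vec" where
  "class_sum n \<rho> x = (\<lambda>B. \<Sum>\<sigma>\<in>{\<sigma>. \<sigma> permutes {..<2*n} \<and> cycle_type (2*n) \<sigma> = \<rho>}. act \<sigma> x B)"

definition c_op :: "nat \<Rightarrow> nat multiset \<Rightarrow> vec \<Rightarrow> vec" where
  "c_op n \<mu> x = (\<lambda>B. \<Sum>\<sigma>\<in>{\<sigma>. \<sigma> permutes {..<2*n} \<and>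
        filter_mset (\<lambda>k. 2 \<le> k) (cycle_type (2*n) \<sigma>) = \<mu>}. act \<sigma> x B)"

(* d^tau_mu(2n): coefficients of f(mu,2n) in the basis M_{2tau}(2n), tau \<in> P(2,n) *)
definition dcoef :: "nat \<Rightarrow> nat multiset \<Rightarrow> nat multiset \<Rightarrow> complex" where
  "dcoef n \<mu> = (THE d. (\<forall>\<tau>. \<tau> \<notin> P2 n \<longrightarrow> d \<tau> = 0) \<and>
      (\<forall>x. supported n x \<longrightarrow>
          c_op n \<mu> x = (\<lambda>B. \<Sum>\<tau>\<in>P2 n. d \<tau> * Mop n \<tau> x B)))"

(* Young tableau of shape nu (rows in weakly decreasing order), filled row by row
   with 0,1,...,|nu|-1 *)
definition rows :: "nat multiset \<Rightarrow> nat list" where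
  "rows \<nu> = rev (sorted_list_of_multiset \<nu>)"

definition row_off :: "nat multiset \<Rightarrow> nat \<Rightarrow> nat" where
  "row_off \<nu> i = sum_list (take i (rows \<nu>))"

definition row_of :: "nat multiset \<Rightarrow> nat \<Rightarrow> nat" where
  "row_of \<nu> k = card {i\<in>{1..<length (rows \<nu>)}. row_off \<nu> i \<le> k}"

definition col_of :: "nat multiset \<Rightarrow> nat \<Rightarrow> nat" where
  "col_of \<nu> k = k - row_off \<nu> (row_of \<nu> k)"

definition row_group :: "nat multiset \<Rightarrow> (nat \<Rightarrow> nat) set" where
  "row_group \<nu> = {p. p permutes {..<sum_mset \<nu>} \<and> (\<forall>k<sum_mset \<nu>. row_of \<nu> (p k) = row_of \<nu> k)}"

definition col_group :: "nat multiset \<Rightarrow> (nat \<Rightarrow> nat) set" where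
  "col_group \<nu> = {q. q permutes {..<sum_mset \<nu>} \<and> (\<forall>k<sum_mset \<nu>. col_of \<nu> (q k) = col_of \<nu> k)}"

definition young_op :: "nat multiset \<Rightarrow> vec \<Rightarrow> vec" where
  "young_op \<nu> x = (\<lambda>B. \<Sum>q\<in>col_group \<nu>. \<Sum>p\<in>row_group \<nu>. of_int (sign q) * act (q \<circ> p) x B)"

(* generators of the isotypic component of V^nu in C[M_{2n}]:
   C[S_{2n}] e_T C[M_{2n}]; its span is the V^nu-component *)
definition iso_gens :: "nat \<Rightarrow> nat multiset \<Rightarrow> vec set" where
  "iso_gens n \<nu> = {act \<sigma> (young_op \<nu> w) | \<sigma> w. \<sigma> permutes {..<2*n} \<and> supported n w}"

definition scalar_on :: "vec set \<Rightarrow> (vec \<Rightarrow> vec) \<Rightarrow> complex" where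
  "scalar_on S T = (THE c. \<forall>v\<in>S. T v = (\<lambda>B. c * v B))"

definition theta :: "nat \<Rightarrow> nat multiset \<Rightarrow> nat multiset \<Rightarrow> complex" where
  "theta n la \<nu> = scalar_on (iso_gens n (double la)) (Nop n \<nu>)"

definition phi :: "nat \<Rightarrow> nat multiset \<Rightarrow> nat multiset \<Rightarrow> complex" where
  "phi n la \<rho> = scalar_on (iso_gens n (double la)) (class_sum n \<rho>)"

end

theory Submission
  imports Defs "HOL-Combinatorics.Orbits"
begin

text \<open>
  The class sum \<open>f(\<mu>,2n)\<close> expands as \<open>\<Sum>\<^sub>\<tau> d\<^sub>\<tau> M\<^sub>\<tau>\<close>, where \<open>d\<^sub>\<tau>\<close> counts the permutations \<open>\<sigma>\<close> of type \<open>\<mu>\<close>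
  with \<open>\<sigma> A = B\<close>, for any fixed pair with \<open>d(A,B) = 2(\<tau>,1,\<dots>,1)\<close>. Every edge of \<open>A - B\<close> contains a point
  moved by \<open>\<sigma>\<close>, so \<open>|\<tau>| \<le> |\<mu>|\<close>. In case of equality each such edge contains exactly one moved point, the
  moved points form a colour class of a proper 2-colouring of the nontrivial components of \<open>A \<union> B\<close>, and
  \<open>\<sigma>\<close> is on them the product of the two matching involutions; hence \<open>\<tau> = \<mu>\<close>, and there is one \<open>\<sigma>\<close> for
  each of the \<open>2\<^sup>\<ell>\<close> colourings. Evaluating the expansion on \<open>V\<^bsup>2\<lambda>\<^esup>\<close> and solving for the term \<open>\<tau> = \<mu>\<close> gives
  the recursion.

  The operators act on \<open>V\<^bsup>2\<lambda>\<^esup>\<close> by scalars because the image of the Young symmetrizer is one-dimensional.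
  By von Neumann's lemma, \<open>\<langle>\<sigma>u, w\<rangle> = a(\<sigma>) \<langle>u, w\<rangle>\<close> for \<open>u\<close>, \<open>w\<close> in this image, with \<open>a(\<sigma>)\<close> real and
  depending only on \<open>\<sigma>\<close>; as any two matchings are exchanged by some permutation,
  \<open>\<Sum>\<^sub>\<sigma> \<langle>\<sigma>u, w\<rangle>\<langle>\<sigma>v, w'\<rangle> = K \<langle>u, w\<rangle>\<langle>v, w'\<rangle>\<close> is symmetric in \<open>u\<close> and \<open>v\<close>, where \<open>K = \<Sum>\<^sub>\<sigma> a(\<sigma>)\<^sup>2 > 0\<close>.
  The image is nonzero because, in that of the standard matching, this matching has positive coefficient.
\<close>

section \<open>Sizes of equivalence classes\<close>

text \<open>Only the classes of points of \<open>X\<close> are constrained, because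
  \<open>conn\<close> and the relation of iterates are defined on all natural numbers.\<close>

definition classes_on :: "'a set \<Rightarrow> ('a \<times> 'a) set \<Rightarrow> bool" where
  "classes_on X R \<longleftrightarrow> (\<forall>x\<in>X. x \<in> R `` {x} \<and> R `` {x} \<subseteq> X \<and> (\<forall>y\<in>R `` {x}. R `` {y} = R `` {x}))"

definition class_sizes :: "'a set \<Rightarrow> ('a \<times> 'a) set \<Rightarrow> nat multiset" where
  "class_sizes X R = image_mset card (mset_set (X // R))"

lemma dmatch_eq_class_sizes: "dmatch n A B = class_sizes {..<2*n} (conn A B)"
  by (simp add: dmatch_def class_sizes_def)

lemma cycle_type_eq_class_sizes: "cycle_type m \<sigma> = class_sizes {..<m} {(x,y). \<exists>k. (\<sigma> ^^ k) x = y}"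
  by (simp add: cycle_type_def class_sizes_def)

lemma quotient_eq_image: "X // R = (\<lambda>x. R `` {x}) ` X"
  by (auto simp: quotient_def)

lemma finite_quotient_set: "finite X \<Longrightarrow> finite (X // R)"
  by (auto simp: quotient_def)

lemma filter_class_sizes:
  assumes "finite X"
  shows "filter_mset P (class_sizes X R) = image_mset card (mset_set {K \<in> X // R. P (card K)})"
  using finite_quotient_set[OF assms, of R]
  by (simp add: class_sizes_def filter_mset_image_mset comp_def)

lemma size_filter_class_sizes:
  assumes "finite X"
  shows "size (filter_mset P (class_sizes X R)) = card {K \<in> X // R. P (card K)}"
  using assms by (simp add: filter_class_sizes)

lemma classes_onD:
  assumes "classes_on X R" "x \<in> X"
  shows "x \<in> R `` {x}" "R `` {x} \<subseteq> X" "y \<in> R `` {x} \<Longrightarrow> R `` {y} = R `` {x}"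
  using assms unfolding classes_on_def by metis+

lemma class_sizes_pos:
  assumes "finite X" "classes_on X R" "k \<in># class_sizes X R"
  shows "0 < k"
proof -
  obtain K where K: "K \<in> X // R" "k = card K"
    using assms finite_quotient_set[of X R] by (auto simp: class_sizes_def)
  from K(1) obtain x where x: "x \<in> X" "K = R `` {x}" by (rule quotientE)
  then have "x \<in> K" "K \<subseteq> X" using classes_onD[OF assms(2)] by blast+
  then show ?thesis unfolding K(2) using finite_subset[OF _ assms(1)] by (auto simp: card_gt_0_iff)
qed

lemma classes_on_member:
  assumes "classes_on X R" "K \<in> X // R" "x \<in> K"
  shows "x \<in> X" "R `` {x} = K"
proof -
  obtain y where "y \<in> X" "K = R `` {y}" using assms(2) by (rule quotientE)
  then show "x \<in> X" "R `` {x} = K"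
    using classes_onD[OF assms(1)] assms(3) by blast+
qed

text \<open>Classes are disjoint, so adding the sizes of those that satisfy \<open>P\<close> counts
  the points lying in them. With \<open>P\<close> a lower bound 2 or 4, these are the points of
  nontrivial cycles or components.\<close>

lemma sum_filter_class_sizes:
  assumes "finite X" "classes_on X R"
  shows "sum_mset (filter_mset P (class_sizes X R)) = card {x \<in> X. P (card (R `` {x}))}"
proof -
  let ?Q = "{K \<in> X // R. P (card K)}"
  have fin: "finite ?Q" using finite_quotient_set[OF assms(1)] by simp
  have "sum_mset (filter_mset P (class_sizes X R)) = (\<Sum>K\<in>?Q. card K)"
    using assms(1) by (simp add: filter_class_sizes sum_unfold_sum_mset)
  also have "\<dots> = card (\<Union>?Q)"
  proof (rule card_Union_disjoint [symmetric])
    show "pairwise disjnt ?Q"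
    proof (rule pairwiseI)
      fix K L assume KL: "K \<in> ?Q" "L \<in> ?Q" "K \<noteq> L"
      have False if "x \<in> K" "x \<in> L" for x
        using that KL classes_on_member(2)[OF assms(2), of K x] classes_on_member(2)[OF assms(2), of L x] by simp
      then show "disjnt K L" by (auto simp: disjnt_def)
    qed
    show "finite K" if "K \<in> ?Q" for K
    proof -
      have "K \<subseteq> X" using that classes_on_member(1)[OF assms(2)] by auto
      then show ?thesis using assms(1) finite_subset by blast
    qed
  qed
  also have "\<Union>?Q = {x \<in> X. P (card (R `` {x}))}"
  proof (intro equalityI subsetI)
    fix x assume "x \<in> \<Union>?Q"
    then obtain K where "K \<in> X // R" "P (card K)" "x \<in> K" by blast
    then show "x \<in> {x \<in> X. P (card (R `` {x}))}"
      using classes_on_member[OF assms(2)] by simp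
  next
    fix x assume "x \<in> {x \<in> X. P (card (R `` {x}))}"
    then have "R `` {x} \<in> ?Q" "x \<in> R `` {x}"
      using classes_onD(1)[OF assms(2)] by (auto intro: quotientI)
    then show "x \<in> \<Union>?Q" by blast
  qed
  finally show ?thesis .
qed

lemma sum_class_sizes:
  assumes "finite X" "classes_on X R"
  shows "sum_mset (class_sizes X R) = card X"
  using sum_filter_class_sizes[OF assms, of "\<lambda>_. True"] by simp

text \<open>Taking images under \<open>g\<close> is a size-preserving bijection between the two
  quotients.\<close>

lemma class_sizes_relabel:
  assumes "finite X" "g permutes X" "\<And>x. x \<in> X \<Longrightarrow> R' `` {g x} = g ` (R `` {x})"
  shows "class_sizes X R' = class_sizes X R"
proof -
  have "X // R' = (\<lambda>y. R' `` {y}) ` (g ` X)"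
    unfolding permutes_image[OF assms(2)] by (rule quotient_eq_image)
  also have "\<dots> = (\<lambda>x. g ` (R `` {x})) ` X"
    unfolding image_image by (rule image_cong) (simp_all only: assms(3))
  also have "\<dots> = (`) g ` (X // R)"
    unfolding image_image quotient_eq_image ..
  finally have eq: "X // R' = (`) g ` (X // R)" .
  have inj: "inj g" using assms(2) permutes_inj by blast
  have "mset_set (X // R') = image_mset ((`) g) (mset_set (X // R))"
    unfolding eq by (rule image_mset_mset_set [symmetric]) (meson inj inj_image_eq_iff inj_onI)
  then show ?thesis
    by (simp add: class_sizes_def multiset.map_comp comp_def card_image inj_on_subset[OF inj])
qed

text \<open>Induction on \<open>X\<close>: the value at a point is attained at some point of
  \<open>Y\<close>, and both are removed. This later pairs off components of equal size.\<close>

lemma bij_betw_of_image_mset_eq: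
  assumes "finite X" "finite Y" "image_mset f (mset_set X) = image_mset g (mset_set Y)"
  shows "\<exists>h. bij_betw h X Y \<and> (\<forall>x\<in>X. g (h x) = f x)"
  using assms
proof (induction X arbitrary: Y rule: finite_induct)
  case empty
  then show ?case by (auto simp: mset_set_empty_iff bij_betw_def)
next
  case (insert x X)
  have "f x \<in># image_mset g (mset_set Y)"
    using insert by (metis image_mset_add_mset mset_set.insert union_single_eq_member)
  then obtain y where y: "y \<in> Y" "g y = f x" using insert by auto
  have "mset_set Y = add_mset y (mset_set (Y - {y}))"
    using y insert by (simp add: mset_set.remove)
  then have "image_mset f (mset_set X) = image_mset g (mset_set (Y - {y}))"
    using insert y by simp
  then obtain h where h: "bij_betw h X (Y - {y})" "\<forall>x\<in>X. g (h x) = f x"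
    using insert.IH[of "Y - {y}"] insert.prems(1) by auto
  have "bij_betw (h(x := y)) (insert x X) Y"
  proof -
    have "bij_betw (h(x := y)) X (Y - {y})"
      using h(1) insert.hyps(2) by (subst bij_betw_cong[where g = h]) auto
    then have "bij_betw (h(x := y)) (insert x X) (insert ((h(x := y)) x) (Y - {y}))"
      using insert.hyps(2) by (subst notIn_Un_bij_betw3 [symmetric, where A = X, simplified]) auto
    then show ?thesis using y by (simp add: insert_absorb)
  qed
  moreover have "\<forall>z\<in>insert x X. g ((h(x := y)) z) = f z"
    using h(2) y insert.hyps(2) by auto
  ultimately show ?case by blast
qed

section \<open>Orbits and cycle types of permutations\<close>

lemma Image_funpow_eq_orbit:
  assumes "permutation f"
  shows "{(x,y). \<exists>k. (f ^^ k) x = y} `` {x} = orbit f x"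
  by (auto simp: orbit_altdef_permutation[OF assms])

lemma permutation_orbit_eq:
  assumes "permutation f" "y \<in> orbit f x"
  shows "orbit f y = orbit f x"
  using assms orbit_cyclic_eq3 cyclic_on_orbit' by metis

lemma classes_on_funpow:
  assumes "f permutes X" "finite X"
  shows "classes_on X {(x,y). \<exists>k. (f ^^ k) x = y}"
proof -
  have p: "permutation f" using assms permutation_permutes by blast
  show ?thesis
    unfolding classes_on_def Image_funpow_eq_orbit[OF p]
    using permutation_self_in_orbit[OF p] permutes_orbit_subset[OF assms(1)] permutation_orbit_eq[OF p]
    by blast
qed

text \<open>The iterates at \<open>x\<close> before the first return are distinct and exhaust the
  orbit, so the return time is the size of the orbit.\<close>

lemma funpow_eq_iff_mod_card_orbit:
  assumes "permutation f"
  shows "(f ^^ i) x = (f ^^ j) x \<longleftrightarrow> i mod card (orbit f x) = j mod card (orbit f x)"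
proof -
  let ?d = "funpow_dist1 f x x"
  have x: "x \<in> orbit f x" by (rule permutation_self_in_orbit[OF assms])
  have inj: "inj_on (\<lambda>n. (f ^^ n) x) {0..<?d}" by (rule inj_on_funpow_dist1[OF x])
  have "orbit f x = (\<lambda>n. (f ^^ n) x) ` {0..<?d}" by (rule orbit_conv_funpow_dist1[OF x])
  then have card: "card (orbit f x) = ?d" using card_image[OF inj] by simp
  have per: "(f ^^ ?d) x = x" by (rule funpow_dist1_prop[OF x])
  have m: "(f ^^ i) x = (f ^^ (i mod ?d)) x" for i using funpow_mod_eq[OF per] by simp
  have "(f ^^ i) x = (f ^^ j) x \<longleftrightarrow> i mod ?d = j mod ?d"
    by (subst m, subst m[of j]) (use inj in \<open>auto dest!: inj_onD\<close>)
  then show ?thesis by (simp add: card)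
qed

lemma cycle_type_conjugate:
  assumes "g permutes {..<m}" "s permutes {..<m}"
  shows "cycle_type m (g \<circ> s \<circ> inv g) = cycle_type m s"
  unfolding cycle_type_eq_class_sizes
proof (rule class_sizes_relabel[OF _ assms(1)])
  fix x assume "x \<in> {..<m}"
  have "(g \<circ> s \<circ> inv g) ^^ k = g \<circ> s ^^ k \<circ> inv g" for k
    by (induction k) (use permutes_inverses[OF assms(1)] in \<open>auto simp: fun_eq_iff\<close>)
  then show "{(x, y). \<exists>k. ((g \<circ> s \<circ> inv g) ^^ k) x = y} `` {g x} =
     g ` ({(x, y). \<exists>k. (s ^^ k) x = y} `` {x})"
    using permutes_inverses[OF assms(1)] by auto
qed simp

lemma sum_cycle_type:
  assumes "\<sigma> permutes {..<m}"
  shows "sum_mset (cycle_type m \<sigma>) = m"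
  using sum_class_sizes[OF _ classes_on_funpow[OF assms]] by (simp add: cycle_type_eq_class_sizes)

lemma cycle_type_pos:
  assumes "\<sigma> permutes {..<m}" "k \<in># cycle_type m \<sigma>"
  shows "0 < k"
  using class_sizes_pos[OF _ classes_on_funpow[OF assms(1)]] assms(2) by (simp add: cycle_type_eq_class_sizes)

lemma card_orbit_ge2_iff:
  assumes "permutation f"
  shows "2 \<le> card (orbit f x) \<longleftrightarrow> f x \<noteq> x"
proof -
  have "card (orbit f x) = 1 \<longleftrightarrow> f x = x"
    using permutation_self_in_orbit[OF assms, of x] orbit_eq_singleton_iff[of f x]
    by (auto simp: card_1_singleton_iff)
  moreover have "card (orbit f x) \<noteq> 0"
    using finite_orbit[OF permutation_self_in_orbit[OF assms]] orbit_nonempty by simp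
  ultimately show ?thesis by linarith
qed

lemma sum_nontrivial_cycles:
  assumes "\<sigma> permutes {..<m}"
  shows "sum_mset (filter_mset (\<lambda>k. 2 \<le> k) (cycle_type m \<sigma>)) = card {x\<in>{..<m}. \<sigma> x \<noteq> x}"
proof -
  have p: "permutation \<sigma>" using assms permutation_permutes by blast
  show ?thesis
    unfolding cycle_type_eq_class_sizes
    using sum_filter_class_sizes[OF _ classes_on_funpow[OF assms], of "\<lambda>k. 2 \<le> k",
        unfolded Image_funpow_eq_orbit[OF p] card_orbit_ge2_iff[OF p]]
    by simp
qed

section \<open>Matchings and their mate involutions\<close>

text \<open>A matching is handled as a fixed-point-free involution of the vertices; the default
  \<open>x\<close> makes it the identity elsewhere, hence a permutation of
  \<open>{..<2*n}\<close>.\<close>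

definition mate :: "matching \<Rightarrow> nat \<Rightarrow> nat" where
  "mate A x = (if \<exists>y. {x, y} \<in> A then THE y. {x, y} \<in> A else x)"

lemma matching_edge:
  assumes "A \<in> matchings n" "{x, y} \<in> A"
  shows "x < 2*n" "y < 2*n" "x \<noteq> y"
proof -
  have "card {x, y} = 2" "{x, y} \<subseteq> {..<2*n}" using assms unfolding matchings_def by blast+
  then show "x < 2*n" "y < 2*n" "x \<noteq> y" by (auto simp: card_insert_if split: if_splits)
qed

lemma matching_edge_obtain:
  assumes "A \<in> matchings n" "e \<in> A"
  obtains x y where "e = {x, y}" "x \<noteq> y" "x < 2*n" "y < 2*n"
proof -
  have "card e = 2" "e \<subseteq> {..<2*n}" using assms unfolding matchings_def by blast+
  then show ?thesis using that by (auto simp: card_2_iff)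
qed

lemma matching_ex1_mate:
  assumes "A \<in> matchings n" "x < 2*n"
  shows "\<exists>!y. {x, y} \<in> A"
proof -
  have ex1: "\<exists>!e. e \<in> A \<and> x \<in> e" using assms unfolding matchings_def by blast
  then obtain e where e: "e \<in> A" "x \<in> e" by blast
  obtain u v where "e = {u, v}" using matching_edge_obtain[OF assms(1) e(1)] by metis
  then have "\<exists>y. e = {x, y}" using e(2) by auto
  then obtain y where "{x, y} \<in> A" using e by blast
  moreover have "z = y" if "{x, z} \<in> A" "{x, y} \<in> A" for y z
  proof -
    have "{x, z} = {x, y}" using ex1 that by blast
    then show ?thesis by (auto simp: doubleton_eq_iff)
  qed
  ultimately show ?thesis by blast
qed

lemma mate_iff:
  assumes "A \<in> matchings n" "x < 2*n"
  shows "{x, y} \<in> A \<longleftrightarrow> y = mate A x"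
  using matching_ex1_mate[OF assms] theI'[OF matching_ex1_mate[OF assms]]
  unfolding mate_def by metis

lemma mate_edge: "A \<in> matchings n \<Longrightarrow> x < 2*n \<Longrightarrow> {x, mate A x} \<in> A"
  by (simp add: mate_iff)

lemma mate_outside:
  assumes "A \<in> matchings n" "\<not> x < 2*n"
  shows "mate A x = x"
  using matching_edge[OF assms(1)] assms(2) unfolding mate_def by metis

lemma mate_less: "A \<in> matchings n \<Longrightarrow> mate A x < 2*n \<longleftrightarrow> x < 2*n"
  by (metis matching_edge(2) mate_edge mate_outside)

lemma mate_neq: "A \<in> matchings n \<Longrightarrow> x < 2*n \<Longrightarrow> mate A x \<noteq> x"
  by (metis matching_edge(3) mate_edge)

lemma mate_mate:
  assumes "A \<in> matchings n"
  shows "mate A (mate A x) = x"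
proof (cases "x < 2*n")
  case True
  then have "{mate A x, x} \<in> A" using mate_edge[OF assms True] by (simp add: insert_commute)
  then show ?thesis using mate_iff[OF assms] mate_less[OF assms] True by metis
qed (simp add: mate_outside[OF assms])

lemma mate_permutes:
  assumes "A \<in> matchings n"
  shows "mate A permutes {..<2*n}"
proof (rule bij_imp_permutes)
  show "bij_betw (mate A) {..<2*n} {..<2*n}"
    by (rule bij_betwI[where g = "mate A"]) (auto simp: mate_less[OF assms] mate_mate[OF assms])
qed (simp add: mate_outside[OF assms])

lemma matching_eq_range_mate:
  assumes "A \<in> matchings n"
  shows "A = (\<lambda>x. {x, mate A x}) ` {..<2*n}"
proof (intro equalityI subsetI)
  fix e assume "e \<in> A"
  then obtain x y where "e = {x, y}" "x < 2*n" using matching_edge_obtain[OF assms] by metis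
  then show "e \<in> (\<lambda>x. {x, mate A x}) ` {..<2*n}"
    using mate_iff[OF assms, of x y] \<open>e \<in> A\<close> by auto
qed (use mate_edge[OF assms] in auto)

lemma matching_eqI:
  assumes "A \<in> matchings n" "B \<in> matchings n" "\<And>x. x < 2*n \<Longrightarrow> mate A x = mate B x"
  shows "A = B"
  using matching_eq_range_mate[OF assms(1)] matching_eq_range_mate[OF assms(2)] assms(3)
  by (metis (no_types, lifting) image_cong lessThan_iff)

lemma finite_matchings: "finite (matchings n)"
proof (rule finite_subset)
  show "matchings n \<subseteq> Pow (Pow {..<2*n})" by (auto simp: matchings_def)
qed simp

text \<open>The converse construction: the two-point orbits of a fixed-point-free involution form a
  perfect matching.\<close>

lemma range_involution_matching:
  fixes m :: "nat \<Rightarrow> nat"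
  assumes "\<And>x. x < 2*n \<Longrightarrow> m x < 2*n" "\<And>x. x < 2*n \<Longrightarrow> m (m x) = x" "\<And>x. x < 2*n \<Longrightarrow> m x \<noteq> x"
  defines "A \<equiv> (\<lambda>x. {x, m x}) ` {..<2*n}"
  shows "A \<in> matchings n" "\<And>x. x < 2*n \<Longrightarrow> mate A x = m x"
proof -
  have uniq: "e = {v, m v}" if e: "e \<in> A" "v \<in> e" for e v
  proof -
    obtain x where x: "x < 2*n" "e = {x, m x}" using e(1) unfolding A_def by auto
    then consider "v = x" | "v = m x" using e(2) by auto
    then show ?thesis using x assms(2)[OF x(1)] by cases (simp_all add: insert_commute)
  qed
  show A: "A \<in> matchings n"
    unfolding matchings_def
  proof (intro CollectI conjI ballI allI impI)
    fix e assume "e \<in> A"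
    then obtain x where x: "x < 2*n" "e = {x, m x}" unfolding A_def by auto
    then show "card e = 2" "e \<subseteq> {..<2*n}" using assms(1,3)[of x] by (auto simp: card_insert_if)
  next
    fix v assume "v < 2*n"
    then have "{v, m v} \<in> A" unfolding A_def by auto
    then show "\<exists>!e. e \<in> A \<and> v \<in> e" using uniq by blast
  qed
  fix x assume "x < 2*n"
  moreover have "{x, m x} \<in> A" using calculation unfolding A_def by auto
  ultimately show "mate A x = m x" using mate_iff[OF A] by metis
qed

section \<open>Relabelling matchings by permutations\<close>

lemma act_m_pair:
  assumes "\<sigma> permutes S"
  shows "{\<sigma> x, \<sigma> y} \<in> act_m \<sigma> A \<longleftrightarrow> {x, y} \<in> A"
proof -
  have "inj ((`) \<sigma>)" using permutes_inj[OF assms] by (simp add: inj_image_eq_iff inj_def)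
  from inj_image_mem_iff[OF this, of "{x, y}" A] show ?thesis unfolding act_m_def by simp
qed

lemma act_m_comp: "act_m (f \<circ> g) A = act_m f (act_m g A)"
  by (simp add: act_m_def image_comp comp_def)

lemma act_m_id [simp]: "act_m id A = A"
  by (simp add: act_m_def)

lemma act_m_inv:
  assumes "\<sigma> permutes S"
  shows "act_m (inv \<sigma>) (act_m \<sigma> A) = A" "act_m \<sigma> (act_m (inv \<sigma>) A) = A"
  using permutes_inv_o[OF assms] by (simp_all flip: act_m_comp)

lemma act_m_matching_mate:
  assumes "\<sigma> permutes {..<2*n}" "A \<in> matchings n"
  shows "act_m \<sigma> A \<in> matchings n" "mate (act_m \<sigma> A) (\<sigma> x) = \<sigma> (mate A x)"
proof -
  \<comment> \<open>The mate function of the relabelled matching will be the conjugate of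
    \<open>mate A\<close> by \<open>\<sigma>\<close>.\<close>
  define m where "m = (\<lambda>x. \<sigma> (mate A (inv \<sigma> x)))"
  note inv = permutes_inverses[OF assms(1)]
  have mem: "\<sigma> y < 2*n \<longleftrightarrow> y < 2*n" "inv \<sigma> y < 2*n \<longleftrightarrow> y < 2*n" for y
    using permutes_in_image[OF assms(1), of y] permutes_in_image[OF permutes_inv[OF assms(1)], of y] by auto
  have m: "m x < 2*n" "m (m x) = x" "m x \<noteq> x" if "x < 2*n" for x
  proof -
    show "m x < 2*n" "m (m x) = x" using that
      by (simp_all add: m_def mem mate_less[OF assms(2)] mate_mate[OF assms(2)] inv)
    have "mate A (inv \<sigma> x) \<noteq> inv \<sigma> x" using that by (intro mate_neq[OF assms(2)]) (simp add: mem)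
    then show "m x \<noteq> x" unfolding m_def by (metis inv(2))
  qed
  have "act_m \<sigma> A = (\<lambda>x. \<sigma> ` {x, mate A x}) ` {..<2*n}"
    unfolding act_m_def by (subst matching_eq_range_mate[OF assms(2)]) (simp add: image_image)
  also have "\<dots> = (\<lambda>x. {x, m x}) ` \<sigma> ` {..<2*n}"
    by (simp add: image_image m_def inv)
  finally have eq: "act_m \<sigma> A = (\<lambda>x. {x, m x}) ` {..<2*n}"
    unfolding permutes_image[OF assms(1)] .
  show M: "act_m \<sigma> A \<in> matchings n"
    unfolding eq by (rule range_involution_matching(1)) (use m in auto)
  show "mate (act_m \<sigma> A) (\<sigma> x) = \<sigma> (mate A x)"
  proof (cases "x < 2*n")
    case True
    have "mate (act_m \<sigma> A) (\<sigma> x) = m (\<sigma> x)"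
      unfolding eq by (rule range_involution_matching(2)) (use m True mem in auto)
    then show ?thesis by (simp add: m_def inv)
  qed (simp add: mem mate_outside[OF M] mate_outside[OF assms(2)])
qed

lemma act_m_eq_iff:
  assumes "\<sigma> permutes {..<2*n}" "A \<in> matchings n" "B \<in> matchings n"
  shows "act_m \<sigma> A = B \<longleftrightarrow> (\<forall>x<2*n. mate B (\<sigma> x) = \<sigma> (mate A x))"
proof
  assume R: "\<forall>x<2*n. mate B (\<sigma> x) = \<sigma> (mate A x)"
  show "act_m \<sigma> A = B"
  proof (rule matching_eqI[OF act_m_matching_mate(1)[OF assms(1,2)] assms(3)])
    fix x assume "x < 2*n"
    moreover obtain y where "x = \<sigma> y" using permutes_surj[OF assms(1)] by blast
    ultimately show "mate (act_m \<sigma> A) x = mate B x"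
      using R permutes_in_image[OF assms(1), of y] by (simp add: act_m_matching_mate(2)[OF assms(1,2)])
  qed
qed (use act_m_matching_mate(2)[OF assms(1,2)] in auto)

lemma act_m_bij_betw:
  assumes "\<sigma> permutes {..<2*n}"
  shows "bij_betw (act_m \<sigma>) (matchings n) (matchings n)"
proof (rule bij_betwI[where g = "act_m (inv \<sigma>)"])
  show "act_m \<sigma> \<in> matchings n \<rightarrow> matchings n" "act_m (inv \<sigma>) \<in> matchings n \<rightarrow> matchings n"
    using act_m_matching_mate(1)[OF assms] act_m_matching_mate(1)[OF permutes_inv[OF assms]] by blast+
qed (simp_all add: act_m_inv[OF assms])

lemma conn_act_m:
  assumes "\<sigma> permutes {..<2*n}"
  shows "conn (act_m \<sigma> A) (act_m \<sigma> B) `` {\<sigma> x} = \<sigma> ` (conn A B `` {x})"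
proof -
  \<comment> \<open>Quantified over the permutation, so that it serves for \<open>\<sigma>\<close>
    and, in the reverse inclusion, for its inverse.\<close>
  have 1: "(\<tau> u, \<tau> v) \<in> conn (act_m \<tau> C) (act_m \<tau> D)"
    if "(u, v) \<in> conn C D" "\<tau> permutes {..<2*n}" for \<tau> u v C D
    using that(1) unfolding conn_def
  proof (induction rule: rtrancl_induct)
    case (step y z)
    then have "{\<tau> y, \<tau> z} \<in> act_m \<tau> C \<union> act_m \<tau> D" using act_m_pair[OF that(2)] by auto
    then show ?case using step.IH by (simp add: rtrancl.rtrancl_into_rtrancl)
  qed simp
  show ?thesis
  proof (intro equalityI subsetI)
    fix y assume "y \<in> conn (act_m \<sigma> A) (act_m \<sigma> B) `` {\<sigma> x}"
    then have "(inv \<sigma> (\<sigma> x), inv \<sigma> y) \<in> conn A B"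
      using 1[of "\<sigma> x" y "act_m \<sigma> A" "act_m \<sigma> B" "inv \<sigma>"] permutes_inv[OF assms] act_m_inv[OF assms] by simp
    then show "y \<in> \<sigma> ` (conn A B `` {x})"
      unfolding permutes_inverses(2)[OF assms]
      by (intro image_eqI[of _ _ "inv \<sigma> y"]) (simp_all add: permutes_inverses(1)[OF assms])
  next
    fix y assume "y \<in> \<sigma> ` (conn A B `` {x})"
    then obtain z where "(x, z) \<in> conn A B" "y = \<sigma> z" by blast
    then show "y \<in> conn (act_m \<sigma> A) (act_m \<sigma> B) `` {\<sigma> x}"
      using 1[OF _ assms] by simp
  qed
qed

lemma dmatch_act_m:
  assumes "\<sigma> permutes {..<2*n}"
  shows "dmatch n (act_m \<sigma> A) (act_m \<sigma> B) = dmatch n A B"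
  unfolding dmatch_eq_class_sizes
  by (rule class_sizes_relabel[OF _ assms]) (simp_all add: conn_act_m[OF assms])

lemma dmatch_commute: "dmatch n A B = dmatch n B A"
  by (simp add: dmatch_def conn_def Un_commute)

section \<open>Pairs of matchings\<close>

locale matching_pair =
  fixes n :: nat and A B :: matching
  assumes A: "A \<in> matchings n" and B: "B \<in> matchings n"
begin

text \<open>Two steps along an alternating cycle of \<open>A \<union> B\<close>, first an edge of
  \<open>A\<close> and then one of \<open>B\<close>; each component splits into two orbits of
  \<open>rot\<close> of equal size.\<close>

definition rot :: "nat \<Rightarrow> nat" where
  "rot = mate B \<circ> mate A"

lemma rot_permutes: "rot permutes {..<2*n}"
  unfolding rot_def by (intro permutes_compose mate_permutes A B)

lemma permutation_rot: "permutation rot"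
  using rot_permutes permutation_permutes by blast

lemma rot_apply: "rot x = mate B (mate A x)"
  by (simp add: rot_def)

lemma mateB_rot: "mate B (rot x) = mate A x"
  by (simp add: rot_apply mate_mate[OF B])

lemma mateA_less [simp]: "mate A x < 2*n \<longleftrightarrow> x < 2*n"
  and mateB_less [simp]: "mate B x < 2*n \<longleftrightarrow> x < 2*n"
  and rot_less [simp]: "rot x < 2*n \<longleftrightarrow> x < 2*n"
  by (simp_all add: mate_less[OF A] mate_less[OF B] rot_apply)

lemma funpow_rot_less [simp]: "(rot ^^ i) x < 2*n \<longleftrightarrow> x < 2*n"
  by (induction i) simp_all

lemma rot_eq_iff: "rot x = x \<longleftrightarrow> mate A x = mate B x"
  unfolding rot_apply using mate_mate[OF B] by metis

text \<open>Conjugation by \<^term>\<open>mate A\<close> inverts \<^term>\<open>rot\<close>; hence an equation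
  \<open>mate A x = rot\<^sup>m x\<close> descends to one with \<open>m - 2\<close>, and finally to a fixed point of an involution
  that has none.\<close>

lemma mate_neq_funpow_rot: "x < 2*n \<Longrightarrow> mate A x \<noteq> (rot ^^ m) x"
proof (induction m arbitrary: x rule: induct_nat_012)
  case 0
  then show ?case using mate_neq[OF A] by simp
next
  case 1
  then show ?case using mate_neq[OF B, of "mate A x"] by (simp add: rot_apply)
next
  case (ge2 m)
  show ?case
  proof
    assume "mate A x = (rot ^^ Suc (Suc m)) x"
    then have "rot (mate A (rot x)) = rot ((rot ^^ m) (rot x))"
      by (simp add: rot_apply[of "mate A _"] mate_mate[OF A] mateB_rot funpow_swap1)
    then have "mate A (rot x) = (rot ^^ m) (rot x)"
      using permutes_inj[OF rot_permutes] by (simp add: inj_eq)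
    then show False using ge2.IH(1)[of "rot x"] ge2.prems by simp
  qed
qed

text \<open>Any point of the orbit is an iterate of any other, so \<open>mate_neq_funpow_rot\<close>
  applies: an edge of \<open>A\<close> leaves the orbit.\<close>

lemma mate_notin_orbit:
  assumes "x < 2*n" "y \<in> orbit rot x" "z \<in> orbit rot x"
  shows "mate A y \<noteq> z"
proof
  assume eq: "mate A y = z"
  have "y < 2*n" using assms permutes_orbit_subset[OF rot_permutes, of x] by auto
  moreover have "z \<in> orbit rot y" using assms permutation_orbit_eq[OF permutation_rot] by simp
  ultimately show False
    using eq mate_neq_funpow_rot[of y] by (auto simp: orbit_altdef_permutation[OF permutation_rot])
qed

lemma conn_edge: "{u, v} \<in> A \<union> B \<longleftrightarrow> u < 2*n \<and> (v = mate A u \<or> v = mate B u)"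
  using matching_edge(1)[OF A] matching_edge(1)[OF B] mate_iff[OF A] mate_iff[OF B] by blast

lemma conn_mate: "x < 2*n \<Longrightarrow> (x, mate A x) \<in> conn A B" "x < 2*n \<Longrightarrow> (x, mate B x) \<in> conn A B"
  unfolding conn_def by (auto simp only: conn_edge intro!: r_into_rtrancl)

lemma conn_trans: "(x, y) \<in> conn A B \<Longrightarrow> (y, z) \<in> conn A B \<Longrightarrow> (x, z) \<in> conn A B"
  unfolding conn_def by (rule rtrancl_trans)

lemma conn_sym: "(x, y) \<in> conn A B \<Longrightarrow> (y, x) \<in> conn A B"
proof -
  have "sym {(u, v). {u, v} \<in> A \<union> B}" by (auto intro!: symI simp: insert_commute)
  then show "(x, y) \<in> conn A B \<Longrightarrow> (y, x) \<in> conn A B"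
    unfolding conn_def using sym_rtrancl symD by metis
qed

lemma conn_closed:
  assumes "(x, y) \<in> conn A B" "x \<in> U"
    "\<And>u. u \<in> U \<Longrightarrow> u < 2*n \<Longrightarrow> mate A u \<in> U \<and> mate B u \<in> U"
  shows "y \<in> U"
  using assms(1) unfolding conn_def
proof (induction rule: rtrancl_induct)
  case (step y z)
  then have "y < 2*n \<and> (z = mate A y \<or> z = mate B y)" using conn_edge by simp
  then show ?case using assms(3)[OF step.IH] by auto
qed (rule assms(2))

lemma classes_on_conn: "classes_on {..<2*n} (conn A B)"
  unfolding classes_on_def
proof (intro ballI conjI)
  fix x assume "x \<in> {..<2*n}"
  then show "conn A B `` {x} \<subseteq> {..<2*n}"
    using conn_closed[of x _ "{..<2*n}"] by auto
  show "x \<in> conn A B `` {x}" by (simp add: conn_def)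
  fix y assume "y \<in> conn A B `` {x}"
  then show "conn A B `` {y} = conn A B `` {x}"
    using conn_trans conn_sym by blast
qed

lemma rot_conn: "x < 2*n \<Longrightarrow> (x, rot x) \<in> conn A B"
  using conn_trans[OF conn_mate(1) conn_mate(2)] by (simp add: rot_apply)

lemma orbit_obtain:
  assumes "y \<in> orbit rot x"
  obtains z where "z \<in> orbit rot x" "y = rot z"
  using assms
proof cases
  case base
  then show ?thesis using that permutation_self_in_orbit[OF permutation_rot] by blast
next
  case (step y)
  then show ?thesis using that by blast
qed

text \<open>The right side is closed under both mates: \<open>mate A\<close> exchanges its two
  halves, and \<open>mate B\<close> exchanges \<open>rot z\<close> and \<open>mate A z\<close>.
  Conversely, all its points are reached along edges.\<close>

lemma conn_class:
  assumes "x < 2*n"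
  shows "conn A B `` {x} = orbit rot x \<union> mate A ` orbit rot x"
proof (intro equalityI subsetI)
  fix y assume "y \<in> conn A B `` {x}"
  then have xy: "(x, y) \<in> conn A B" by simp
  show "y \<in> orbit rot x \<union> mate A ` orbit rot x"
  proof (rule conn_closed[OF xy])
    show "x \<in> orbit rot x \<union> mate A ` orbit rot x"
      using permutation_self_in_orbit[OF permutation_rot] by blast
    fix u assume "u \<in> orbit rot x \<union> mate A ` orbit rot x"
    then consider "u \<in> orbit rot x" | v where "v \<in> orbit rot x" "u = mate A v" by blast
    then show "mate A u \<in> orbit rot x \<union> mate A ` orbit rot x \<and> mate B u \<in> orbit rot x \<union> mate A ` orbit rot x"
    proof cases
      case 1
      then obtain z where "z \<in> orbit rot x" "u = rot z" by (rule orbit_obtain)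
      then show ?thesis using 1 by (simp add: mateB_rot)
    next
      case 2
      then show ?thesis using orbit.step[of v rot x] by (simp add: mate_mate[OF A] rot_apply)
    qed
  qed
next
  have *: "y < 2*n \<and> (x, y) \<in> conn A B" if "y \<in> orbit rot x" for y
    using that
  proof induction
    case base
    then show ?case using rot_conn assms by simp
  next
    case (step y)
    then show ?case using rot_conn[of y] conn_trans by auto
  qed
  fix y assume "y \<in> orbit rot x \<union> mate A ` orbit rot x"
  then show "y \<in> conn A B `` {x}" using * conn_mate(1) conn_trans by blast
qed

lemma card_conn_class:
  assumes "x < 2*n"
  shows "card (conn A B `` {x}) = 2 * card (orbit rot x)"
proof -
  have fin: "finite (orbit rot x)"
    by (rule finite_orbit[OF permutation_self_in_orbit[OF permutation_rot]])
  have "orbit rot x \<inter> mate A ` orbit rot x = {}"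
    using mate_notin_orbit[OF assms] by blast
  moreover have "card (mate A ` orbit rot x) = card (orbit rot x)"
    using permutes_inj_on[OF mate_permutes[OF A]] by (rule card_image)
  ultimately show ?thesis
    using fin by (simp add: conn_class[OF assms] card_Un_disjoint)
qed

lemma card_conn_class_ge4_iff:
  assumes "x < 2*n"
  shows "4 \<le> card (conn A B `` {x}) \<longleftrightarrow> mate A x \<noteq> mate B x"
  using card_orbit_ge2_iff[OF permutation_rot, of x] rot_eq_iff[of x]
  by (simp add: card_conn_class[OF assms])

lemma ex_dmatch_eq_double:
  "\<exists>\<nu>. is_partition \<nu> n \<and> dmatch n A B = double \<nu>"
proof -
  let ?D = "dmatch n A B"
  define \<nu> where "\<nu> = image_mset (\<lambda>k. k div 2) ?D"
  have ev: "even k \<and> 0 < k" if "k \<in># ?D" for k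
  proof -
    obtain x where "x < 2*n" "k = card (conn A B `` {x})"
      using \<open>k \<in># ?D\<close> finite_quotient_set[of "{..<2*n}"]
      by (auto simp: dmatch_def quotient_eq_image)
    moreover have "0 < k"
      using that class_sizes_pos[OF _ classes_on_conn] by (simp add: dmatch_eq_class_sizes)
    ultimately show ?thesis using card_conn_class by simp
  qed
  have "double \<nu> = image_mset (\<lambda>k. k) ?D"
    unfolding double_def \<nu>_def multiset.map_comp
    by (rule image_mset_cong) (use ev in auto)
  then have eq: "double \<nu> = ?D" by simp
  have "sum_mset (double \<nu>) = 2*n"
    unfolding eq dmatch_eq_class_sizes by (simp add: sum_class_sizes[OF _ classes_on_conn])
  then have "sum_mset \<nu> = n" by (simp add: double_def flip: sum_mset_distrib_left)
  moreover have "\<forall>x\<in>#\<nu>. 0 < x"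
  proof
    fix x assume "x \<in># \<nu>"
    then obtain k where "k \<in># ?D" "x = k div 2" unfolding \<nu>_def by auto
    then show "0 < x" using ev[of k] by (auto elim!: evenE)
  qed
  ultimately show ?thesis using eq unfolding is_partition_def by metis
qed

lemma card_moved:
  "sum_mset (filter_mset (\<lambda>k. 4 \<le> k) (dmatch n A B)) = card {x\<in>{..<2*n}. mate A x \<noteq> mate B x}"
proof -
  have "{x\<in>{..<2*n}. 4 \<le> card (conn A B `` {x})} = {x\<in>{..<2*n}. mate A x \<noteq> mate B x}"
    using card_conn_class_ge4_iff by auto
  then show ?thesis
    by (simp add: dmatch_eq_class_sizes sum_filter_class_sizes[OF _ classes_on_conn])
qed

text \<open>Coordinates on the component of \<open>r\<close>: an index along the \<open>rot\<close>
  orbit, counted modulo its size, and a flag for the image under \<open>mate A\<close>. In them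
  \<open>mate A\<close> flips the flag and \<open>mate B\<close> joins \<open>(i, True)\<close> to
  \<open>(Suc i, False)\<close>.\<close>

fun coord :: "nat \<Rightarrow> nat \<times> bool \<Rightarrow> nat" where
  "coord r (i, t) = (if t then mate A ((rot ^^ i) r) else (rot ^^ i) r)"

lemma coord_eq_iff:
  assumes "r < 2*n"
  shows "coord r (i, s) = coord r (j, t) \<longleftrightarrow>
    s = t \<and> i mod card (orbit rot r) = j mod card (orbit rot r)"
proof -
  have orb: "(rot ^^ i) r \<in> orbit rot r" for i
    by (auto simp: orbit_altdef_permutation[OF permutation_rot])
  have "mate A ((rot ^^ i) r) = mate A ((rot ^^ j) r) \<longleftrightarrow> (rot ^^ i) r = (rot ^^ j) r" for i j
    using mate_mate[OF A] by metis
  moreover have "mate A ((rot ^^ i) r) \<noteq> (rot ^^ j) r" for i j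
    using mate_notin_orbit[OF assms orb orb] .
  ultimately show ?thesis
    using funpow_eq_iff_mod_card_orbit[OF permutation_rot]
    by (cases s; cases t) (auto simp: eq_commute)
qed

lemma coord_range:
  assumes "r < 2*n"
  shows "conn A B `` {r} = range (coord r)"
proof (intro equalityI subsetI)
  fix x assume "x \<in> conn A B `` {r}"
  then obtain i where "x = (rot ^^ i) r \<or> x = mate A ((rot ^^ i) r)"
    unfolding conn_class[OF assms] orbit_altdef_permutation[OF permutation_rot] by blast
  then have "x = coord r (i, False) \<or> x = coord r (i, True)" by simp
  then show "x \<in> range (coord r)" by blast
next
  fix x assume "x \<in> range (coord r)"
  then obtain i t where "x = coord r (i, t)" by auto
  then show "x \<in> conn A B `` {r}"
    unfolding conn_class[OF assms] orbit_altdef_permutation[OF permutation_rot] by auto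
qed

lemma mateA_coord: "mate A (coord r (i, t)) = coord r (i, \<not> t)"
  by (simp add: mate_mate[OF A])

lemma mateB_coord: "mate B (coord r (i, True)) = coord r (Suc i, False)"
  "mate B (coord r (Suc i, False)) = coord r (i, True)"
  by (simp_all add: rot_apply mate_mate[OF B])

end

text \<open>Components of equal size are matched, and coordinates from chosen base points are
  transported. Both mates obey the same rules in coordinates on either side, so the resulting
  bijection carries both matchings over.\<close>

lemma pair_iso:
  assumes "A \<in> matchings n" "B \<in> matchings n" "A' \<in> matchings n" "B' \<in> matchings n"
    and eq: "dmatch n A B = dmatch n A' B'"
  shows "\<exists>g. g permutes {..<2*n} \<and> act_m g A = A' \<and> act_m g B = B'"
proof -
  interpret P: matching_pair n A B using assms by unfold_locales
  interpret Q: matching_pair n A' B' using assms by unfold_locales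
  let ?X = "{..<2*n} // conn A B" and ?Y = "{..<2*n} // conn A' B'"
  have "\<exists>h. bij_betw h ?X ?Y \<and> (\<forall>K\<in>?X. card (h K) = card K)"
    using eq unfolding dmatch_def
    by (intro bij_betw_of_image_mset_eq finite_quotient_set) simp_all
  then obtain h where h: "bij_betw h ?X ?Y" "\<And>K. K \<in> ?X \<Longrightarrow> card (h K) = card K" by blast
  \<comment> \<open>\<open>r x\<close> and \<open>r' x\<close> are base points of the component of
    \<open>x\<close> and of the component assigned to it; they depend only on
    \<open>K x\<close>.\<close>
  define K where "K = (\<lambda>x. conn A B `` {x})"
  define r where "r = (\<lambda>x. SOME y. y \<in> K x)"
  define r' where "r' = (\<lambda>x. SOME y. y \<in> h (K x))"
  have K: "K x \<in> ?X" if "x < 2*n" for x using that unfolding K_def by (auto intro: quotientI)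
  have r: "r x \<in> K x" "r x < 2*n" "K (r x) = K x" if "x < 2*n" for x
  proof -
    have "x \<in> K x" using classes_onD(1)[OF P.classes_on_conn, of x] that by (simp add: K_def)
    then show *: "r x \<in> K x" unfolding r_def by (rule someI)
    then show "r x < 2*n" "K (r x) = K x"
      using classes_on_member[OF P.classes_on_conn K[OF that], of "r x"] unfolding K_def by auto
  qed
  have r': "r' x < 2*n" "conn A' B' `` {r' x} = h (K x)" if "x < 2*n" for x
  proof -
    have hK: "h (K x) \<in> ?Y" using h(1) K[OF that] by (rule bij_betw_apply)
    then obtain y where "y < 2*n" "h (K x) = conn A' B' `` {y}" by (auto elim: quotientE)
    then have "y \<in> h (K x)" using classes_onD(1)[OF Q.classes_on_conn, of y] by simp
    then have "r' x \<in> h (K x)" unfolding r'_def by (rule someI)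
    then show "r' x < 2*n" "conn A' B' `` {r' x} = h (K x)"
      using classes_on_member[OF Q.classes_on_conn hK, of "r' x"] by auto
  qed
  have card_eq: "card (orbit P.rot (r x)) = card (orbit Q.rot (r' x))" if "x < 2*n" for x
    using P.card_conn_class[of "r x"] Q.card_conn_class[of "r' x"] r[OF that] r'[OF that] h(2)[OF K[OF that]]
    unfolding K_def by simp
  define c where "c = (\<lambda>x. SOME p. x = P.coord (r x) p)"
  have c: "x = P.coord (r x) (c x)" if "x < 2*n" for x
  proof -
    have "x \<in> K (r x)" using r(3)[OF that] classes_onD(1)[OF P.classes_on_conn, of x] that by (simp add: K_def)
    then have "\<exists>p. x = P.coord (r x) p"
      unfolding K_def P.coord_range[OF r(2)[OF that]] by blast
    then show ?thesis unfolding c_def by (rule someI_ex)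
  qed
  define g where "g = (\<lambda>x. if x < 2*n then Q.coord (r' x) (c x) else x)"
  have K_eq: "K y = K x" "r y = r x" "r' y = r' x" if "y \<in> K x" "x < 2*n" for x y
  proof -
    show "K y = K x" using classes_onD(3)[OF P.classes_on_conn, of x y] that unfolding K_def by simp
    then show "r y = r x" "r' y = r' x" unfolding r_def r'_def by simp_all
  qed
  \<comment> \<open>Coincidence of coordinates depends only on the orbit size, which is the same on
    both sides; so the choice made by \<open>c\<close> does not affect \<open>g\<close>.\<close>
  have transfer: "Q.coord (r' x) (i, s) = Q.coord (r' x) (j, t) \<longleftrightarrow> P.coord (r x) (i, s) = P.coord (r x) (j, t)"
    if "x < 2*n" for x i j s t
    using P.coord_eq_iff[OF r(2)[OF that], of i s j t] Q.coord_eq_iff[OF r'(1)[OF that], of i s j t] card_eq[OF that]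
    by simp
  have g: "g (P.coord (r x) (i, t)) = Q.coord (r' x) (i, t)" if x: "x < 2*n" for x i t
  proof -
    let ?y = "P.coord (r x) (i, t)"
    have y: "?y \<in> K x" using P.coord_range[OF r(2)[OF x]] r(3)[OF x] unfolding K_def by blast
    have "K x \<subseteq> {..<2*n}" using classes_onD(2)[OF P.classes_on_conn, of x] x unfolding K_def by simp
    with y have y2: "?y < 2*n" by blast
    obtain j s where js: "c ?y = (j, s)" by (rule prod.exhaust)
    have "?y = P.coord (r x) (j, s)" using c[OF y2] unfolding js K_eq[OF y x] .
    then show ?thesis using transfer[OF x] y2 unfolding g_def js K_eq[OF y x] by auto
  qed
  have gK: "conn A' B' `` {g x} = h (K x)" "g x < 2*n" if x: "x < 2*n" for x
  proof -
    have "h (K x) \<in> ?Y" using h(1) K[OF that] by (rule bij_betw_apply)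
    moreover have "g x \<in> h (K x)"
      using r'[OF x] Q.coord_range[OF r'(1)[OF x]] x unfolding g_def by auto
    ultimately show "conn A' B' `` {g x} = h (K x)" "g x < 2*n"
      using classes_on_member[OF Q.classes_on_conn] by auto
  qed
  have inj: "inj_on g {..<2*n}"
  proof (rule inj_onI)
    fix x y assume xy: "x \<in> {..<2*n}" "y \<in> {..<2*n}" "g x = g y"
    then have "h (K x) = h (K y)" using gK(1)[of x] gK(1)[of y] by (simp only: lessThan_iff)
    then have "K x = K y"
      by (rule inj_onD[OF bij_betw_imp_inj_on[OF h(1)]]) (use K xy in simp_all)
    then have r_eq: "r y = r x" "r' y = r' x" unfolding r_def r'_def by simp_all
    obtain i s where i: "c x = (i, s)" by (rule prod.exhaust)
    obtain j t where j: "c y = (j, t)" by (rule prod.exhaust)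
    note ij = i j
    have "Q.coord (r' x) (i, s) = Q.coord (r' x) (j, t)"
      using xy r_eq ij by (simp add: g_def)
    then have "P.coord (r x) (i, s) = P.coord (r x) (j, t)" using transfer xy by simp
    moreover have "x = P.coord (r x) (i, s)" using c[of x] xy(1) unfolding ij by simp
    moreover have "y = P.coord (r x) (j, t)" using c[of y] xy(2) unfolding ij r_eq by simp
    ultimately show "x = y" by metis
  qed
  have "g ` {..<2*n} \<subseteq> {..<2*n}" using gK by auto
  then have "bij_betw g {..<2*n} {..<2*n}"
    using inj by (simp add: bij_betw_def endo_inj_surj)
  then have gp: "g permutes {..<2*n}" by (rule bij_imp_permutes) (simp add: g_def)
  have "mate A' (g x) = g (mate A x) \<and> mate B' (g x) = g (mate B x)" if x: "x < 2*n" for x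
  proof -
    obtain i t where it: "c x = (i, t)" by (rule prod.exhaust)
    have x_eq: "x = P.coord (r x) (i, t)" using c[OF x] it by simp
    have gx: "g x = Q.coord (r' x) (i, t)" using g[OF x, of i t] x_eq by simp
    have mA: "mate A x = P.coord (r x) (i, \<not> t)" using P.mateA_coord x_eq by metis
    have "mate A' (g x) = g (mate A x)"
      unfolding mA gx g[OF x] by (rule Q.mateA_coord)
    moreover have "mate B' (g x) = g (mate B x)"
    proof (cases t)
      case True
      have "mate B x = P.coord (r x) (Suc i, False)" using P.mateB_coord(1) x_eq True by metis
      moreover have "g x = Q.coord (r' x) (i, True)" using gx True by (simp only:)
      ultimately show ?thesis by (simp only: g[OF x] Q.mateB_coord)
    next
      case False
      \<comment> \<open>From flag \<open>False\<close>, \<open>mate B\<close> steps back one index.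
        Adding the orbit size leaves the point unchanged and makes a predecessor available.\<close>
      define k where "k = card (orbit P.rot (r x))"
      have "finite (orbit P.rot (r x))"
        by (rule finite_orbit[OF permutation_self_in_orbit[OF P.permutation_rot]])
      then have "0 < k" unfolding k_def using orbit_nonempty[of P.rot "r x"] by (simp add: card_gt_0_iff)
      then obtain j where j: "i + k = Suc j" by (metis add_gr_0 gr0_implies_Suc)
      have x2: "x = P.coord (r x) (Suc j, False)"
        using x_eq P.coord_eq_iff[OF r(2)[OF x], of i False "i + k" False] False
        unfolding j[symmetric] k_def by simp
      have "mate B x = P.coord (r x) (j, True)" using P.mateB_coord(2) x2 by metis
      moreover have "g x = Q.coord (r' x) (Suc j, False)" using g[OF x, of "Suc j" False] x2 by simp
      ultimately show ?thesis by (simp only: g[OF x] Q.mateB_coord)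
    qed
    ultimately show ?thesis by simp
  qed
  then have "act_m g A = A'" "act_m g B = B'"
    using act_m_eq_iff[OF gp assms(1,3)] act_m_eq_iff[OF gp assms(2,4)] by simp_all
  then show ?thesis using gp by blast
qed

text \<open>The symmetry behind Gelfand's criterion for multiplicity-freeness; it yields the
  exchange of \<open>u\<close> and \<open>v\<close> in \<open>sum_pairing_act_swap\<close>.\<close>

corollary pair_swap:
  assumes "A \<in> matchings n" "B \<in> matchings n"
  shows "\<exists>g. g permutes {..<2*n} \<and> act_m g A = B \<and> act_m g B = A"
  using pair_iso[OF assms assms(2,1) dmatch_commute] .

section \<open>Permutations carrying one matching to another\<close>

text \<open>A part 1 doubles to 2 and a part of \<open>\<tau>\<close> to at least 4, so the
  threshold 4 separates them.\<close>

lemma filter_double_pad1: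
  assumes "\<tau> \<in> P2 m"
  shows "filter_mset (\<lambda>k. 4 \<le> k) (double (pad1 \<tau> r)) = double \<tau>"
proof -
  have "filter_mset (\<lambda>k. 4 \<le> k) (double \<tau>) = double \<tau>"
    using assms by (auto simp: filter_mset_eq_conv double_def P2_def)
  moreover have "filter_mset (\<lambda>k. 4 \<le> k) (double (replicate_mset r 1)) = {#}"
    by (auto simp: double_def filter_mset_eq_conv)
  ultimately show ?thesis by (simp add: pad1_def double_def)
qed

lemma halve_double: "image_mset (\<lambda>k. k div 2) (double \<tau>) = \<tau>"
  by (simp add: double_def multiset.map_comp comp_def)

lemma sum_double: "sum_mset (double \<tau>) = 2 * sum_mset \<tau>"
  by (induction \<tau>) (simp_all add: double_def)

context matching_pair
begin

text \<open>By \<open>card_conn_class_ge4_iff\<close>, these are the vertices of the components with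
  at least four vertices.\<close>

definition moved :: "nat set" where
  "moved = {x\<in>{..<2*n}. mate A x \<noteq> mate B x}"

lemma movedD: "x \<in> moved \<Longrightarrow> x < 2*n" "x \<in> moved \<Longrightarrow> mate A x \<noteq> mate B x"
  by (simp_all add: moved_def)

lemma finite_moved: "finite moved"
  by (simp add: moved_def)

lemma moved_mate [simp]: "mate A x \<in> moved \<longleftrightarrow> x \<in> moved" "mate B x \<in> moved \<longleftrightarrow> x \<in> moved"
proof -
  have "mate A (mate A x) \<noteq> mate B (mate A x) \<longleftrightarrow> mate A x \<noteq> mate B x"
    "mate A (mate B x) \<noteq> mate B (mate B x) \<longleftrightarrow> mate A x \<noteq> mate B x"
    using mate_mate[OF A] mate_mate[OF B] by metis+
  then show "mate A x \<in> moved \<longleftrightarrow> x \<in> moved" "mate B x \<in> moved \<longleftrightarrow> x \<in> moved"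
    by (simp_all add: moved_def)
qed

text \<open>Proper 2-colourings of the nontrivial components of \<open>A \<union> B\<close>, given by one colour class.\<close>

definition coloring :: "nat set \<Rightarrow> bool" where
  "coloring S \<longleftrightarrow> S \<subseteq> moved \<and> (\<forall>x\<in>moved. (mate A x \<in> S \<longleftrightarrow> x \<notin> S) \<and> (mate B x \<in> S \<longleftrightarrow> x \<notin> S))"

lemma coloringD:
  assumes "coloring S"
  shows "x \<in> S \<Longrightarrow> x \<in> moved"
    "x \<in> moved \<Longrightarrow> mate A x \<in> S \<longleftrightarrow> x \<notin> S" "x \<in> moved \<Longrightarrow> mate B x \<in> S \<longleftrightarrow> x \<notin> S"
  using assms unfolding coloring_def by auto

text \<open>For colourings \<open>S\<close>, these will be exactly the permutations that carry
  \<open>A\<close> to \<open>B\<close> with the smallest possible support.\<close>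

definition half_rot :: "nat set \<Rightarrow> nat \<Rightarrow> nat" where
  "half_rot S x = (if x \<in> S then rot x else x)"

text \<open>If \<open>\<sigma>\<close> fixes both ends of an edge of \<open>A\<close>, that edge
  also belongs to \<open>B\<close>, and its ends are not in \<open>moved\<close>.\<close>

lemma moved_subset_support:
  assumes "\<sigma> permutes {..<2*n}" "act_m \<sigma> A = B"
  shows "moved \<subseteq> {x. \<sigma> x \<noteq> x} \<union> mate A ` {x. \<sigma> x \<noteq> x}"
proof
  fix x assume x: "x \<in> moved"
  show "x \<in> {x. \<sigma> x \<noteq> x} \<union> mate A ` {x. \<sigma> x \<noteq> x}"
  proof (cases "\<sigma> x = x")
    case True
    have "mate B (\<sigma> x) = \<sigma> (mate A x)"
      using act_m_eq_iff[OF assms(1) A B] assms(2) movedD(1)[OF x] by blast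
    then have "\<sigma> (mate A x) \<noteq> mate A x" using True movedD(2)[OF x] by simp
    then show ?thesis using mate_mate[OF A, of x] by (intro UnI2 image_eqI[of _ _ "mate A x"]) simp_all
  qed simp
qed

lemma support_finite:
  assumes "\<sigma> permutes {..<2*n}"
  shows "{x. \<sigma> x \<noteq> x} = {x\<in>{..<2*n}. \<sigma> x \<noteq> x}"
  using permutes_not_in[OF assms] by auto

lemma finite_support:
  assumes "\<sigma> permutes {..<2*n}"
  shows "finite {x. \<sigma> x \<noteq> x}"
  by (subst support_finite[OF assms]) simp

lemma card_moved_le:
  assumes "\<sigma> permutes {..<2*n}" "act_m \<sigma> A = B"
  shows "card moved \<le> 2 * card {x. \<sigma> x \<noteq> x}"
proof -
  note fin = finite_support[OF assms(1)]
  have "card moved \<le> card ({x. \<sigma> x \<noteq> x} \<union> mate A ` {x. \<sigma> x \<noteq> x})"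
    by (rule card_mono[OF _ moved_subset_support[OF assms]]) (use fin in simp)
  also have "\<dots> \<le> card {x. \<sigma> x \<noteq> x} + card (mate A ` {x. \<sigma> x \<noteq> x})" by (rule card_Un_le)
  also have "\<dots> \<le> 2 * card {x. \<sigma> x \<noteq> x}" using card_image_le[OF fin, of "mate A"] by simp
  finally show ?thesis .
qed

text \<open>Equality makes the support and its image under \<open>mate A\<close> disjoint with union
  \<open>moved\<close>, so each edge of \<open>A\<close> inside \<open>moved\<close> has exactly one
  moved end. The fixed ends then determine \<open>\<sigma>\<close>, and invariance of the support
  under \<open>\<sigma>\<close> gives the same for edges of \<open>B\<close>.\<close>

lemma support_coloring:
  assumes \<sigma>: "\<sigma> permutes {..<2*n}" "act_m \<sigma> A = B"
    and eq: "card moved = 2 * card {x. \<sigma> x \<noteq> x}"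
  shows "coloring {x. \<sigma> x \<noteq> x}" "\<sigma> = half_rot {x. \<sigma> x \<noteq> x}"
proof -
  define S where "S = {x. \<sigma> x \<noteq> x}"
  have fin: "finite S" unfolding S_def by (rule finite_support[OF \<sigma>(1)])
  have card_a: "card (mate A ` S) = card S"
    using permutes_inj_on[OF mate_permutes[OF A]] by (rule card_image)
  have sub: "moved \<subseteq> S \<union> mate A ` S" using moved_subset_support[OF \<sigma>] by (simp add: S_def)
  have le: "card (S \<union> mate A ` S) \<le> card moved"
    using card_Un_le[of S "mate A ` S"] eq card_a by (simp add: S_def)
  have mv: "moved = S \<union> mate A ` S"
    by (rule card_seteq[OF _ sub le]) (use fin in simp)
  have "card (S \<union> mate A ` S) + card (S \<inter> mate A ` S) = 2 * card S"
    using card_Un_Int[OF fin, of "mate A ` S"] fin card_a by simp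
  then have disj: "S \<inter> mate A ` S = {}"
    using eq fin unfolding mv[symmetric] S_def[symmetric] by simp
  have aS: "mate A x \<in> S \<longleftrightarrow> x \<notin> S" if "x \<in> moved" for x
  proof
    assume "mate A x \<in> S" then show "x \<notin> S" using disj by blast
  next
    assume "x \<notin> S"
    moreover have "x \<in> S \<union> mate A ` S" using that by (simp only: mv)
    ultimately obtain y where "y \<in> S" "x = mate A y" by blast
    then show "mate A x \<in> S" by (simp add: mate_mate[OF A])
  qed
  have S_sub: "S \<subseteq> moved" unfolding mv by blast
  \<comment> \<open>The \<open>A\<close>-mate of \<open>x\<close> is fixed, so the intertwining
    identity reads \<open>mate B (\<sigma> x) = mate A x\<close>.\<close>
  have rot: "\<sigma> x = rot x" if "x \<in> S" for x
  proof -
    have x: "x \<in> moved" using that S_sub by blast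
    then have "\<sigma> (mate A x) = mate A x" using aS[of x] that by (simp add: S_def)
    then have "mate B (\<sigma> x) = mate A x"
      using act_m_eq_iff[OF \<sigma>(1) A B] \<sigma>(2) movedD(1)[OF x] by metis
    then show ?thesis using mate_mate[OF B, of "\<sigma> x"] by (simp add: rot_apply)
  qed
  then show "\<sigma> = half_rot {x. \<sigma> x \<noteq> x}"
    unfolding S_def[symmetric]
  proof (intro ext)
    fix x show "\<sigma> x = half_rot S x"
      using rot[of x] by (cases "x \<in> S") (simp_all add: half_rot_def S_def)
  qed
  have inj: "inj \<sigma>" using \<sigma>(1) permutes_inj by blast
  have "\<sigma> ` S \<subseteq> S" using inj by (auto simp: S_def inj_eq)
  then have surj: "\<sigma> ` S = S" using fin inj_on_subset[OF inj] by (simp add: endo_inj_surj)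
  \<comment> \<open>If \<open>x\<close> is outside \<open>S\<close>, its \<open>A\<close>-mate is in
    \<open>S\<close> and is sent to \<open>mate B x\<close>, again in \<open>S\<close>. If
    \<open>x\<close> is in \<open>S\<close>, it is \<open>\<sigma> y\<close> with \<open>y\<close>
    in \<open>S\<close>, and \<open>mate B x = mate A y\<close> is outside \<open>S\<close>.\<close>
  have bS: "mate B x \<in> S \<longleftrightarrow> x \<notin> S" if x: "x \<in> moved" for x
  proof
    assume "x \<notin> S"
    then have "mate A x \<in> S" using aS x by simp
    then have "rot (mate A x) \<in> S" using rot surj by (metis image_eqI)
    then show "mate B x \<in> S" by (simp add: rot_apply mate_mate[OF A])
  next
    assume bx: "mate B x \<in> S"
    show "x \<notin> S"
    proof
      assume "x \<in> S"
      then obtain y where y: "y \<in> S" "x = \<sigma> y" using surj by blast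
      then have "mate A y \<in> S" using bx rot[OF y(1)] by (simp add: mateB_rot)
      then show False using aS[of y] y(1) S_sub by blast
    qed
  qed
  show "coloring {x. \<sigma> x \<noteq> x}"
    unfolding S_def[symmetric] coloring_def using S_sub aS bS by simp
qed

lemma coloring_rot: "coloring S \<Longrightarrow> x \<in> S \<Longrightarrow> rot x \<in> S"
  using coloringD by (simp add: rot_apply)

lemma half_rot_permutes:
  assumes "coloring S"
  shows "half_rot S permutes {..<2*n}"
proof -
  have inj: "inj_on (half_rot S) {..<2*n}"
  proof (rule inj_onI)
    fix x y assume eq: "half_rot S x = half_rot S y"
    have "x \<in> S \<longleftrightarrow> y \<in> S"
      using eq coloring_rot[OF assms, of x] coloring_rot[OF assms, of y]
      unfolding half_rot_def by metis
    then show "x = y" using eq permutes_inj[OF rot_permutes] by (auto simp: half_rot_def inj_eq split: if_splits)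
  qed
  have "half_rot S ` {..<2*n} \<subseteq> {..<2*n}" by (auto simp: half_rot_def)
  then have "bij_betw (half_rot S) {..<2*n} {..<2*n}"
    using inj by (simp add: bij_betw_def endo_inj_surj)
  then show ?thesis
    by (rule bij_imp_permutes) (use coloringD(1)[OF assms] movedD(1) in \<open>auto simp: half_rot_def\<close>)
qed

lemma half_rot_act_m:
  assumes "coloring S"
  shows "act_m (half_rot S) A = B"
  unfolding act_m_eq_iff[OF half_rot_permutes[OF assms] A B]
proof (intro allI impI)
  fix x assume x: "x < 2*n"
  note S = coloringD[OF assms]
  consider "x \<notin> moved" | "x \<in> moved" "x \<in> S" | "x \<in> moved" "x \<notin> S" by blast
  then show "mate B (half_rot S x) = half_rot S (mate A x)"
  proof cases
    case 1
    then have "x \<notin> S" "mate A x \<notin> S" using S(1) moved_mate(1) by blast+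
    then show ?thesis using 1 x by (simp add: half_rot_def moved_def)
  next
    case 2
    then show ?thesis using S(2)[of x] by (simp add: half_rot_def mateB_rot)
  next
    case 3
    then show ?thesis using S(2)[of x] by (simp add: half_rot_def rot_apply mate_mate[OF A])
  qed
qed

lemma half_rot_support:
  assumes "coloring S"
  shows "{x. half_rot S x \<noteq> x} = S"
proof -
  have "rot x \<noteq> x" if "x \<in> S" for x
    using movedD(2)[OF coloringD(1)[OF assms that]] by (simp add: rot_eq_iff)
  then show ?thesis by (auto simp: half_rot_def)
qed

lemma half_rot_orbit:
  assumes "coloring S" "x \<in> S"
  shows "orbit (half_rot S) x = orbit rot x" "orbit rot x \<subseteq> S"
proof -
  show sub: "orbit rot x \<subseteq> S"
  proof
    fix y assume "y \<in> orbit rot x"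
    then show "y \<in> S" by induction (use coloring_rot[OF assms(1)] assms(2) in auto)
  qed
  show "orbit (half_rot S) x = orbit rot x"
    by (rule orbit_cong[OF permutation_self_in_orbit[OF permutation_rot]])
      (use sub in \<open>auto simp: half_rot_def\<close>)
qed

text \<open>A nontrivial cycle is an orbit of \<open>rot\<close> inside \<open>S\<close>; with its
  image under \<open>mate A\<close> it forms a nontrivial component, twice as large, and all
  nontrivial components arise in this way.\<close>

lemma half_rot_cycle_type:
  assumes "coloring S"
  shows "filter_mset (\<lambda>k. 2 \<le> k) (cycle_type (2*n) (half_rot S)) =
    image_mset (\<lambda>k. k div 2) (filter_mset (\<lambda>k. 4 \<le> k) (dmatch n A B))"
proof -
  let ?R = "{(x, y). \<exists>k. (half_rot S ^^ k) x = y}"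
  let ?Q = "(\<lambda>x. orbit rot x) ` S"
  let ?\<Phi> = "\<lambda>Z. Z \<union> mate A ` Z"
  note perm = half_rot_permutes[OF assms]
  have p: "permutation (half_rot S)" using perm permutation_permutes by blast
  have S: "x < 2*n" "x \<in> moved" if "x \<in> S" for x using coloringD(1)[OF assms that] movedD by auto
  have ge2: "2 \<le> card (orbit (half_rot S) x) \<longleftrightarrow> x \<in> S" for x
    using half_rot_support[OF assms] unfolding card_orbit_ge2_iff[OF p] by blast
  have fin: "finite ?Q" using finite_subset[of S moved] finite_moved coloringD(1)[OF assms] by blast
  have "{K \<in> {..<2*n} // ?R. 2 \<le> card K} = (\<lambda>x. orbit (half_rot S) x) ` {x\<in>{..<2*n}. 2 \<le> card (orbit (half_rot S) x)}"
    unfolding quotient_eq_image Image_funpow_eq_orbit[OF p] by blast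
  also have "{x\<in>{..<2*n}. 2 \<le> card (orbit (half_rot S) x)} = S" using S(1) by (auto simp: ge2)
  also have "(\<lambda>x. orbit (half_rot S) x) ` S = ?Q"
    by (rule image_cong) (use half_rot_orbit[OF assms] in auto)
  finally have cyc: "{K \<in> {..<2*n} // ?R. 2 \<le> card K} = ?Q" .
  have "{K \<in> {..<2*n} // conn A B. 4 \<le> card K} = (\<lambda>x. conn A B `` {x}) ` moved"
    unfolding quotient_eq_image moved_def using card_conn_class_ge4_iff by auto
  also have "\<dots> = (\<lambda>x. conn A B `` {x}) ` S"
  proof (intro equalityI subsetI)
    fix K assume "K \<in> (\<lambda>x. conn A B `` {x}) ` moved"
    then obtain x where x: "x \<in> moved" "K = conn A B `` {x}" by blast
    have "K = conn A B `` {mate A x}"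
      unfolding x(2) by (rule sym, rule classes_onD(3)[OF classes_on_conn])
        (use movedD(1)[OF x(1)] conn_mate in auto)
    moreover have "x \<in> S \<or> mate A x \<in> S" using coloringD(2)[OF assms x(1)] by blast
    ultimately show "K \<in> (\<lambda>x. conn A B `` {x}) ` S" using x(2) by blast
  qed (use S(2) in blast)
  also have "\<dots> = ?\<Phi> ` ?Q" unfolding image_image by (rule image_cong) (use conn_class S(1) in auto)
  finally have con: "{K \<in> {..<2*n} // conn A B. 4 \<le> card K} = ?\<Phi> ` ?Q" .
  \<comment> \<open>Intersecting a component with \<open>S\<close> recovers the cycle, since
    \<open>mate A\<close> maps \<open>S\<close> outside \<open>S\<close>.\<close>
  have inj: "inj_on ?\<Phi> ?Q"
  proof (rule inj_on_inverseI[where g = "\<lambda>K. K \<inter> S"])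
    fix Z assume "Z \<in> ?Q"
    then obtain x where "x \<in> S" "Z = orbit rot x" by blast
    then have "Z \<subseteq> S" using half_rot_orbit(2)[OF assms] by simp
    then show "?\<Phi> Z \<inter> S = Z" using coloringD(1,2)[OF assms] by blast
  qed
  have "image_mset (\<lambda>k. k div 2) (filter_mset (\<lambda>k. 4 \<le> k) (dmatch n A B)) =
      image_mset (\<lambda>k. k div 2) (image_mset card (image_mset ?\<Phi> (mset_set ?Q)))"
    by (simp add: dmatch_eq_class_sizes filter_class_sizes con image_mset_mset_set[OF inj])
  also have "\<dots> = image_mset (\<lambda>Z. card (?\<Phi> Z) div 2) (mset_set ?Q)"
    by (simp add: multiset.map_comp comp_def)
  also have "\<dots> = image_mset card (mset_set ?Q)"
  proof (rule image_mset_cong)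
    fix Z assume "Z \<in># mset_set ?Q"
    then obtain x where x: "x \<in> S" "Z = orbit rot x" using fin by auto
    show "card (?\<Phi> Z) div 2 = card Z"
      using card_conn_class[of x] S(1)[OF x(1)] unfolding x(2) conn_class[OF S(1)[OF x(1)]] by simp
  qed
  also have "\<dots> = filter_mset (\<lambda>k. 2 \<le> k) (cycle_type (2*n) (half_rot S))"
    unfolding cycle_type_eq_class_sizes by (subst filter_class_sizes) (simp_all only: cyc finite_lessThan)
  finally show ?thesis ..
qed

text \<open>Crossing an edge changes both colours, so whether the colourings agree is constant along
  a component.\<close>

lemma coloring_agree:
  assumes "coloring S" "coloring T" "(x, y) \<in> conn A B" "x \<in> moved"
  shows "((y \<in> S) = (y \<in> T)) = ((x \<in> S) = (x \<in> T))"
proof -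
  have "y \<in> {z \<in> moved. ((z \<in> S) = (z \<in> T)) = ((x \<in> S) = (x \<in> T))}"
    by (rule conn_closed[OF assms(3)])
      (use assms(4) coloringD(2,3)[OF assms(1)] coloringD(2,3)[OF assms(2)] in auto)
  then show ?thesis by simp
qed

text \<open>Relative to one fixed colouring \<open>S0\<close>, a colouring amounts to the set of
  nontrivial components on which it agrees with \<open>S0\<close>.\<close>

lemma card_colorings:
  "card {S. coloring S} = 2 ^ card {K \<in> {..<2*n} // conn A B. 4 \<le> card K}"
proof -
  let ?Q = "{K \<in> {..<2*n} // conn A B. 4 \<le> card K}"
  define K where "K = (\<lambda>x. conn A B `` {x})"
  define r where "r = (\<lambda>K. SOME x. (x::nat) \<in> (K::nat set))"
  \<comment> \<open>From each nontrivial component, the \<open>rot\<close> orbit through its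
    representative.\<close>
  define S0 where "S0 = {x\<in>moved. x \<in> orbit rot (r (K x))}"
  have K: "K x \<in> ?Q" if "x \<in> moved" for x
    using movedD[OF that] card_conn_class_ge4_iff[of x] unfolding K_def by (auto intro: quotientI)
  have r: "r L \<in> moved" "K (r L) = L" if L: "L \<in> ?Q" for L
  proof -
    have "L \<noteq> {}" using L by auto
    then have "r L \<in> L" unfolding r_def by (simp add: some_in_eq)
    then show KL: "K (r L) = L" and "r L \<in> moved"
      using classes_on_member[OF classes_on_conn, of L "r L"] card_conn_class_ge4_iff[of "r L"] L
      unfolding K_def moved_def by auto
  qed
  have K_mate: "K (mate A x) = K x" "K (mate B x) = K x" if "x \<in> moved" for x
    using classes_onD(3)[OF classes_on_conn, of x] conn_mate movedD(1)[OF that] unfolding K_def by auto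
  have S0: "coloring S0"
    unfolding coloring_def
  proof (intro conjI ballI)
    show "S0 \<subseteq> moved" by (auto simp: S0_def)
    fix x assume x: "x \<in> moved"
    define q where "q = r (K x)"
    have q: "q < 2*n" "K q = K x" using r[OF K[OF x]] movedD(1) by (simp_all add: q_def)
    have "x \<in> K x" using classes_onD(1)[OF classes_on_conn, of x] movedD(1)[OF x] by (simp add: K_def)
    then have "x \<in> orbit rot q \<union> mate A ` orbit rot q"
      unfolding conn_class[OF q(1), symmetric] using q(2) unfolding K_def by simp
    then consider z where "z \<in> orbit rot q" "x = rot z" | z where "z \<in> orbit rot q" "x = mate A z"
      by (auto elim: orbit_obtain)
    then have "(mate A x \<in> orbit rot q \<longleftrightarrow> x \<notin> orbit rot q) \<and> (mate B x \<in> orbit rot q \<longleftrightarrow> x \<notin> orbit rot q)"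
    proof cases
      case (1 z)
      then have "x \<in> orbit rot q" using orbit.step by simp
      then show ?thesis using mate_notin_orbit[OF q(1)] 1 by (auto simp: mateB_rot)
    next
      case (2 z)
      then have "x \<notin> orbit rot q" using mate_notin_orbit[OF q(1)] by blast
      moreover have "mate A x = z" "mate B x = rot z" using 2 by (simp_all add: mate_mate[OF A] rot_apply)
      ultimately show ?thesis using 2 orbit.step by simp
    qed
    then show "mate A x \<in> S0 \<longleftrightarrow> x \<notin> S0" "mate B x \<in> S0 \<longleftrightarrow> x \<notin> S0"
      using x by (simp_all add: S0_def K_mate q_def)
  qed
  have rS0: "r L \<in> S0" if "L \<in> ?Q" for L
    unfolding S0_def using r[OF that] permutation_self_in_orbit[OF permutation_rot] by simp
  \<comment> \<open>\<open>U\<close> is the set of components of agreement. As the representatives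
    lie in \<open>S0\<close>, it is recovered by testing them.\<close>
  have "bij_betw (\<lambda>U. {x\<in>moved. (x \<in> S0) = (K x \<in> U)}) (Pow ?Q) {S. coloring S}"
  proof (rule bij_betwI[where g = "\<lambda>S. {L\<in>?Q. r L \<in> S}"])
    show "(\<lambda>U. {x\<in>moved. (x \<in> S0) = (K x \<in> U)}) \<in> Pow ?Q \<rightarrow> {S. coloring S}"
      using coloringD[OF S0] unfolding coloring_def by (auto simp: K_mate)
    show "(\<lambda>S. {L\<in>?Q. r L \<in> S}) \<in> {S. coloring S} \<rightarrow> Pow ?Q" by blast
    show "{L\<in>?Q. r L \<in> {x\<in>moved. (x \<in> S0) = (K x \<in> U)}} = U" if "U \<in> Pow ?Q" for U
    proof -
      have "r L \<in> {x\<in>moved. (x \<in> S0) = (K x \<in> U)} \<longleftrightarrow> L \<in> U" if "L \<in> ?Q" for L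
        using r[OF that] rS0[OF that] by simp
      then show ?thesis using that by blast
    qed
    show "{x\<in>moved. (x \<in> S0) = (K x \<in> {L\<in>?Q. r L \<in> S})} = S" if S: "S \<in> {S. coloring S}" for S
    proof -
      have "(x \<in> S0) = (K x \<in> {L\<in>?Q. r L \<in> S}) \<longleftrightarrow> x \<in> S" if x: "x \<in> moved" for x
      proof -
        have KQ: "K x \<in> ?Q" by (rule K[OF x])
        have "r (K x) \<in> conn A B `` {x}"
        proof -
          have "r (K x) \<in> K (r (K x))"
            using classes_onD(1)[OF classes_on_conn, of "r (K x)"] movedD(1)[OF r(1)[OF KQ]] by (simp add: K_def)
          then show ?thesis by (simp only: r(2)[OF KQ]) (simp add: K_def)
        qed
        then have agree: "((r (K x) \<in> S) = (r (K x) \<in> S0)) = ((x \<in> S) = (x \<in> S0))"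
          by (intro coloring_agree S0 x) (use S in simp_all)
        have mem: "K x \<in> {L\<in>?Q. r L \<in> S} \<longleftrightarrow> r (K x) \<in> S" using KQ by blast
        show ?thesis unfolding mem using agree rS0[OF KQ] by argo
      qed
      then have "{x\<in>moved. (x \<in> S0) = (K x \<in> {L\<in>?Q. r L \<in> S})} = {x\<in>moved. x \<in> S}"
        by (intro Collect_cong conj_cong refl)
      also have "\<dots> = S" using S by (auto simp: coloring_def)
      finally show ?thesis .
    qed
  qed
  then have "card {S. coloring S} = card (Pow ?Q)" by (rule bij_betw_same_card [symmetric])
  then show ?thesis using finite_quotient_set[of "{..<2*n}" "conn A B"] by (simp add: card_Pow)
qed

text \<open>The nontrivial components have twice \<open>sum_mset \<tau>\<close> vertices, and the
  support of \<open>\<sigma>\<close> has \<open>sum_mset \<mu>\<close> points. In the case of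
  equality \<open>\<sigma>\<close> is some \<open>half_rot\<close>, whose nontrivial cycle lengths
  are half the component sizes.\<close>

lemma transporter_sum_le:
  assumes "\<sigma> permutes {..<2*n}" "act_m \<sigma> A = B" "\<tau> \<in> P2 m" "dmatch n A B = double (pad1 \<tau> r)"
  defines "\<mu> \<equiv> filter_mset (\<lambda>k. 2 \<le> k) (cycle_type (2*n) \<sigma>)"
  shows "sum_mset \<tau> \<le> sum_mset \<mu>" "sum_mset \<tau> = sum_mset \<mu> \<Longrightarrow> \<tau> = \<mu>"
proof -
  have mv: "card moved = 2 * sum_mset \<tau>"
    using card_moved unfolding assms(4) filter_double_pad1[OF assms(3)] sum_double moved_def by simp
  have supp: "card {x. \<sigma> x \<noteq> x} = sum_mset \<mu>"
    unfolding \<mu>_def sum_nontrivial_cycles[OF assms(1)] support_finite[OF assms(1)] ..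
  show "sum_mset \<tau> \<le> sum_mset \<mu>" using card_moved_le[OF assms(1,2)] unfolding mv supp by simp
  assume "sum_mset \<tau> = sum_mset \<mu>"
  then have "card moved = 2 * card {x. \<sigma> x \<noteq> x}" unfolding mv supp by simp
  from support_coloring[OF assms(1,2) this]
  have "\<mu> = image_mset (\<lambda>k. k div 2) (filter_mset (\<lambda>k. 4 \<le> k) (dmatch n A B))"
    unfolding \<mu>_def using half_rot_cycle_type by metis
  then show "\<tau> = \<mu>" unfolding assms(4) filter_double_pad1[OF assms(3)] halve_double by simp
qed

text \<open>Here the support is as small as possible, so the permutations correspond to the
  colourings, with one binary choice for each part of \<open>\<tau>\<close>.\<close>

lemma card_transporter:
  assumes "\<tau> \<in> P2 m" "dmatch n A B = double (pad1 \<tau> r)"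
  shows "card {\<sigma>. \<sigma> permutes {..<2*n} \<and> filter_mset (\<lambda>k. 2 \<le> k) (cycle_type (2*n) \<sigma>) = \<tau> \<and> act_m \<sigma> A = B}
    = 2 ^ size \<tau>"
proof -
  let ?T = "{\<sigma>. \<sigma> permutes {..<2*n} \<and> filter_mset (\<lambda>k. 2 \<le> k) (cycle_type (2*n) \<sigma>) = \<tau> \<and> act_m \<sigma> A = B}"
  have mv: "card moved = 2 * sum_mset \<tau>"
    using card_moved unfolding assms(2) filter_double_pad1[OF assms(1)] sum_double moved_def by simp
  have "?T = half_rot ` {S. coloring S}"
  proof (intro equalityI subsetI)
    fix \<sigma> assume \<sigma>: "\<sigma> \<in> ?T"
    then have p: "\<sigma> permutes {..<2*n}" and AB: "act_m \<sigma> A = B" by blast+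
    have "card {x. \<sigma> x \<noteq> x} = sum_mset \<tau>"
      using \<sigma> sum_nontrivial_cycles[OF p] support_finite[OF p] by simp
    then have "card moved = 2 * card {x. \<sigma> x \<noteq> x}" unfolding mv by simp
    from support_coloring[OF p AB this] show "\<sigma> \<in> half_rot ` {S. coloring S}" by blast
  next
    fix \<sigma> assume "\<sigma> \<in> half_rot ` {S. coloring S}"
    then obtain S where "coloring S" "\<sigma> = half_rot S" by blast
    then show "\<sigma> \<in> ?T"
      using half_rot_permutes half_rot_act_m half_rot_cycle_type[of S]
      by (simp add: assms(2) filter_double_pad1[OF assms(1)] halve_double)
  qed
  moreover have "inj_on half_rot {S. coloring S}"
    by (rule inj_on_inverseI[where g = "\<lambda>\<sigma>. {x. \<sigma> x \<noteq> x}"]) (use half_rot_support in auto)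
  ultimately have "card ?T = card {S. coloring S}" by (simp add: card_image)
  also have "card {K \<in> {..<2*n} // conn A B. 4 \<le> card K} = size \<tau>"
    using size_filter_class_sizes[of "{..<2*n}" "\<lambda>k. 4 \<le> k" "conn A B"]
    unfolding dmatch_eq_class_sizes[symmetric] assms(2) filter_double_pad1[OF assms(1)]
    by (simp add: double_def)
  then have "card {S. coloring S} = 2 ^ size \<tau>" by (simp add: card_colorings)
  finally show ?thesis .
qed

end

section \<open>Tableaux\<close>

lemma mset_rows: "mset (rows \<nu>) = \<nu>"
  by (simp add: rows_def)

lemma sum_list_rows: "sum_list (rows \<nu>) = sum_mset \<nu>"
  by (metis mset_rows sum_mset_sum_list)

lemma rows_antimono:
  assumes "i \<le> j" "j < length (rows \<nu>)"
  shows "rows \<nu> ! j \<le> rows \<nu> ! i"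
  using sorted_rev_nth_mono[of "rows \<nu>" i j] assms by (simp add: rows_def)

lemma row_off_Suc: "i < length (rows \<nu>) \<Longrightarrow> row_off \<nu> (Suc i) = row_off \<nu> i + rows \<nu> ! i"
  by (simp add: row_off_def take_Suc_conv_app_nth)

lemma row_off_mono: "i \<le> j \<Longrightarrow> row_off \<nu> i \<le> row_off \<nu> j"
proof -
  assume "i \<le> j"
  then have "take j (rows \<nu>) = take i (rows \<nu>) @ take (j - i) (drop i (rows \<nu>))"
    by (metis le_add_diff_inverse take_add)
  then show ?thesis by (simp add: row_off_def)
qed

lemma row_off_length: "row_off \<nu> (length (rows \<nu>)) = sum_mset \<nu>"
  by (simp add: row_off_def sum_list_rows)

lemma row_of_eqI:
  assumes "r < length (rows \<nu>)" "row_off \<nu> r \<le> k" "k < row_off \<nu> (Suc r)"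
  shows "row_of \<nu> k = r"
proof -
  have "i \<le> r" if "row_off \<nu> i \<le> k" for i
    using row_off_mono[of "Suc r" i \<nu>] that assms(3) by (metis le_trans not_less not_less_eq_eq)
  moreover have "row_off \<nu> i \<le> k" if "i \<le> r" for i
    using row_off_mono[OF that, of \<nu>] assms(2) by simp
  ultimately have "{i\<in>{1..<length (rows \<nu>)}. row_off \<nu> i \<le> k} = {1..r}"
    using assms(1) by fastforce
  then show ?thesis by (simp add: row_of_def)
qed

lemma cell:
  assumes "r < length (rows \<nu>)" "c < rows \<nu> ! r"
  shows "row_off \<nu> r + c < sum_mset \<nu>" "row_of \<nu> (row_off \<nu> r + c) = r" "col_of \<nu> (row_off \<nu> r + c) = c"
proof -
  show r: "row_of \<nu> (row_off \<nu> r + c) = r"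
    by (rule row_of_eqI) (use assms in \<open>simp_all add: row_off_Suc\<close>)
  then show "col_of \<nu> (row_off \<nu> r + c) = c" by (simp add: col_of_def)
  have "row_off \<nu> r + c < row_off \<nu> (Suc r)" using assms by (simp add: row_off_Suc)
  also have "\<dots> \<le> sum_mset \<nu>" using row_off_mono[of "Suc r" "length (rows \<nu>)" \<nu>] assms(1) by (simp add: row_off_length)
  finally show "row_off \<nu> r + c < sum_mset \<nu>" .
qed

lemma row_col:
  assumes "k < sum_mset \<nu>"
  shows "row_of \<nu> k < length (rows \<nu>)" "col_of \<nu> k < rows \<nu> ! row_of \<nu> k"
    "k = row_off \<nu> (row_of \<nu> k) + col_of \<nu> k"
proof -
  define m where "m = (LEAST m. k < row_off \<nu> m)"
  have ex: "k < row_off \<nu> (length (rows \<nu>))" using assms by (simp add: row_off_length)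
  have m: "k < row_off \<nu> m" unfolding m_def by (rule LeastI, rule ex)
  have "m \<noteq> 0" using m by (auto simp: row_off_def intro: Nat.gr0I)
  then obtain r where r: "m = Suc r" by (metis not0_implies_Suc)
  have "m \<le> length (rows \<nu>)" unfolding m_def by (rule Least_le, rule ex)
  then have rl: "r < length (rows \<nu>)" by (simp add: r)
  have "\<not> k < row_off \<nu> r" using not_less_Least[of r "\<lambda>m. k < row_off \<nu> m"] r unfolding m_def by simp
  then have off: "row_off \<nu> r \<le> k" by simp
  have row: "row_of \<nu> k = r" using row_of_eqI[OF rl off] m r by simp
  show "row_of \<nu> k < length (rows \<nu>)" by (simp add: row rl)
  show "k = row_off \<nu> (row_of \<nu> k) + col_of \<nu> k" by (simp add: row col_of_def off)
  show "col_of \<nu> k < rows \<nu> ! row_of \<nu> k"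
    using m off rl by (simp add: row col_of_def r row_off_Suc)
qed

lemma row_col_inj:
  "x < sum_mset \<nu> \<Longrightarrow> y < sum_mset \<nu> \<Longrightarrow> row_of \<nu> x = row_of \<nu> y \<Longrightarrow> col_of \<nu> x = col_of \<nu> y \<Longrightarrow> x = y"
  by (metis row_col(3))

text \<open>Rows higher up are at least as long. This is the shape condition \<open>down\<close> of
  \<open>tableau_factorization\<close>.\<close>

lemma cell_above:
  assumes "x < sum_mset \<nu>" "i \<le> row_of \<nu> x"
  shows "\<exists>y<sum_mset \<nu>. row_of \<nu> y = i \<and> col_of \<nu> y = col_of \<nu> x"
proof -
  have i: "i < length (rows \<nu>)" using assms row_col(1)[OF assms(1)] by simp
  have "col_of \<nu> x < rows \<nu> ! i"
    using row_col(1,2)[OF assms(1)] rows_antimono[OF assms(2)] by (meson less_le_trans)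
  then show ?thesis using cell[OF i] by blast
qed

lemma downward_closed_eq_lessThan:
  fixes T :: "nat set"
  assumes "finite T" "\<And>x y. x \<in> T \<Longrightarrow> y \<le> x \<Longrightarrow> y \<in> T"
  shows "T = {..<card T}"
proof (cases "T = {}")
  case False
  then have "T = {..Max T}" using assms Max_in[OF assms(1)] Max_ge[OF assms(1)] by blast
  then have "T = {..<Suc (Max T)}" by (simp add: lessThan_Suc_atMost)
  then show ?thesis by (metis card_lessThan)
qed simp

text \<open>The counting core of von Neumann's lemma. For each \<open>i\<close>, a column meets the image of the first
  \<open>i\<close> rows in at most \<open>min i h\<close> cells, \<open>h\<close> being its height; as these bounds add up to the number
  of cells in the first \<open>i\<close> rows, they are all attained.\<close>

lemma tableau_factorization:
  fixes row col :: "'a \<Rightarrow> nat"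
  assumes fin: "finite X"
    and inj: "\<And>x y. x \<in> X \<Longrightarrow> y \<in> X \<Longrightarrow> row x = row y \<Longrightarrow> col x = col y \<Longrightarrow> x = y"
    and down: "\<And>x i. x \<in> X \<Longrightarrow> i \<le> row x \<Longrightarrow> \<exists>y\<in>X. row y = i \<and> col y = col x"
    and \<sigma>: "\<sigma> permutes X"
    and dist: "\<And>x y. x \<in> X \<Longrightarrow> y \<in> X \<Longrightarrow> row x = row y \<Longrightarrow> col (\<sigma> x) = col (\<sigma> y) \<Longrightarrow> x = y"
  shows "\<exists>p q. p permutes X \<and> q permutes X \<and> (\<forall>x\<in>X. row (p x) = row x) \<and>
    (\<forall>x\<in>X. col (q x) = col x) \<and> \<sigma> = q \<circ> p"
proof -
  define C where "C = (\<lambda>c. {x\<in>X. col x = c})"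
  \<comment> \<open>\<open>M c i\<close> is the part of column \<open>c\<close> in the first
    \<open>i\<close> rows; \<open>N c i\<close> is the part of these rows that
    \<open>\<sigma>\<close> sends into column \<open>c\<close>.\<close>
  define M where "M = (\<lambda>c i. {x\<in>X. col x = c \<and> row x < i})"
  define N where "N = (\<lambda>c i. {x\<in>X. col (\<sigma> x) = c \<and> row x < i})"
  have fins: "finite (C c)" "finite (M c i)" "finite (N c i)" for c i
    using fin by (simp_all add: C_def M_def N_def)
  have \<sigma>X: "\<sigma> x \<in> X \<longleftrightarrow> x \<in> X" for x by (rule permutes_in_image[OF \<sigma>])
  have injC: "inj_on row (C c)" for c using inj by (intro inj_onI) (simp add: C_def)
  have rowC: "row ` C c = {..<card (C c)}" for c
  proof -
    have "row ` C c = {..<card (row ` C c)}"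
    proof (rule downward_closed_eq_lessThan)
      fix x y assume "x \<in> row ` C c" "y \<le> x"
      then obtain z where z: "z \<in> X" "col z = c" "y \<le> row z" by (auto simp: C_def)
      from down[OF z(1,3)] show "y \<in> row ` C c" using z(2) by (auto simp: C_def)
    qed (simp add: fins)
    then show ?thesis by (simp add: card_image[OF injC])
  qed
  have card_M: "card (M c i) = min i (card (C c))" for c i
  proof -
    have "row ` M c i = row ` C c \<inter> {..<i}" by (auto simp: M_def C_def)
    also have "\<dots> = {..<min i (card (C c))}" unfolding rowC by auto
    finally have "card (row ` M c i) = min i (card (C c))" by simp
    moreover have "inj_on row (M c i)" by (rule inj_on_subset[OF injC[of c]]) (auto simp: M_def C_def)
    ultimately show ?thesis by (simp add: card_image)
  qed
  have card_N: "card (N c i) \<le> card (M c i)" for c i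
  proof -
    have "inj_on row (N c i)" using dist by (intro inj_onI) (simp add: N_def)
    then have "card (N c i) = card (row ` N c i)" by (simp add: card_image)
    also have "\<dots> \<le> card {..<i}" by (rule card_mono) (auto simp: N_def)
    finally have "card (N c i) \<le> i" by simp
    moreover have "card (N c i) = card (\<sigma> ` N c i)"
      using permutes_inj_on[OF \<sigma>] by (simp add: card_image)
    moreover have "card (\<sigma> ` N c i) \<le> card (C c)"
      by (rule card_mono[OF fins(1)]) (auto simp: N_def C_def \<sigma>X)
    ultimately show ?thesis unfolding card_M by simp
  qed
  have eq: "card (N c i) = card (M c i)" if c: "c \<in> col ` X" for c i
  proof (rule sum_mono_inv[where I = "col ` X" and f = "\<lambda>c. card (N c i)" and g = "\<lambda>c. card (M c i)"])
    have 1: "(\<Sum>c\<in>col ` X. card {x\<in>{x\<in>X. row x < i}. f x = c}) = card {x\<in>X. row x < i}"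
      if "\<And>x. x \<in> X \<Longrightarrow> f x \<in> col ` X" for f :: "'a \<Rightarrow> nat"
    proof -
      have "card {x\<in>X. row x < i} = (\<Sum>x\<in>{x\<in>X. row x < i}. 1)" by simp
      also have "\<dots> = (\<Sum>c\<in>col ` X. \<Sum>x\<in>{x\<in>{x\<in>X. row x < i}. f x = c}. 1)"
        by (rule sum.group [symmetric]) (use fin that in auto)
      finally show ?thesis by simp
    qed
    have "M c i = {x\<in>{x\<in>X. row x < i}. col x = c}" "N c i = {x\<in>{x\<in>X. row x < i}. col (\<sigma> x) = c}" for c
      by (auto simp: M_def N_def)
    then show "(\<Sum>c\<in>col ` X. card (N c i)) = (\<Sum>c\<in>col ` X. card (M c i))"
      using 1[of col] 1[of "\<lambda>x. col (\<sigma> x)"] \<sigma>X by simp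
  qed (use c fin card_N in simp_all)
  \<comment> \<open>Raising the bound past \<open>row x\<close> adds \<open>x\<close> to the cells
    sent into this column, so the minimum grows as well; the column is thus tall enough to have a
    cell in the row of \<open>x\<close>.\<close>
  have ex: "\<exists>y. y \<in> X \<and> row y = row x \<and> col y = col (\<sigma> x)" if x: "x \<in> X" for x
  proof -
    let ?c = "col (\<sigma> x)" and ?i = "row x"
    have c: "?c \<in> col ` X" using x \<sigma>X by blast
    have "insert x (N ?c ?i) \<subseteq> N ?c (Suc ?i)" "x \<notin> N ?c ?i" using x by (auto simp: N_def)
    then have "card (N ?c ?i) < card (N ?c (Suc ?i))"
      using card_mono[OF fins(3), of "insert x (N ?c ?i)" ?c "Suc ?i"] fins(3) by simp
    then have "?i < card (C ?c)" unfolding eq[OF c] card_M by linarith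
    then have "?i \<in> row ` C ?c" unfolding rowC by simp
    then show ?thesis by (auto simp: C_def)
  qed
  \<comment> \<open>\<open>p\<close> moves each cell along its row to the column in which
    \<open>\<sigma>\<close> puts it, so that the remaining factor
    \<open>\<sigma> \<circ> inv p\<close> preserves columns.\<close>
  define p where "p = (\<lambda>x. if x \<in> X then SOME y. y \<in> X \<and> row y = row x \<and> col y = col (\<sigma> x) else x)"
  have p: "p x \<in> X" "row (p x) = row x" "col (p x) = col (\<sigma> x)" if "x \<in> X" for x
    using someI_ex[OF ex[OF that]] that by (simp_all add: p_def)
  have "inj_on p X" using p dist by (intro inj_onI) metis
  moreover have "p ` X \<subseteq> X" using p(1) by blast
  ultimately have "bij_betw p X X" using fin by (simp add: bij_betw_def endo_inj_surj)
  then have pp: "p permutes X" by (rule bij_imp_permutes) (simp add: p_def)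
  have "col ((\<sigma> \<circ> inv p) x) = col x" if "x \<in> X" for x
  proof -
    have "inv p x \<in> X" using that permutes_in_image[OF permutes_inv[OF pp]] by simp
    from p(3)[OF this] show ?thesis by (simp add: permutes_inverses[OF pp])
  qed
  moreover have "\<sigma> = (\<sigma> \<circ> inv p) \<circ> p" by (simp add: fun_eq_iff permutes_inverses[OF pp])
  moreover have "\<sigma> \<circ> inv p permutes X" using permutes_compose[OF permutes_inv[OF pp] \<sigma>] .
  ultimately show ?thesis using pp p(2) by blast
qed

section \<open>The standard matching and pairs of prescribed type\<close>

definition sw :: "nat \<Rightarrow> nat" where
  "sw x = (if even x then x + 1 else x - 1)"

lemma sw_sw [simp]: "sw (sw x) = x"
  by (auto simp: sw_def)

lemma sw_neq: "sw x \<noteq> x"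
  by (auto simp: sw_def elim: oddE)

lemma even_sw [simp]: "even (sw x) \<longleftrightarrow> odd x"
  by (auto simp: sw_def)

lemma sw_less: "even m \<Longrightarrow> sw x < m \<longleftrightarrow> x < m"
  by (auto simp: sw_def elim!: evenE oddE)

lemma sw_add: "even m \<Longrightarrow> sw (m + x) = m + sw x"
  by (auto simp: sw_def elim: oddE)

definition std_matching :: "nat \<Rightarrow> matching" where
  "std_matching n = (\<lambda>x. {x, sw x}) ` {..<2*n}"

lemma std_matching: "std_matching n \<in> matchings n" "x < 2*n \<Longrightarrow> mate (std_matching n) x = sw x"
  unfolding std_matching_def
  by (rule range_involution_matching[of n sw]; simp add: sw_less sw_neq)+

lemma even_rows_double: "i < length (rows (double \<nu>)) \<Longrightarrow> even (rows (double \<nu>) ! i)"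
proof -
  assume "i < length (rows (double \<nu>))"
  then have "rows (double \<nu>) ! i \<in># double \<nu>" by (metis mset_rows nth_mem_mset)
  then show ?thesis by (auto simp: double_def)
qed

lemma even_row_off_double: "even (row_off (double \<nu>) i)"
proof -
  have "even (sum_list xs)" if "\<forall>x\<in>set xs. even x" for xs :: "nat list"
    using that by (induction xs) auto
  moreover have "\<forall>x\<in>set (take i (rows (double \<nu>))). even x"
    using even_rows_double by (auto simp: in_set_conv_nth)
  ultimately show ?thesis unfolding row_off_def by blast
qed

text \<open>Rows of a doubled shape begin at even entries and have even length, so each edge of the
  standard matching lies in one row, in columns \<open>2j\<close> and \<open>2j + 1\<close>.\<close>

lemma row_col_sw:
  assumes "x < sum_mset (double \<nu>)"
  shows "row_of (double \<nu>) (sw x) = row_of (double \<nu>) x" "col_of (double \<nu>) (sw x) = sw (col_of (double \<nu>) x)"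
    "sw x < sum_mset (double \<nu>)"
proof -
  note r = row_col[OF assms]
  have c: "sw (col_of (double \<nu>) x) < rows (double \<nu>) ! row_of (double \<nu>) x"
    using r even_rows_double[OF r(1)] by (simp add: sw_less)
  have "sw x = row_off (double \<nu>) (row_of (double \<nu>) x) + sw (col_of (double \<nu>) x)"
    by (subst r(3)) (simp add: sw_add even_row_off_double)
  then show "row_of (double \<nu>) (sw x) = row_of (double \<nu>) x" "col_of (double \<nu>) (sw x) = sw (col_of (double \<nu>) x)"
    "sw x < sum_mset (double \<nu>)"
    using cell[OF r(1) c] by simp_all
qed

text \<open>The second matching joins the columns \<open>2j + 1\<close> and \<open>2j + 2\<close> cyclically in each row of the
  tableau of \<open>double \<nu>\<close>, so that every row becomes one alternating cycle.\<close>

lemma ex_dmatch: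
  assumes "is_partition \<nu> n"
  shows "\<exists>A\<in>matchings n. \<exists>B\<in>matchings n. dmatch n A B = double \<nu>"
proof -
  let ?D = "double \<nu>"
  define L where "L = length (rows ?D)"
  define len where "len = (\<lambda>r. rows ?D ! r)"
  \<comment> \<open>In a row of length two both wrap-around cases occur and reproduce the edge of
    the standard matching, which gives a component of two vertices.\<close>
  define pc where "pc = (\<lambda>r c. if odd c then (if c + 1 = len r then 0 else c + 1)
    else (if c = 0 then len r - 1 else c - 1))"
  define m where "m = (\<lambda>x. row_off ?D (row_of ?D x) + pc (row_of ?D x) (col_of ?D x))"
  have N: "sum_mset ?D = 2*n" using assms by (simp add: sum_double is_partition_def)
  have len: "even (len r)" "0 < len r" if "r < L" for r
  proof -
    have "rows ?D ! r \<in># ?D" using that unfolding L_def by (metis mset_rows nth_mem_mset)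
    then show "even (len r)" "0 < len r" using assms by (auto simp: double_def is_partition_def len_def)
  qed
  have pc: "pc r c < len r" "pc r (pc r c) = c" "pc r c \<noteq> c" if r: "r < L" and c: "c < len r" for r c
  proof -
    obtain l where l: "len r = 2*l" "0 < l" using len[OF r] by auto
    show "pc r c < len r" "pc r (pc r c) = c" "pc r c \<noteq> c"
      using c l by (auto simp: pc_def elim!: evenE oddE, presburger)
  qed
  note rc = row_col[where \<nu> = ?D, unfolded N, folded L_def len_def]
  note cl = cell[where \<nu> = ?D, unfolded N, folded L_def len_def]
  have m: "row_of ?D (m x) = row_of ?D x" "col_of ?D (m x) = pc (row_of ?D x) (col_of ?D x)" "m x < 2*n"
    if "x < 2*n" for x
    using cl[OF rc(1)[OF that] pc(1)[OF rc(1,2)[OF that]]] by (simp_all add: m_def)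
  have mm: "m (m x) = x" "m x \<noteq> x" if "x < 2*n" for x
  proof -
    have "m y = row_off ?D (row_of ?D y) + pc (row_of ?D y) (col_of ?D y)" for y
      by (simp only: m_def)
    from this[of "m x"] show "m (m x) = x"
      unfolding m[OF that] pc(2)[OF rc(1,2)[OF that]] rc(3)[OF that, symmetric] .
    show "m x \<noteq> x" using pc(3)[OF rc(1,2)[OF that]] m(2)[OF that] by metis
  qed
  define B where "B = (\<lambda>x. {x, m x}) ` {..<2*n}"
  have mate_B: "mate B x = m x" if "x < 2*n" for x
    using range_involution_matching[of n m] m(3) mm that unfolding B_def by auto
  have BM: "B \<in> matchings n"
    using range_involution_matching(1)[of n m] m(3) mm unfolding B_def by auto
  let ?A = "std_matching n"
  interpret matching_pair n ?A B by unfold_locales (use std_matching BM in auto)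
  define R where "R = (\<lambda>r. {y\<in>{..<2*n}. row_of ?D y = r})"
  \<comment> \<open>Moving right from the first cell of a row uses edges of the two matchings
    alternately, so a row is connected.\<close>
  have first: "(row_off ?D r, row_off ?D r + c) \<in> conn ?A B" if r: "r < L" and "c < len r" for r c
    using that(2)
  proof (induction c)
    case 0
    then show ?case by (simp add: conn_def)
  next
    case (Suc c)
    let ?x = "row_off ?D r + c"
    have x: "?x < 2*n" "row_of ?D ?x = r" "col_of ?D ?x = c" using cl[OF r, of c] Suc.prems by auto
    have "(?x, row_off ?D r + Suc c) \<in> conn ?A B"
    proof (cases "even c")
      case True
      then show ?thesis
        using conn_mate(1)[OF x(1)] x(1) by (simp add: std_matching(2) sw_add even_row_off_double sw_def)
    next
      case False
      then show ?thesis
        using conn_mate(2)[OF x(1)] Suc.prems by (simp add: mate_B[OF x(1)] m_def x(2,3) pc_def)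
    qed
    then show ?case using Suc conn_trans by simp
  qed
  have first': "(row_off ?D (row_of ?D x), x) \<in> conn ?A B" if "x < 2*n" for x
    using first[OF rc(1,2)[OF that]] unfolding rc(3)[OF that, symmetric] .
  \<comment> \<open>Both mates preserve rows, so no component extends beyond a row.\<close>
  have cls: "conn ?A B `` {x} = R (row_of ?D x)" if "x < 2*n" for x
  proof (intro equalityI subsetI)
    fix y assume "y \<in> conn ?A B `` {x}"
    then have "(x, y) \<in> conn ?A B" by simp
    then show "y \<in> R (row_of ?D x)"
    proof (rule conn_closed)
      show "x \<in> R (row_of ?D x)" using that by (simp add: R_def)
      fix u assume u: "u \<in> R (row_of ?D x)" "u < 2*n"
      then show "mate ?A u \<in> R (row_of ?D x) \<and> mate B u \<in> R (row_of ?D x)"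
        using m(1,3)[OF u(2)] row_col_sw(1,3)[of u \<nu>] by (simp add: R_def std_matching(2) mate_B N)
    qed
  next
    fix y assume "y \<in> R (row_of ?D x)"
    then have "y < 2*n" "row_of ?D y = row_of ?D x" by (simp_all add: R_def)
    then show "y \<in> conn ?A B `` {x}"
      using conn_trans[OF conn_sym[OF first'[OF that]], of y] first'[of y] by simp
  qed
  have row_surj: "row_of ?D ` {..<2*n} = {..<L}"
  proof (intro equalityI subsetI)
    fix r assume "r \<in> {..<L}"
    then show "r \<in> row_of ?D ` {..<2*n}"
      using cl[of r 0] len(2)[of r] by (intro image_eqI[of _ _ "row_off ?D r + 0"]) auto
  qed (use rc(1) in auto)
  have R_eq: "R r = (\<lambda>c. row_off ?D r + c) ` {..<len r}" if "r < L" for r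
  proof (intro equalityI subsetI)
    fix y assume "y \<in> R r"
    then have y: "y < 2*n" "row_of ?D y = r" by (simp_all add: R_def)
    then show "y \<in> (\<lambda>c. row_off ?D r + c) ` {..<len r}"
      using rc(2,3)[OF y(1)] by (intro image_eqI[of _ _ "col_of ?D y"]) simp_all
  qed (use cl[OF that] in \<open>auto simp: R_def\<close>)
  have card_R: "card (R r) = len r" if "r < L" for r
    unfolding R_eq[OF that] by (subst card_image) simp_all
  have "inj_on R {..<L}"
  proof (rule inj_onI)
    fix r s assume rs: "r \<in> {..<L}" "s \<in> {..<L}" "R r = R s"
    then have "R r \<noteq> {}" using card_R[of r] len(2)[of r] by auto
    then show "r = s" using rs(3) unfolding R_def by blast
  qed
  moreover have "{..<2*n} // conn ?A B = R ` {..<L}"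
  proof -
    have "{..<2*n} // conn ?A B = (\<lambda>x. R (row_of ?D x)) ` {..<2*n}"
      unfolding quotient_eq_image by (rule image_cong) (use cls in auto)
    also have "\<dots> = R ` {..<L}" by (simp add: row_surj flip: image_image)
    finally show ?thesis .
  qed
  ultimately have "dmatch n ?A B = image_mset (\<lambda>r. card (R r)) (mset_set {..<L})"
    unfolding dmatch_def by (simp add: multiset.map_comp comp_def flip: image_mset_mset_set)
  also have "\<dots> = image_mset len (mset_set {..<L})" by (rule image_mset_cong) (simp add: card_R)
  also have "\<dots> = mset (map len [0..<L])" by (simp add: lessThan_atLeast0)
  also have "map len [0..<L] = rows ?D" unfolding len_def L_def by (rule map_nth)
  finally have "dmatch n ?A B = ?D" by (simp add: mset_rows)
  then show ?thesis using std_matching(1) BM by blast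
qed

section \<open>The Young operator\<close>

definition perm_group :: "'a set \<Rightarrow> ('a \<Rightarrow> 'a) set \<Rightarrow> bool" where
  "perm_group X G \<longleftrightarrow> (\<forall>p\<in>G. p permutes X \<and> inv p \<in> G) \<and> id \<in> G \<and> (\<forall>p\<in>G. \<forall>q\<in>G. p \<circ> q \<in> G)"

lemma perm_groupD:
  assumes "perm_group X G"
  shows "p \<in> G \<Longrightarrow> p permutes X" "p \<in> G \<Longrightarrow> inv p \<in> G" "id \<in> G" "p \<in> G \<Longrightarrow> q \<in> G \<Longrightarrow> p \<circ> q \<in> G"
  using assms unfolding perm_group_def by blast+

lemma perm_group_finite:
  assumes "perm_group X G" "finite X"
  shows "finite G"
  using finite_subset[OF _ finite_permutations[OF assms(2)], of G] perm_groupD(1)[OF assms(1)] by blast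

lemma perm_group_permutations: "perm_group X {p. p permutes X}"
  unfolding perm_group_def using permutes_inv permutes_compose permutes_id by auto

lemma perm_group_bij:
  assumes "perm_group X G"
  shows "t \<in> G \<Longrightarrow> bij_betw (\<lambda>p. t \<circ> p) G G" "t \<in> G \<Longrightarrow> bij_betw (\<lambda>p. p \<circ> t) G G" "bij_betw inv G G"
proof -
  note G = perm_groupD[OF assms]
  have inv: "t \<circ> inv t = id" "inv t \<circ> t = id" if "t \<in> G" for t
    using permutes_inv_o[OF G(1)[OF that]] by simp_all
  show "bij_betw (\<lambda>p. t \<circ> p) G G" if t: "t \<in> G"
    by (rule bij_betwI[where g = "\<lambda>p. inv t \<circ> p"]) (use G(2,4) t in \<open>simp_all add: o_assoc inv[OF t]\<close>)
  show "bij_betw (\<lambda>p. p \<circ> t) G G" if t: "t \<in> G"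
    by (rule bij_betwI[where g = "\<lambda>p. p \<circ> inv t"]) (use G(2,4) t in \<open>simp_all add: inv[OF t] flip: o_assoc\<close>)
  show "bij_betw inv G G"
    by (rule bij_betwI[where g = inv]) (use G(2) permutes_inv_inv[OF G(1)] in auto)
qed

section \<open>The action on vectors and the Young symmetrizer\<close>

lemma act_comp:
  assumes "f permutes S" "g permutes S"
  shows "act (f \<circ> g) x = act f (act g x)"
  using permutes_bij[OF assms(1)] permutes_bij[OF assms(2)]
  by (simp add: act_def o_inv_distrib act_m_comp)

lemma act_id [simp]: "act id x = x"
  by (simp add: act_def)

lemma act_act_m:
  assumes "\<sigma> permutes S"
  shows "act \<sigma> x (act_m \<sigma> A) = x A"
  by (simp add: act_def act_m_inv[OF assms])

lemma act_supported:
  assumes "\<sigma> permutes {..<2*n}" "supported n x"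
  shows "supported n (act \<sigma> x)"
  unfolding supported_def act_def
proof (intro allI impI)
  fix A assume "A \<notin> matchings n"
  then have "act_m (inv \<sigma>) A \<notin> matchings n"
    using act_m_matching_mate(1)[OF assms(1), of "act_m (inv \<sigma>) A"] by (auto simp: act_m_inv[OF assms(1)])
  then show "x (act_m (inv \<sigma>) A) = 0" using assms(2) by (simp add: supported_def)
qed

text \<open>The two factors of the Young symmetrizer are kept apart because each absorbs elements of
  its own group: \<open>row_sum\<close> those applied after it, \<open>col_alt\<close> those applied
  before it, up to sign.\<close>

definition row_sum :: "nat multiset \<Rightarrow> vec \<Rightarrow> vec" where
  "row_sum \<nu> x = (\<lambda>B. \<Sum>p\<in>row_group \<nu>. act p x B)"

definition col_alt :: "nat multiset \<Rightarrow> vec \<Rightarrow> vec" where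
  "col_alt \<nu> x = (\<lambda>B. \<Sum>q\<in>col_group \<nu>. of_int (sign q) * act q x B)"

lemma perm_group_fibres:
  "perm_group {..<m} {p. p permutes {..<m} \<and> (\<forall>k<m. f (p k) = f k)}"
  unfolding perm_group_def
proof (intro conjI ballI)
  fix p assume "p \<in> {p. p permutes {..<m} \<and> (\<forall>k<m. f (p k) = f k)}"
  then have p: "p permutes {..<m}" and f: "\<And>k. k < m \<Longrightarrow> f (p k) = f k" by auto
  have lt: "p k < m \<longleftrightarrow> k < m" for k using permutes_in_image[OF p, of k] by simp
  show "p permutes {..<m}" by fact
  have "f (inv p k) = f k" if "k < m" for k
  proof -
    have "inv p k < m" using that permutes_in_image[OF permutes_inv[OF p], of k] by simp
    from f[OF this] show ?thesis by (simp add: permutes_inverses[OF p])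
  qed
  then show "inv p \<in> {p. p permutes {..<m} \<and> (\<forall>k<m. f (p k) = f k)}"
    using permutes_inv[OF p] by simp
  fix q assume "q \<in> {p. p permutes {..<m} \<and> (\<forall>k<m. f (p k) = f k)}"
  then have q: "q permutes {..<m}" and fq: "\<And>k. k < m \<Longrightarrow> f (q k) = f k" by auto
  have "q k < m \<longleftrightarrow> k < m" for k using permutes_in_image[OF q, of k] by simp
  then show "p \<circ> q \<in> {p. p permutes {..<m} \<and> (\<forall>k<m. f (p k) = f k)}"
    using f fq permutes_compose[OF q p] by simp
qed simp

lemma perm_group_row_group: "perm_group {..<sum_mset \<nu>} (row_group \<nu>)"
  and perm_group_col_group: "perm_group {..<sum_mset \<nu>} (col_group \<nu>)"
  unfolding row_group_def col_group_def by (rule perm_group_fibres)+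

lemma act_row_sum:
  assumes "t \<in> row_group \<nu>"
  shows "act t (row_sum \<nu> x) = row_sum \<nu> x"
proof
  fix B
  note G = perm_groupD[OF perm_group_row_group[of \<nu>]]
  have "act t (row_sum \<nu> x) B = (\<Sum>p\<in>row_group \<nu>. act t (act p x) B)"
    by (simp add: act_def row_sum_def)
  also have "\<dots> = (\<Sum>p\<in>row_group \<nu>. act (t \<circ> p) x B)"
    by (rule sum.cong[OF refl]) (simp add: act_comp[OF G(1)[OF assms] G(1)])
  also have "\<dots> = row_sum \<nu> x B"
    unfolding row_sum_def
    by (rule sum.reindex_bij_betw[OF perm_group_bij(1)[OF perm_group_row_group assms], of "\<lambda>p. act p x B"])
  finally show "act t (row_sum \<nu> x) B = row_sum \<nu> x B" .
qed

lemma col_alt_act: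
  assumes "t \<in> col_group \<nu>"
  shows "col_alt \<nu> (act t x) = (\<lambda>B. of_int (sign t) * col_alt \<nu> x B)"
proof
  fix B
  note G = perm_groupD[OF perm_group_col_group[of \<nu>]]
  have perm: "permutation q" if "q \<in> col_group \<nu>" for q
    using G(1)[OF that] permutation_permutes by blast
  have "col_alt \<nu> x B = (\<Sum>q\<in>col_group \<nu>. of_int (sign (q \<circ> t)) * act (q \<circ> t) x B)"
    unfolding col_alt_def
    by (rule sum.reindex_bij_betw[OF perm_group_bij(2)[OF perm_group_col_group assms],
          of "\<lambda>q. of_int (sign q) * act q x B", symmetric])
  also have "\<dots> = (\<Sum>q\<in>col_group \<nu>. of_int (sign t) * (of_int (sign q) * act q (act t x) B))"
    by (rule sum.cong[OF refl]) (simp add: act_comp[OF G(1) G(1)[OF assms]] sign_compose perm assms)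
  also have "\<dots> = of_int (sign t) * col_alt \<nu> (act t x) B"
    by (simp add: col_alt_def sum_distrib_left)
  finally show "col_alt \<nu> (act t x) B = of_int (sign t) * col_alt \<nu> x B"
    by (simp add: flip: mult.assoc of_int_mult)
qed

lemma young_op_eq: "young_op \<nu> x = col_alt \<nu> (row_sum \<nu> x)"
proof
  fix B
  note R = perm_groupD(1)[OF perm_group_row_group[of \<nu>]] and C = perm_groupD(1)[OF perm_group_col_group[of \<nu>]]
  have "young_op \<nu> x B = (\<Sum>q\<in>col_group \<nu>. \<Sum>p\<in>row_group \<nu>. of_int (sign q) * act q (act p x) B)"
    unfolding young_op_def by (intro sum.cong refl) (simp add: act_comp[OF C R])
  also have "\<dots> = col_alt \<nu> (row_sum \<nu> x) B"
    by (simp add: col_alt_def row_sum_def act_def sum_distrib_left)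
  finally show "young_op \<nu> x B = col_alt \<nu> (row_sum \<nu> x) B" .
qed

text \<open>If two entries of one row are moved by \<open>\<sigma>\<close> into one column, transposing them shows that
  the operator equals its own negative; otherwise \<open>\<sigma> = q p\<close> by \<open>tableau_factorization\<close>.\<close>

lemma col_alt_act_row_sum:
  assumes "\<sigma> permutes {..<sum_mset \<nu>}"
  shows "\<exists>c::real. \<forall>x. col_alt \<nu> (act \<sigma> (row_sum \<nu> x)) = (\<lambda>B. of_real c * young_op \<nu> x B)"
proof (cases "\<exists>x<sum_mset \<nu>. \<exists>y<sum_mset \<nu>. x \<noteq> y \<and> row_of \<nu> x = row_of \<nu> y \<and> col_of \<nu> (\<sigma> x) = col_of \<nu> (\<sigma> y)")
  case True
  then obtain a b where ab: "a < sum_mset \<nu>" "b < sum_mset \<nu>" "a \<noteq> b"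
    "row_of \<nu> a = row_of \<nu> b" "col_of \<nu> (\<sigma> a) = col_of \<nu> (\<sigma> b)" by blast
  have \<sigma>ab: "\<sigma> a < sum_mset \<nu>" "\<sigma> b < sum_mset \<nu>" "\<sigma> a \<noteq> \<sigma> b"
    using ab permutes_in_image[OF assms] permutes_inj[OF assms] by (auto simp: inj_eq)
  let ?t = "transpose a b" and ?t' = "transpose (\<sigma> a) (\<sigma> b)"
  have tp: "?t permutes {..<sum_mset \<nu>}" "?t' permutes {..<sum_mset \<nu>}"
    using ab \<sigma>ab by (simp_all add: permutes_swap_id)
  have t: "?t \<in> row_group \<nu>" "?t' \<in> col_group \<nu>"
    using tp ab by (auto simp: row_group_def col_group_def transpose_def)
  have comm: "\<sigma> \<circ> ?t = ?t' \<circ> \<sigma>"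
    using permutes_inj[OF assms] by (auto simp: fun_eq_iff transpose_def inj_eq)
  have "col_alt \<nu> (act \<sigma> (row_sum \<nu> x)) = (\<lambda>B. of_real 0 * young_op \<nu> x B)" for x
  proof
    fix B
    have "act \<sigma> (row_sum \<nu> x) = act \<sigma> (act ?t (row_sum \<nu> x))" by (simp add: act_row_sum[OF t(1)])
    also have "\<dots> = act ?t' (act \<sigma> (row_sum \<nu> x))"
      by (simp add: comm flip: act_comp[OF assms tp(1)] act_comp[OF tp(2) assms])
    finally have "col_alt \<nu> (act \<sigma> (row_sum \<nu> x)) = (\<lambda>B. of_int (sign ?t') * col_alt \<nu> (act \<sigma> (row_sum \<nu> x)) B)"
      using col_alt_act[OF t(2)] by metis
    from fun_cong[OF this, of B] show "col_alt \<nu> (act \<sigma> (row_sum \<nu> x)) B = of_real 0 * young_op \<nu> x B"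
      using \<sigma>ab(3) by (simp add: sign_swap_id)
  qed
  then show ?thesis by blast
next
  case False
  have "\<exists>p q. p permutes {..<sum_mset \<nu>} \<and> q permutes {..<sum_mset \<nu>} \<and>
      (\<forall>x\<in>{..<sum_mset \<nu>}. row_of \<nu> (p x) = row_of \<nu> x) \<and>
      (\<forall>x\<in>{..<sum_mset \<nu>}. col_of \<nu> (q x) = col_of \<nu> x) \<and> \<sigma> = q \<circ> p"
  proof (rule tableau_factorization[OF _ _ _ assms])
    show "x = y" if "x \<in> {..<sum_mset \<nu>}" "y \<in> {..<sum_mset \<nu>}" "row_of \<nu> x = row_of \<nu> y" "col_of \<nu> x = col_of \<nu> y" for x y
      using row_col_inj that by simp
    show "\<exists>y\<in>{..<sum_mset \<nu>}. row_of \<nu> y = i \<and> col_of \<nu> y = col_of \<nu> x"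
      if "x \<in> {..<sum_mset \<nu>}" "i \<le> row_of \<nu> x" for x i
      using cell_above[of x \<nu> i] that by auto
    show "x = y" if "x \<in> {..<sum_mset \<nu>}" "y \<in> {..<sum_mset \<nu>}" "row_of \<nu> x = row_of \<nu> y"
      "col_of \<nu> (\<sigma> x) = col_of \<nu> (\<sigma> y)" for x y
      using False that by auto
  qed simp
  then obtain p q where pq: "p \<in> row_group \<nu>" "q \<in> col_group \<nu>" "\<sigma> = q \<circ> p"
    by (auto simp: row_group_def col_group_def)
  have "col_alt \<nu> (act \<sigma> (row_sum \<nu> x)) = (\<lambda>B. of_real (of_int (sign q)) * young_op \<nu> x B)" for x
  proof -
    have "act \<sigma> (row_sum \<nu> x) = act q (row_sum \<nu> x)"
      unfolding pq(3) using act_comp[OF perm_groupD(1)[OF perm_group_col_group pq(2)]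
          perm_groupD(1)[OF perm_group_row_group pq(1)]] act_row_sum[OF pq(1)] by simp
    then show ?thesis by (simp add: col_alt_act[OF pq(2)] young_op_eq)
  qed
  then show ?thesis by blast
qed

section \<open>An invariant bilinear pairing\<close>

definition pairing :: "nat \<Rightarrow> vec \<Rightarrow> vec \<Rightarrow> complex" where
  "pairing n x y = (\<Sum>A\<in>matchings n. x A * y A)"

lemma pairing_sum_left: "pairing n (\<lambda>B. \<Sum>i\<in>I. c i * f i B) y = (\<Sum>i\<in>I. c i * pairing n (f i) y)"
  unfolding pairing_def
  by (simp add: sum_distrib_left sum_distrib_right mult.assoc) (rule sum.swap)

lemma pairing_scale_left: "pairing n (\<lambda>B. c * f B) y = c * pairing n f y"
  by (simp add: pairing_def sum_distrib_left mult.assoc)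

lemma pairing_commute: "pairing n x y = pairing n y x"
  by (simp add: pairing_def mult.commute)

lemma pairing_act:
  assumes "\<sigma> permutes {..<2*n}"
  shows "pairing n (act \<sigma> x) y = pairing n x (act (inv \<sigma>) y)"
proof -
  have "pairing n (act \<sigma> x) y = (\<Sum>A\<in>matchings n. act \<sigma> x (act_m \<sigma> A) * y (act_m \<sigma> A))"
    unfolding pairing_def
    by (rule sum.reindex_bij_betw[OF act_m_bij_betw[OF assms], of "\<lambda>A. act \<sigma> x A * y A", symmetric])
  also have "\<dots> = pairing n x (act (inv \<sigma>) y)"
    unfolding pairing_def
    by (simp add: act_act_m[OF assms] act_def[of "inv \<sigma>"] inv_inv_eq[OF permutes_bij[OF assms]])
  finally show ?thesis .
qed

text \<open>The pairing is bilinear, so conjugation is inserted by hand; the value is then the sum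
  of the squared absolute values.\<close>

lemma pairing_cnj_self:
  assumes "supported n x" "pairing n x (\<lambda>B. cnj (x B)) = 0"
  shows "x = (\<lambda>_. 0)"
proof
  fix A
  have "pairing n x (\<lambda>B. cnj (x B)) = of_real (\<Sum>A\<in>matchings n. (cmod (x A))\<^sup>2)"
    by (simp add: pairing_def complex_norm_square del: of_real_power)
  then have "(\<Sum>A\<in>matchings n. (cmod (x A))\<^sup>2) = 0" using assms(2) by (metis of_real_eq_0_iff)
  then have "\<forall>A\<in>matchings n. (cmod (x A))\<^sup>2 = 0"
    by (subst (asm) sum_nonneg_eq_0_iff[OF finite_matchings]) simp_all
  then show "x A = 0" using assms(1) by (cases "A \<in> matchings n") (auto simp: supported_def)
qed

text \<open>Expanded over pairs of matchings, the two sums agree coefficient by coefficient: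
  replacing \<open>\<sigma>\<close> by \<open>g \<circ> \<sigma>\<close>, where \<open>g\<close>
  exchanges \<open>A\<close> and \<open>B\<close>, exchanges the roles of \<open>u\<close> and
  \<open>v\<close>.\<close>

lemma sum_pairing_act_swap:
  "(\<Sum>\<sigma> | \<sigma> permutes {..<2*n}. pairing n (act \<sigma> u) w * pairing n (act \<sigma> v) w') =
   (\<Sum>\<sigma> | \<sigma> permutes {..<2*n}. pairing n (act \<sigma> v) w * pairing n (act \<sigma> u) w')"
proof -
  let ?S = "{\<sigma>. \<sigma> permutes {..<2*n}}"
  have expand: "(\<Sum>\<sigma>\<in>?S. pairing n (act \<sigma> u) w * pairing n (act \<sigma> v) w') =
      (\<Sum>A\<in>matchings n. \<Sum>B\<in>matchings n. w A * w' B * (\<Sum>\<sigma>\<in>?S. act \<sigma> u A * act \<sigma> v B))" for u v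
  proof -
    have "(\<Sum>\<sigma>\<in>?S. pairing n (act \<sigma> u) w * pairing n (act \<sigma> v) w') =
        (\<Sum>\<sigma>\<in>?S. \<Sum>A\<in>matchings n. \<Sum>B\<in>matchings n. w A * w' B * (act \<sigma> u A * act \<sigma> v B))"
      unfolding pairing_def sum_product by (intro sum.cong refl) (simp add: mult_ac)
    also have "\<dots> = (\<Sum>A\<in>matchings n. \<Sum>\<sigma>\<in>?S. \<Sum>B\<in>matchings n. w A * w' B * (act \<sigma> u A * act \<sigma> v B))"
      by (rule sum.swap)
    also have "\<dots> = (\<Sum>A\<in>matchings n. \<Sum>B\<in>matchings n. \<Sum>\<sigma>\<in>?S. w A * w' B * (act \<sigma> u A * act \<sigma> v B))"
      by (rule sum.cong[OF refl], rule sum.swap)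
    finally show ?thesis by (simp add: sum_distrib_left)
  qed
  have "(\<Sum>\<sigma>\<in>?S. act \<sigma> u A * act \<sigma> v B) = (\<Sum>\<sigma>\<in>?S. act \<sigma> v A * act \<sigma> u B)"
    if AB: "A \<in> matchings n" "B \<in> matchings n" for A B
  proof -
    obtain g where g: "g permutes {..<2*n}" "act_m g A = B" "act_m g B = A" using pair_swap[OF AB] by blast
    have "(\<Sum>\<sigma>\<in>?S. act \<sigma> v A * act \<sigma> u B) = (\<Sum>\<sigma>\<in>?S. act (g \<circ> \<sigma>) v A * act (g \<circ> \<sigma>) u B)"
      by (rule sum.reindex_bij_betw[OF perm_group_bij(1)[OF perm_group_permutations], symmetric]) (simp add: g)
    also have "\<dots> = (\<Sum>\<sigma>\<in>?S. act \<sigma> u A * act \<sigma> v B)"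
    proof (rule sum.cong[OF refl])
      fix \<sigma> assume "\<sigma> \<in> ?S"
      then have "act (g \<circ> \<sigma>) x = act g (act \<sigma> x)" for x using act_comp g(1) by blast
      moreover have "act g x A = x B" "act g x B = x A" for x
        using act_act_m[OF g(1), of x A] act_act_m[OF g(1), of x B] g by simp_all
      ultimately show "act (g \<circ> \<sigma>) v A * act (g \<circ> \<sigma>) u B = act \<sigma> u A * act \<sigma> v B" by simp
    qed
    finally show ?thesis ..
  qed
  then show ?thesis unfolding expand by (intro sum.cong refl) simp
qed

locale young =
  fixes n :: nat and \<nu> :: "nat multiset"
  assumes size: "sum_mset \<nu> = 2*n"
begin

lemma col_group_permutes: "q \<in> col_group \<nu> \<Longrightarrow> q permutes {..<2*n}"
  and row_group_permutes: "p \<in> row_group \<nu> \<Longrightarrow> p permutes {..<2*n}"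
  by (simp_all add: col_group_def row_group_def size)

lemma finite_col_group: "finite (col_group \<nu>)"
  using perm_group_finite[OF perm_group_col_group] by simp

text \<open>The adjoint of \<open>act q\<close> is \<open>act (inv q)\<close>, and inversion
  permutes the column group and preserves signs.\<close>

lemma pairing_col_alt: "pairing n (col_alt \<nu> x) y = pairing n x (col_alt \<nu> y)"
proof -
  have perm: "permutation q" if "q \<in> col_group \<nu>" for q
    using col_group_permutes[OF that] permutation_permutes by blast
  have "pairing n (col_alt \<nu> x) y = (\<Sum>q\<in>col_group \<nu>. of_int (sign q) * pairing n (act q x) y)"
    unfolding col_alt_def by (rule pairing_sum_left)
  also have "\<dots> = (\<Sum>q\<in>col_group \<nu>. of_int (sign (inv q)) * pairing n (act (inv q) y) x)"
    by (intro sum.cong refl)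
      (simp add: pairing_act col_group_permutes sign_inverse perm pairing_commute[of n x])
  also have "\<dots> = (\<Sum>q\<in>col_group \<nu>. of_int (sign q) * pairing n (act q y) x)"
    by (rule sum.reindex_bij_betw[OF perm_group_bij(3)[OF perm_group_col_group]])
  also have "\<dots> = pairing n (col_alt \<nu> y) x"
    unfolding col_alt_def by (rule pairing_sum_left [symmetric])
  finally show ?thesis by (simp add: pairing_commute)
qed

lemma col_alt_act_col_alt:
  "col_alt \<nu> (act \<sigma> (col_alt \<nu> z)) B =
    (\<Sum>q\<in>col_group \<nu>. of_int (sign q) * col_alt \<nu> (act \<sigma> (act q z)) B)"
proof -
  have "col_alt \<nu> (act \<sigma> (col_alt \<nu> z)) B =
      (\<Sum>q'\<in>col_group \<nu>. \<Sum>q\<in>col_group \<nu>. of_int (sign q') * (of_int (sign q) * act q' (act \<sigma> (act q z)) B))"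
    by (simp add: col_alt_def act_def sum_distrib_left)
  also have "\<dots> = (\<Sum>q\<in>col_group \<nu>. \<Sum>q'\<in>col_group \<nu>. of_int (sign q') * (of_int (sign q) * act q' (act \<sigma> (act q z)) B))"
    by (rule sum.swap)
  also have "\<dots> = (\<Sum>q\<in>col_group \<nu>. of_int (sign q) * col_alt \<nu> (act \<sigma> (act q z)) B)"
    by (simp add: col_alt_def sum_distrib_left mult_ac)
  finally show ?thesis .
qed

text \<open>With \<open>col_alt\<close> moved from the right argument to the left, it stands before
  and after \<open>\<sigma>\<close>, and \<open>col_alt_act_row_sum\<close> yields the multiple
  \<open>a\<close> of \<open>young_op \<nu> u\<close>. Without \<open>\<sigma>\<close> the multiple
  is \<open>?k\<close>, whence the ratio \<open>a / ?k\<close>.\<close>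

lemma pairing_act_young:
  assumes "\<sigma> permutes {..<2*n}"
  shows "\<exists>a::real. \<forall>u w. pairing n (act \<sigma> (young_op \<nu> u)) (young_op \<nu> w) =
    of_real a * pairing n (young_op \<nu> u) (young_op \<nu> w)"
proof -
  let ?k = "card (col_group \<nu>)"
  have k: "?k \<noteq> 0" using finite_col_group perm_groupD(3)[OF perm_group_col_group[of \<nu>]] by auto
  have "\<forall>q\<in>col_group \<nu>. \<exists>c::real. \<forall>x. col_alt \<nu> (act (\<sigma> \<circ> q) (row_sum \<nu> x)) = (\<lambda>B. of_real c * young_op \<nu> x B)"
    by (intro ballI col_alt_act_row_sum) (simp add: size permutes_compose[OF col_group_permutes assms])
  from bchoice[OF this] obtain c :: "(nat \<Rightarrow> nat) \<Rightarrow> real" where c: "\<And>q x. q \<in> col_group \<nu> \<Longrightarrow>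
      col_alt \<nu> (act (\<sigma> \<circ> q) (row_sum \<nu> x)) = (\<lambda>B. of_real (c q) * young_op \<nu> x B)"
    by blast
  define a where "a = (\<Sum>q\<in>col_group \<nu>. of_int (sign q) * c q)"
  have 1: "col_alt \<nu> (act \<sigma> (young_op \<nu> u)) = (\<lambda>B. of_real a * young_op \<nu> u B)" for u
  proof
    fix B
    have "col_alt \<nu> (act \<sigma> (young_op \<nu> u)) B =
        (\<Sum>q\<in>col_group \<nu>. of_int (sign q) * (of_real (c q) * young_op \<nu> u B))"
      unfolding young_op_eq[of _ u] col_alt_act_col_alt
      by (intro sum.cong refl) (simp add: c young_op_eq flip: act_comp[OF assms col_group_permutes])
    then show "col_alt \<nu> (act \<sigma> (young_op \<nu> u)) B = of_real a * young_op \<nu> u B"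
      by (simp add: a_def sum_distrib_right mult.assoc)
  qed
  \<comment> \<open>\<open>col_alt\<close> is idempotent up to the order of the column group, since
    the two signs cancel.\<close>
  have 2: "col_alt \<nu> (young_op \<nu> u) = (\<lambda>B. of_nat ?k * young_op \<nu> u B)" for u
  proof
    fix B
    have "col_alt \<nu> (young_op \<nu> u) B = (\<Sum>q\<in>col_group \<nu>. of_int (sign q) * (of_int (sign q) * young_op \<nu> u B))"
      using col_alt_act_col_alt[of id "row_sum \<nu> u" B] unfolding young_op_eq[of _ u] act_id
      by (simp add: col_alt_act)
    then show "col_alt \<nu> (young_op \<nu> u) B = of_nat ?k * young_op \<nu> u B"
      by (simp add: flip: mult.assoc of_int_mult)
  qed
  have "pairing n (act \<sigma> (young_op \<nu> u)) (young_op \<nu> w) =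
    of_real (a / ?k) * pairing n (young_op \<nu> u) (young_op \<nu> w)" for u w
    unfolding young_op_eq[of _ w] pairing_col_alt[symmetric] 1 2 pairing_scale_left using k by simp
  then show ?thesis by blast
qed

lemma young_op_supported:
  assumes "supported n x"
  shows "supported n (young_op \<nu> x)"
  unfolding supported_def young_op_def
proof (intro allI impI sum.neutral ballI)
  fix A q p assume "A \<notin> matchings n" "q \<in> col_group \<nu>" "p \<in> row_group \<nu>"
  then show "of_int (sign q) * act (q \<circ> p) x A = 0"
    using act_supported[OF permutes_compose[OF row_group_permutes col_group_permutes] assms]
    by (simp add: supported_def)
qed

lemma young_op_diff: "young_op \<nu> (\<lambda>B. x B - c * y B) = (\<lambda>B. young_op \<nu> x B - c * young_op \<nu> y B)"
  by (simp add: young_op_def act_def algebra_simps sum_subtractf sum_distrib_left)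

lemma young_op_cnj: "young_op \<nu> (\<lambda>B. cnj (x B)) = (\<lambda>B. cnj (young_op \<nu> x B))"
  by (simp add: young_op_def act_def)

text \<open>By \<open>pairing_act_young\<close> both sides of \<open>sum_pairing_act_swap\<close> are products of two pairings times
  the same positive constant.\<close>

lemma young_op_proportional:
  assumes "supported n x" "supported n y" "young_op \<nu> y \<noteq> (\<lambda>_. 0)"
  shows "\<exists>c. young_op \<nu> x = (\<lambda>B. c * young_op \<nu> y B)"
proof -
  let ?S = "{\<sigma>. \<sigma> permutes {..<2*n}}"
  let ?e = "young_op \<nu>"
  have fin: "finite ?S" by (simp add: finite_permutations)
  obtain a :: "(nat \<Rightarrow> nat) \<Rightarrow> real" where a: "\<And>\<sigma> u w. \<sigma> permutes {..<2*n} \<Longrightarrow>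
      pairing n (act \<sigma> (?e u)) (?e w) = of_real (a \<sigma>) * pairing n (?e u) (?e w)"
    using pairing_act_young by metis
  let ?y' = "\<lambda>B. cnj (y B)"
  \<comment> \<open>The operator has real coefficients and so commutes with conjugation; this
    pairing is the squared norm of a nonzero vector.\<close>
  have ny: "pairing n (?e y) (?e ?y') \<noteq> 0"
    using pairing_cnj_self[OF young_op_supported[OF assms(2)]] assms(3) by (auto simp: young_op_cnj)
  define K where "K = (\<Sum>\<sigma>\<in>?S. (a \<sigma>)\<^sup>2)"
  \<comment> \<open>The identity contributes 1 to \<open>K\<close>, and squares of real numbers
    cannot cancel it.\<close>
  have "a id = 1" using a[OF permutes_id, of y ?y'] ny by simp
  then have "1 \<le> K" unfolding K_def using member_le_sum[of id ?S "\<lambda>\<sigma>. (a \<sigma>)\<^sup>2"] fin by simp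
  then have K: "complex_of_real K \<noteq> 0" by (metis not_one_le_zero of_real_eq_0_iff)
  have eval: "(\<Sum>\<sigma>\<in>?S. pairing n (act \<sigma> (?e u)) (?e w) * pairing n (act \<sigma> (?e v)) (?e w')) =
      of_real K * (pairing n (?e u) (?e w) * pairing n (?e v) (?e w'))" for u v w w'
  proof -
    have "(\<Sum>\<sigma>\<in>?S. pairing n (act \<sigma> (?e u)) (?e w) * pairing n (act \<sigma> (?e v)) (?e w')) =
       (\<Sum>\<sigma>\<in>?S. of_real ((a \<sigma>)\<^sup>2) * (pairing n (?e u) (?e w) * pairing n (?e v) (?e w')))"
      by (intro sum.cong refl) (simp add: a power2_eq_square mult_ac)
    then show ?thesis by (simp add: K_def sum_distrib_right)
  qed
  have exch: "pairing n (?e x) (?e w) * pairing n (?e y) (?e ?y') =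
      pairing n (?e y) (?e w) * pairing n (?e x) (?e ?y')" for w
    using sum_pairing_act_swap[of n "?e x" "?e w" "?e y" "?e ?y'"] K unfolding eval by simp
  \<comment> \<open>By the exchange relation, this \<open>c\<close> makes the image of
    \<open>?z\<close> orthogonal to all images. Taking the image of the conjugate of
    \<open>?z\<close> turns this into a vanishing norm.\<close>
  define c where "c = pairing n (?e x) (?e ?y') / pairing n (?e y) (?e ?y')"
  let ?z = "\<lambda>B. x B - c * y B"
  have "pairing n (?e ?z) (?e w) = 0" for w
  proof -
    have "pairing n (?e ?z) (?e w) = pairing n (?e x) (?e w) - c * pairing n (?e y) (?e w)"
      by (simp add: young_op_diff pairing_def algebra_simps sum_subtractf sum_distrib_left)
    also have "\<dots> = 0" using exch[of w] ny by (simp add: c_def field_simps)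
    finally show ?thesis .
  qed
  from this[of "\<lambda>B. cnj (?z B)"] have "pairing n (?e ?z) (\<lambda>B. cnj (?e ?z B)) = 0"
    unfolding young_op_cnj .
  moreover have "supported n (?e ?z)"
    by (rule young_op_supported) (use assms(1,2) in \<open>simp add: supported_def\<close>)
  ultimately have "?e ?z = (\<lambda>_. 0)" using pairing_cnj_self by blast
  then have "?e x B - c * ?e y B = 0" for B unfolding young_op_diff by (rule fun_cong)
  then have "?e x = (\<lambda>B. c * ?e y B)" by (simp add: fun_eq_iff)
  then show ?thesis by blast
qed

end

text \<open>If \<open>q p\<close> fixes the standard matching, then \<open>q\<close> commutes with \<open>sw\<close>; so \<open>q\<close> acts in the same
  way on each even column and on its odd neighbour, and is even.\<close>

lemma sign_col_fixing:
  assumes \<nu>: "sum_mset (double \<nu>) = 2*n"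
    and p: "p \<in> row_group (double \<nu>)" and q: "q \<in> col_group (double \<nu>)"
    and fixed: "act_m (q \<circ> p) (std_matching n) = std_matching n"
  shows "sign q = 1"
proof -
  let ?D = "double \<nu>" and ?A = "std_matching n"
  interpret young n ?D by unfold_locales (rule \<nu>)
  have pp: "p permutes {..<2*n}" and qp: "q permutes {..<2*n}"
    using row_group_permutes[OF p] col_group_permutes[OF q] .
  have lt: "p x < 2*n \<longleftrightarrow> x < 2*n" "q x < 2*n \<longleftrightarrow> x < 2*n" for x
    using permutes_in_image[OF pp, of x] permutes_in_image[OF qp, of x] by auto
  have row: "row_of ?D (p x) = row_of ?D x" and col: "col_of ?D (q x) = col_of ?D x" if "x < 2*n" for x
    using p q that by (simp_all add: row_group_def col_group_def \<nu>)
  note sw = row_col_sw[where \<nu> = \<nu>, unfolded \<nu>]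
  \<comment> \<open>\<open>p (sw y)\<close> and \<open>sw x\<close> share their row because
    \<open>p\<close> and \<open>sw\<close> preserve rows, and their column because \<open>q\<close>
    preserves columns; hence they are the same cell.\<close>
  have comm: "q (sw x) = sw (q x)" if x: "x < 2*n" for x
  proof -
    obtain y where y: "x = p y" using permutes_surj[OF pp] by blast
    then have y2: "y < 2*n" using x lt by simp
    have qpp: "q \<circ> p permutes {..<2*n}" using permutes_compose[OF pp qp] .
    have "mate ?A ((q \<circ> p) y) = (q \<circ> p) (mate ?A y)"
      using act_m_eq_iff[OF qpp std_matching(1) std_matching(1)] fixed y2 by blast
    then have eq: "sw (q x) = q (p (sw y))" using std_matching(2) y y2 lt by simp
    have sy: "sw y < 2*n" using sw(3)[OF y2] .
    have "row_of ?D (p (sw y)) = row_of ?D (sw x)"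
      using sw(1)[OF x] sw(1)[OF y2] row[OF sy] row[OF y2] y by simp
    moreover have "col_of ?D (p (sw y)) = col_of ?D (sw x)"
    proof -
      have "col_of ?D (p (sw y)) = col_of ?D (sw (q x))" unfolding eq using col[of "p (sw y)"] sy lt by simp
      also have "\<dots> = sw (col_of ?D x)" using sw(2)[of "q x"] x lt col[OF x] by simp
      finally show ?thesis using sw(2)[OF x] by simp
    qed
    ultimately have "p (sw y) = sw x"
      using row_col_inj[of "p (sw y)" ?D "sw x"] sy lt sw(3)[OF x] by (simp add: \<nu>)
    then show ?thesis using eq by simp
  qed
  \<comment> \<open>The parts of \<open>q\<close> on even and on odd columns are conjugate under the
    involution \<open>s\<close>. They have equal signs, and \<open>q\<close> is their
    product.\<close>
  define q0 where "q0 = (\<lambda>x. if x < 2*n \<and> even (col_of ?D x) then q x else x)"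
  define q1 where "q1 = (\<lambda>x. if x < 2*n \<and> odd (col_of ?D x) then q x else x)"
  define s where "s = (\<lambda>x. if x < 2*n then sw x else x)"
  have s: "s permutes {..<2*n}"
    by (rule bij_imp_permutes, rule bij_betwI[where g = s]) (auto simp: s_def sw_less)
  have q0: "q0 permutes {..<2*n}"
  proof -
    have "inj_on q0 {..<2*n}"
    proof (rule inj_onI)
      fix x y assume xy: "x \<in> {..<2*n}" "y \<in> {..<2*n}" "q0 x = q0 y"
      then have "col_of ?D x = col_of ?D y"
        using col[of x] col[of y] unfolding q0_def by (metis lessThan_iff)
      then show "x = y" using xy permutes_inj[OF qp] by (auto simp: q0_def inj_eq split: if_splits)
    qed
    moreover have "q0 ` {..<2*n} \<subseteq> {..<2*n}" by (auto simp: q0_def lt)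
    ultimately have "bij_betw q0 {..<2*n} {..<2*n}" by (simp add: bij_betw_def endo_inj_surj)
    then show ?thesis by (rule bij_imp_permutes) (simp add: q0_def)
  qed
  have q1_eq: "q1 = s \<circ> q0 \<circ> s"
  proof
    fix x
    show "q1 x = (s \<circ> q0 \<circ> s) x"
      using comm[of x] sw(2)[of x] lt(2) by (auto simp: q1_def q0_def s_def sw_less)
  qed
  have "q = q0 \<circ> q1"
  proof
    fix x
    show "q x = (q0 \<circ> q1) x"
      using col[of x] lt(2) permutes_not_in[OF qp, of x] by (auto simp: q0_def q1_def)
  qed
  moreover have "permutation q0" "permutation s" using q0 s permutation_permutes by blast+
  ultimately show ?thesis
    by (simp add: q1_eq sign_compose permutation_compose mult_ac)
qed

text \<open>The coefficient in question counts the pairs \<open>(q, p)\<close> whose product fixes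
  the standard matching: all of them have sign 1 by \<open>sign_col_fixing\<close>, and the pair of
  identities is among them.\<close>

lemma young_op_nonzero:
  assumes "is_partition la n"
  shows "\<exists>w. supported n w \<and> young_op (double la) w \<noteq> (\<lambda>_. 0)"
proof -
  let ?A = "std_matching n" and ?D = "double la"
  let ?w = "\<lambda>B. if B = ?A then 1 else (0::complex)"
  have size: "sum_mset ?D = 2*n" using assms by (simp add: sum_double is_partition_def)
  interpret young n ?D by unfold_locales (rule size)
  have summand: "of_int (sign q) * act (q \<circ> p) ?w ?A = of_nat (if act_m (q \<circ> p) ?A = ?A then 1 else 0)"
    if q: "q \<in> col_group ?D" and p: "p \<in> row_group ?D" for p q
  proof -
    have qp: "q \<circ> p permutes {..<2*n}"
      using permutes_compose[OF row_group_permutes[OF p] col_group_permutes[OF q]] .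
    have "act_m (inv (q \<circ> p)) ?A = ?A \<longleftrightarrow> act_m (q \<circ> p) ?A = ?A"
      using act_m_inv[OF qp] by metis
    then show ?thesis using sign_col_fixing[OF size p q] by (simp add: act_def)
  qed
  let ?T = "\<lambda>q p. if act_m (q \<circ> p) ?A = ?A then 1 else (0::nat)"
  have "young_op ?D ?w ?A = of_nat (\<Sum>q\<in>col_group ?D. \<Sum>p\<in>row_group ?D. ?T q p)"
    unfolding young_op_def of_nat_sum by (intro sum.cong refl summand)
  moreover have "(\<Sum>q\<in>col_group ?D. \<Sum>p\<in>row_group ?D. ?T q p) \<noteq> 0"
  proof -
    have id: "id \<in> col_group ?D" "id \<in> row_group ?D"
      using perm_groupD(3) perm_group_col_group perm_group_row_group by blast+
    have "finite (row_group ?D)" using perm_group_finite[OF perm_group_row_group] by simp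
    then have "?T id id \<le> (\<Sum>p\<in>row_group ?D. ?T id p)"
      by (intro member_le_sum[OF id(2), of "?T id"]) simp_all
    also have "\<dots> \<le> (\<Sum>q\<in>col_group ?D. \<Sum>p\<in>row_group ?D. ?T q p)"
      by (rule member_le_sum[OF id(1), of "\<lambda>q. \<Sum>p\<in>row_group ?D. ?T q p"]) (simp_all add: finite_col_group)
    finally show ?thesis by simp
  qed
  ultimately have "young_op ?D ?w ?A \<noteq> 0" by (metis of_nat_eq_0_iff)
  moreover have "supported n ?w" using std_matching(1) by (auto simp: supported_def)
  ultimately show ?thesis by metis
qed

section \<open>Expansion of the class sums\<close>

text \<open>All parts are at least 2, so there are at most \<open>m\<close> of them, each at most
  \<open>m\<close>.\<close>

lemma finite_P2: "finite (P2 m)"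
proof (rule finite_subset)
  show "P2 m \<subseteq> mset ` {xs. set xs \<subseteq> {..m} \<and> length xs \<le> m}"
  proof
    fix \<tau> assume \<tau>: "\<tau> \<in> P2 m"
    obtain xs where xs: "mset xs = \<tau>" using ex_mset by blast
    have "x \<le> m" if "x \<in> set xs" for x
      using member_le_sum_list[OF that] \<tau> by (simp add: P2_def flip: xs sum_mset_sum_list)
    moreover have "length ys \<le> sum_list ys" if "\<forall>y\<in>set ys. 2 \<le> y" for ys :: "nat list"
      using that by (induction ys) auto
    from this[of xs] have "length xs \<le> m" using \<tau> by (simp add: P2_def flip: xs sum_mset_sum_list)
    ultimately show "\<tau> \<in> mset ` {xs. set xs \<subseteq> {..m} \<and> length xs \<le> m}" using xs by auto
  qed
  show "finite (mset ` {xs. set xs \<subseteq> {..m} \<and> length xs \<le> m})"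
    by (intro finite_imageI finite_lists_length_le) simp
qed

lemma pad1_filter:
  assumes "\<forall>x\<in>#\<nu>. 0 < x"
  shows "pad1 (filter_mset (\<lambda>k. 2 \<le> k) \<nu>) (sum_mset \<nu> - sum_mset (filter_mset (\<lambda>k. 2 \<le> k) \<nu>)) = \<nu>"
  using assms
proof (induction \<nu>)
  case (add x \<nu>)
  have le: "sum_mset (filter_mset (\<lambda>k. 2 \<le> k) \<nu>) \<le> sum_mset \<nu>"
    by (induction \<nu>) auto
  have IH: "pad1 (filter_mset (\<lambda>k. 2 \<le> k) \<nu>) (sum_mset \<nu> - sum_mset (filter_mset (\<lambda>k. 2 \<le> k) \<nu>)) = \<nu>"
    using add by simp
  have "0 < x" using add.prems by simp
  then consider "2 \<le> x" | "x = 1" by linarith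
  then show ?case
  proof cases
    case 1
    then show ?thesis using IH by (simp add: pad1_def)
  next
    case 2
    then show ?thesis using IH le by (simp add: pad1_def Suc_diff_le)
  qed
qed (simp add: pad1_def)

lemma filter_pad1:
  assumes "\<tau> \<in> P2 m"
  shows "filter_mset (\<lambda>k. 2 \<le> k) (pad1 \<tau> r) = \<tau>"
proof -
  have "filter_mset (\<lambda>k. 2 \<le> k) \<tau> = \<tau>"
    using assms by (auto simp: P2_def filter_mset_eq_conv)
  moreover have "filter_mset (\<lambda>k. 2 \<le> k) (replicate_mset r (1::nat)) = {#}"
    by (auto simp: filter_mset_eq_conv)
  ultimately show ?thesis by (simp add: pad1_def)
qed

lemma double_inj: "double \<mu> = double \<nu> \<Longrightarrow> \<mu> = \<nu>"
  by (metis halve_double)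

lemma double_pad1_inj: "\<tau> \<in> P2 m \<Longrightarrow> \<tau>' \<in> P2 m' \<Longrightarrow> double (pad1 \<tau> r) = double (pad1 \<tau>' r') \<Longrightarrow> \<tau> = \<tau>'"
  by (metis double_inj filter_pad1)

lemma is_partition_pad1: "\<tau> \<in> P2 n \<Longrightarrow> is_partition (pad1 \<tau> (n - sum_mset \<tau>)) n"
  by (auto simp: is_partition_def pad1_def P2_def)

lemma ex_pair_of_type:
  assumes "\<tau> \<in> P2 n"
  shows "\<exists>A\<in>matchings n. \<exists>B\<in>matchings n. dmatch n A B = double (pad1 \<tau> (n - sum_mset \<tau>))"
  using ex_dmatch[OF is_partition_pad1[OF assms]] .

lemma ex_type_of_pair:
  assumes "A \<in> matchings n" "B \<in> matchings n"
  shows "\<exists>\<tau>\<in>P2 n. dmatch n A B = double (pad1 \<tau> (n - sum_mset \<tau>))"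
proof -
  interpret matching_pair n A B using assms by unfold_locales
  obtain \<nu> where \<nu>: "is_partition \<nu> n" "dmatch n A B = double \<nu>" using ex_dmatch_eq_double by blast
  let ?\<tau> = "filter_mset (\<lambda>k. 2 \<le> k) \<nu>"
  have eq: "pad1 ?\<tau> (n - sum_mset ?\<tau>) = \<nu>" using pad1_filter[of \<nu>] \<nu>(1) by (simp add: is_partition_def)
  have "sum_mset ?\<tau> \<le> sum_mset \<nu>" by (induction \<nu>) auto
  then have "?\<tau> \<in> P2 n" using \<nu>(1) by (simp add: P2_def is_partition_def)
  then show ?thesis using \<nu>(2) eq by metis
qed

section \<open>Transporters and the coefficients of the expansion\<close>

definition transporters :: "nat \<Rightarrow> nat multiset \<Rightarrow> matching \<Rightarrow> matching \<Rightarrow> (nat \<Rightarrow> nat) set" where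
  "transporters n \<mu> A B = {\<sigma>. \<sigma> permutes {..<2*n} \<and>
    filter_mset (\<lambda>k. 2 \<le> k) (cycle_type (2*n) \<sigma>) = \<mu> \<and> act_m \<sigma> A = B}"

lemma finite_transporters: "finite (transporters n \<mu> A B)"
  by (rule finite_subset[OF _ finite_permutations[of "{..<2*n}"]]) (auto simp: transporters_def)

text \<open>Conjugation by \<open>g\<close> preserves the cycle type. The opposite inequality will
  come from the inverse of \<open>g\<close>.\<close>

lemma card_transporters_act_le:
  assumes g: "g permutes {..<2*n}"
  shows "card (transporters n \<mu> A B) \<le> card (transporters n \<mu> (act_m g A) (act_m g B))"
proof (rule card_inj_on_le[OF _ _ finite_transporters])
  show "inj_on (\<lambda>\<sigma>. g \<circ> \<sigma> \<circ> inv g) (transporters n \<mu> A B)"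
  proof (rule inj_on_inverseI[where g = "\<lambda>\<sigma>. inv g \<circ> \<sigma> \<circ> g"])
    fix \<sigma> show "inv g \<circ> (g \<circ> \<sigma> \<circ> inv g) \<circ> g = \<sigma>"
      by (simp add: fun_eq_iff permutes_inverses[OF g])
  qed
  show "(\<lambda>\<sigma>. g \<circ> \<sigma> \<circ> inv g) ` transporters n \<mu> A B \<subseteq> transporters n \<mu> (act_m g A) (act_m g B)"
  proof
    fix \<rho> assume "\<rho> \<in> (\<lambda>\<sigma>. g \<circ> \<sigma> \<circ> inv g) ` transporters n \<mu> A B"
    then obtain \<sigma> where \<sigma>: "\<rho> = g \<circ> \<sigma> \<circ> inv g" "\<sigma> permutes {..<2*n}"
      "filter_mset (\<lambda>k. 2 \<le> k) (cycle_type (2*n) \<sigma>) = \<mu>" "act_m \<sigma> A = B"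
      by (auto simp: transporters_def)
    have "\<rho> permutes {..<2*n}"
      unfolding \<sigma>(1) by (intro permutes_compose permutes_inv g \<sigma>(2))
    moreover have "act_m \<rho> (act_m g A) = act_m g B"
      by (simp add: \<sigma>(1,4) act_m_comp act_m_inv[OF g])
    ultimately show "\<rho> \<in> transporters n \<mu> (act_m g A) (act_m g B)"
      using \<sigma>(3) by (simp add: transporters_def \<sigma>(1) cycle_type_conjugate[OF g \<sigma>(2)])
  qed
qed

text \<open>Pairs of equal type differ by a relabelling, so the count is a function of the type;
  this puts the class sum into the span of the operators \<open>Mop\<close>.\<close>

lemma card_transporters_cong:
  assumes "A \<in> matchings n" "B \<in> matchings n" "A' \<in> matchings n" "B' \<in> matchings n"
    "dmatch n A B = dmatch n A' B'"
  shows "card (transporters n \<mu> A B) = card (transporters n \<mu> A' B')"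
proof -
  obtain g where g: "g permutes {..<2*n}" "act_m g A = A'" "act_m g B = B'"
    using pair_iso[OF assms] by blast
  have "act_m (inv g) A' = A" "act_m (inv g) B' = B" using g(2,3) act_m_inv(1)[OF g(1)] by auto
  then show ?thesis
    using card_transporters_act_le[OF g(1), of \<mu> A B] card_transporters_act_le[OF permutes_inv[OF g(1)], of \<mu> A' B'] g(2,3)
    by simp
qed

lemma c_op_eq_transporters:
  assumes "supported n x"
  shows "c_op n \<mu> x B = (\<Sum>A\<in>matchings n. of_nat (card (transporters n \<mu> A B)) * x A)"
proof -
  let ?C = "{\<sigma>. \<sigma> permutes {..<2*n} \<and> filter_mset (\<lambda>k. 2 \<le> k) (cycle_type (2*n) \<sigma>) = \<mu>}"
  have fin: "finite ?C" by (rule finite_subset[OF _ finite_permutations[of "{..<2*n}"]]) auto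
  \<comment> \<open>The only candidate for \<open>A\<close> is the preimage of \<open>B\<close>; if
    that is not a matching, the value vanishes by the support condition.\<close>
  have act: "act \<sigma> x B = (\<Sum>A\<in>matchings n. if act_m \<sigma> A = B then x A else 0)" if "\<sigma> permutes {..<2*n}" for \<sigma>
  proof -
    have "act_m \<sigma> A = B \<longleftrightarrow> A = act_m (inv \<sigma>) B" for A using act_m_inv[OF that] by metis
    then have "(\<Sum>A\<in>matchings n. if act_m \<sigma> A = B then x A else 0) =
        (\<Sum>A\<in>matchings n. if A = act_m (inv \<sigma>) B then x A else 0)" by simp
    also have "\<dots> = (if act_m (inv \<sigma>) B \<in> matchings n then x (act_m (inv \<sigma>) B) else 0)"
      by (rule sum.delta[OF finite_matchings])
    finally show ?thesis using assms by (simp add: act_def supported_def)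
  qed
  have "c_op n \<mu> x B = (\<Sum>\<sigma>\<in>?C. \<Sum>A\<in>matchings n. if act_m \<sigma> A = B then x A else 0)"
    unfolding c_op_def by (intro sum.cong refl act) simp
  also have "\<dots> = (\<Sum>A\<in>matchings n. \<Sum>\<sigma>\<in>?C. if act_m \<sigma> A = B then x A else 0)"
    by (rule sum.swap)
  also have "\<dots> = (\<Sum>A\<in>matchings n. of_nat (card (transporters n \<mu> A B)) * x A)"
  proof (rule sum.cong[OF refl])
    fix A
    have "(\<Sum>\<sigma>\<in>?C. if act_m \<sigma> A = B then x A else 0) = (\<Sum>\<sigma>\<in>{\<sigma>\<in>?C. act_m \<sigma> A = B}. x A)"
      by (rule sum.inter_filter[OF fin, symmetric])
    also have "{\<sigma>\<in>?C. act_m \<sigma> A = B} = transporters n \<mu> A B" by (auto simp: transporters_def)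
    finally show "(\<Sum>\<sigma>\<in>?C. if act_m \<sigma> A = B then x A else 0) = of_nat (card (transporters n \<mu> A B)) * x A"
      by simp
  qed
  finally show ?thesis .
qed

lemma Mop_eq: "\<tau> \<in> P2 n \<Longrightarrow> Mop n \<tau> = Nop n (pad1 \<tau> (n - sum_mset \<tau>))"
  by (simp add: Mop_def P2_def)

text \<open>As \<open>dcoef\<close> is a definite description, both existence and uniqueness are
  established. The candidate counts the transporters of one chosen pair for each type; uniqueness
  follows by evaluating an expansion at an indicator vector.\<close>

lemma
  shows dcoef_expansion: "supported n x \<Longrightarrow> c_op n \<mu> x = (\<lambda>B. \<Sum>\<tau>\<in>P2 n. dcoef n \<mu> \<tau> * Mop n \<tau> x B)"
    and dcoef_eq: "\<lbrakk>\<tau> \<in> P2 n; A \<in> matchings n; B \<in> matchings n;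
      dmatch n A B = double (pad1 \<tau> (n - sum_mset \<tau>))\<rbrakk>
      \<Longrightarrow> dcoef n \<mu> \<tau> = of_nat (card (transporters n \<mu> A B))"
proof -
  let ?t = "\<lambda>\<tau>. double (pad1 \<tau> (n - sum_mset \<tau>))"
  have "\<forall>\<tau>\<in>P2 n. \<exists>p. fst p \<in> matchings n \<and> snd p \<in> matchings n \<and> dmatch n (fst p) (snd p) = ?t \<tau>"
    using ex_pair_of_type by (metis fst_conv snd_conv)
  from bchoice[OF this] obtain p where p: "\<And>\<tau>. \<tau> \<in> P2 n \<Longrightarrow>
      fst (p \<tau>) \<in> matchings n \<and> snd (p \<tau>) \<in> matchings n \<and> dmatch n (fst (p \<tau>)) (snd (p \<tau>)) = ?t \<tau>"
    by blast
  define d where "d = (\<lambda>\<tau>. if \<tau> \<in> P2 n then complex_of_nat (card (transporters n \<mu> (fst (p \<tau>)) (snd (p \<tau>)))) else 0)"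
  have d: "d \<tau> = of_nat (card (transporters n \<mu> A B))"
    if "\<tau> \<in> P2 n" "A \<in> matchings n" "B \<in> matchings n" "dmatch n A B = ?t \<tau>" for \<tau> A B
    using card_transporters_cong[of A n B "fst (p \<tau>)" "snd (p \<tau>)" \<mu>] p[OF that(1)] that by (simp add: d_def)
  have type_sum: "(\<Sum>\<tau>\<in>P2 n. if dmatch n A B = ?t \<tau> then f \<tau> else 0) = f \<tau>'"
    if "\<tau>' \<in> P2 n" "dmatch n A B = ?t \<tau>'" for f :: "nat multiset \<Rightarrow> complex" and A B \<tau>'
  proof -
    have "(\<Sum>\<tau>\<in>P2 n. if dmatch n A B = ?t \<tau> then f \<tau> else 0) = (\<Sum>\<tau>\<in>P2 n. if \<tau> = \<tau>' then f \<tau> else 0)"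
    proof (rule sum.cong[OF refl])
      fix \<tau> assume "\<tau> \<in> P2 n"
      then have "dmatch n A B = ?t \<tau> \<longleftrightarrow> \<tau> = \<tau>'"
        unfolding that(2) using double_pad1_inj[OF that(1)] by metis
      then show "(if dmatch n A B = ?t \<tau> then f \<tau> else 0) = (if \<tau> = \<tau>' then f \<tau> else 0)" by simp
    qed
    then show ?thesis using finite_P2 that(1) by simp
  qed
  have sat: "c_op n \<mu> x = (\<lambda>B. \<Sum>\<tau>\<in>P2 n. d \<tau> * Mop n \<tau> x B)" if "supported n x" for x
  proof
    fix B
    show "c_op n \<mu> x B = (\<Sum>\<tau>\<in>P2 n. d \<tau> * Mop n \<tau> x B)"
    proof (cases "B \<in> matchings n")
      case True
      have "(\<Sum>\<tau>\<in>P2 n. d \<tau> * Mop n \<tau> x B) =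
          (\<Sum>\<tau>\<in>P2 n. \<Sum>A\<in>matchings n. if dmatch n A B = ?t \<tau> then d \<tau> * x A else 0)"
        by (intro sum.cong refl) (simp add: Mop_eq Nop_def True sum_distrib_left if_distrib cong: if_cong)
      also have "\<dots> = (\<Sum>A\<in>matchings n. \<Sum>\<tau>\<in>P2 n. if dmatch n A B = ?t \<tau> then d \<tau> * x A else 0)"
        by (rule sum.swap)
      also have "\<dots> = (\<Sum>A\<in>matchings n. of_nat (card (transporters n \<mu> A B)) * x A)"
      proof (rule sum.cong[OF refl])
        fix A assume A: "A \<in> matchings n"
        obtain \<tau> where \<tau>: "\<tau> \<in> P2 n" "dmatch n A B = ?t \<tau>" using ex_type_of_pair[OF A True] by blast
        show "(\<Sum>\<tau>\<in>P2 n. if dmatch n A B = ?t \<tau> then d \<tau> * x A else 0) =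
            of_nat (card (transporters n \<mu> A B)) * x A"
          unfolding type_sum[OF \<tau>, of "\<lambda>\<tau>. d \<tau> * x A"] d[OF \<tau>(1) A True \<tau>(2)] ..
      qed
      finally show ?thesis unfolding c_op_eq_transporters[OF that] ..
    next
      case False
      have "transporters n \<mu> A B = {}" if "A \<in> matchings n" for A
        using act_m_matching_mate(1)[of _ n A] that False by (auto simp: transporters_def)
      then have "c_op n \<mu> x B = 0" by (simp add: c_op_eq_transporters[OF that])
      moreover have "Mop n \<tau> x B = 0" for \<tau> by (simp add: Mop_def Nop_def False)
      ultimately show ?thesis by simp
    qed
  qed
  have uniq: "d' = d" if d': "\<forall>\<tau>. \<tau> \<notin> P2 n \<longrightarrow> d' \<tau> = 0"
    "\<forall>x. supported n x \<longrightarrow> c_op n \<mu> x = (\<lambda>B. \<Sum>\<tau>\<in>P2 n. d' \<tau> * Mop n \<tau> x B)" for d'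
  proof
    fix \<tau>
    show "d' \<tau> = d \<tau>"
    proof (cases "\<tau> \<in> P2 n")
      case True
      define A where "A = fst (p \<tau>)"
      define B where "B = snd (p \<tau>)"
      have AB: "A \<in> matchings n" "B \<in> matchings n" "dmatch n A B = ?t \<tau>" using p[OF True] by (simp_all add: A_def B_def)
      let ?x = "\<lambda>C. if C = A then 1 else (0::complex)"
      have x: "supported n ?x" using AB(1) by (auto simp: supported_def)
      have Mop: "Mop n \<tau>' ?x B = (if dmatch n A B = ?t \<tau>' then 1 else 0)" if "\<tau>' \<in> P2 n" for \<tau>'
      proof -
        have "Mop n \<tau>' ?x B = (\<Sum>C\<in>matchings n. if C = A then (if dmatch n A B = ?t \<tau>' then 1 else 0) else 0)"
          unfolding Mop_eq[OF that] Nop_def if_P[OF AB(2)] by (rule sum.cong[OF refl]) simp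
        then show ?thesis using AB(1) finite_matchings by simp
      qed
      \<comment> \<open>On the indicator of \<open>A\<close>, the operator of type
        \<open>\<tau>'\<close> has coefficient 1 at \<open>B\<close> if \<open>\<tau>'\<close> is
        the type of the pair, and 0 otherwise; so one term remains.\<close>
      have "(\<Sum>\<tau>'\<in>P2 n. d' \<tau>' * Mop n \<tau>' ?x B) = d' \<tau>'" if "d' \<tau>' = d' \<tau>" for \<tau>'
      proof -
        have "(\<Sum>\<tau>'\<in>P2 n. d' \<tau>' * Mop n \<tau>' ?x B) = (\<Sum>\<tau>'\<in>P2 n. if dmatch n A B = ?t \<tau>' then d' \<tau>' else 0)"
          by (intro sum.cong refl) (simp add: Mop)
        then show ?thesis using type_sum[OF True AB(3), of d'] that by simp
      qed
      from this[of \<tau>] have "d' \<tau> = c_op n \<mu> ?x B" using d'(2) x by simp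
      also have "\<dots> = of_nat (card (transporters n \<mu> A B))"
        using finite_matchings AB(1) by (simp add: c_op_eq_transporters[OF x] if_distrib cong: if_cong)
      finally show ?thesis unfolding d[OF True AB] .
    qed (use d'(1) in \<open>simp add: d_def\<close>)
  qed
  have dcoef: "dcoef n \<mu> = d"
    unfolding dcoef_def
  proof (rule the_equality)
    show "(\<forall>\<tau>. \<tau> \<notin> P2 n \<longrightarrow> d \<tau> = 0) \<and>
      (\<forall>x. supported n x \<longrightarrow> c_op n \<mu> x = (\<lambda>B. \<Sum>\<tau>\<in>P2 n. d \<tau> * Mop n \<tau> x B))"
      using sat by (simp add: d_def)
  qed (use uniq in blast)
  show "supported n x \<Longrightarrow> c_op n \<mu> x = (\<lambda>B. \<Sum>\<tau>\<in>P2 n. dcoef n \<mu> \<tau> * Mop n \<tau> x B)"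
    unfolding dcoef by (rule sat)
  show "\<lbrakk>\<tau> \<in> P2 n; A \<in> matchings n; B \<in> matchings n; dmatch n A B = ?t \<tau>\<rbrakk>
      \<Longrightarrow> dcoef n \<mu> \<tau> = of_nat (card (transporters n \<mu> A B))"
    unfolding dcoef by (rule d)
qed

text \<open>A transporter would force \<open>sum_mset \<tau> \<le> sum_mset \<mu>\<close>, with
  equality only for \<open>\<tau> = \<mu>\<close>; the assumptions leave neither possibility, so
  there is none to count.\<close>

lemma dcoef_eq_0:
  assumes "\<tau> \<in> P2 n" "\<tau> \<noteq> \<mu>" "\<tau> \<notin> P2 (sum_mset \<mu> - 1)"
  shows "dcoef n \<mu> \<tau> = 0"
proof -
  obtain A B where AB: "A \<in> matchings n" "B \<in> matchings n" "dmatch n A B = double (pad1 \<tau> (n - sum_mset \<tau>))"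
    using ex_pair_of_type[OF assms(1)] by blast
  interpret matching_pair n A B using AB by unfold_locales
  have "\<sigma> \<notin> transporters n \<mu> A B" for \<sigma>
  proof
    assume "\<sigma> \<in> transporters n \<mu> A B"
    then have \<sigma>: "\<sigma> permutes {..<2*n}" "act_m \<sigma> A = B"
      "filter_mset (\<lambda>k. 2 \<le> k) (cycle_type (2*n) \<sigma>) = \<mu>" by (auto simp: transporters_def)
    have "sum_mset \<tau> \<le> sum_mset \<mu>" "sum_mset \<tau> \<noteq> sum_mset \<mu>"
      using transporter_sum_le[OF \<sigma>(1,2) assms(1) AB(3)] assms(2) unfolding \<sigma>(3) by auto
    then show False using assms(1,3) by (auto simp: P2_def)
  qed
  then have "transporters n \<mu> A B = {}" by blast
  then show ?thesis using dcoef_eq[OF assms(1) AB] by simp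
qed

lemma dcoef_self:
  assumes "\<mu> \<in> P2 n"
  shows "dcoef n \<mu> \<mu> = 2 ^ size \<mu>"
proof -
  obtain A B where AB: "A \<in> matchings n" "B \<in> matchings n" "dmatch n A B = double (pad1 \<mu> (n - sum_mset \<mu>))"
    using ex_pair_of_type[OF assms] by blast
  interpret matching_pair n A B using AB by unfold_locales
  show ?thesis
    using dcoef_eq[OF assms AB, of \<mu>] card_transporter[OF assms AB(3)] by (simp add: transporters_def)
qed

section \<open>Scalars on the isotypic components\<close>

lemma Nop_sum: "Nop n \<nu> (\<lambda>B. \<Sum>i\<in>I. f i B) = (\<lambda>B. \<Sum>i\<in>I. Nop n \<nu> (f i) B)"
proof
  fix B
  have "(\<Sum>A\<in>matchings n. if P A then \<Sum>i\<in>I. f i A else 0) = (\<Sum>i\<in>I. \<Sum>A\<in>matchings n. if P A then f i A else 0)" for P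
    by (subst sum.swap) (intro sum.cong refl, simp)
  then show "Nop n \<nu> (\<lambda>B. \<Sum>i\<in>I. f i B) B = (\<Sum>i\<in>I. Nop n \<nu> (f i) B)" by (simp add: Nop_def)
qed

lemma Nop_scale: "Nop n \<nu> (\<lambda>B. c * f B) = (\<lambda>B. c * Nop n \<nu> f B)"
  by (auto simp: Nop_def fun_eq_iff sum_distrib_left intro!: sum.cong)

lemma Nop_act:
  assumes "\<sigma> permutes {..<2*n}"
  shows "Nop n \<nu> (act \<sigma> x) = act \<sigma> (Nop n \<nu> x)"
proof
  fix B
  note inv = act_m_inv[OF assms]
  have mem: "act_m (inv \<sigma>) B \<in> matchings n \<longleftrightarrow> B \<in> matchings n"
    using act_m_matching_mate(1)[OF assms, of "act_m (inv \<sigma>) B"] act_m_matching_mate(1)[OF permutes_inv[OF assms], of B] inv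
    by auto
  have "(\<Sum>A\<in>matchings n. if dmatch n A B = double \<nu> then act \<sigma> x A else 0) =
      (\<Sum>A\<in>matchings n. if dmatch n (act_m \<sigma> A) B = double \<nu> then act \<sigma> x (act_m \<sigma> A) else 0)"
    by (rule sum.reindex_bij_betw[OF act_m_bij_betw[OF assms],
          of "\<lambda>A. if dmatch n A B = double \<nu> then act \<sigma> x A else 0", symmetric])
  also have "\<dots> = (\<Sum>A\<in>matchings n. if dmatch n A (act_m (inv \<sigma>) B) = double \<nu> then x A else 0)"
    using dmatch_act_m[OF assms, of _ "act_m (inv \<sigma>) B"] by (simp add: inv act_act_m[OF assms] cong: if_cong)
  finally have "Nop n \<nu> (act \<sigma> x) B = Nop n \<nu> x (act_m (inv \<sigma>) B)"
    by (simp add: Nop_def mem)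
  then show "Nop n \<nu> (act \<sigma> x) B = act \<sigma> (Nop n \<nu> x) B" by (simp add: act_def)
qed

lemma Nop_supported: "supported n (Nop n \<nu> x)"
  by (simp add: supported_def Nop_def)

lemma (in young) Nop_young_op: "Nop n \<rho> (young_op \<nu> x) = young_op \<nu> (Nop n \<rho> x)"
proof -
  have "Nop n \<rho> (young_op \<nu> x) = (\<lambda>B. \<Sum>q\<in>col_group \<nu>. \<Sum>p\<in>row_group \<nu>. of_int (sign q) * Nop n \<rho> (act (q \<circ> p) x) B)"
    unfolding young_op_def Nop_sum Nop_scale ..
  also have "\<dots> = young_op \<nu> (Nop n \<rho> x)"
    unfolding young_op_def
    by (intro ext sum.cong refl) (simp add: Nop_act permutes_compose[OF row_group_permutes col_group_permutes])
  finally show ?thesis .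
qed

lemma iso_gens_supported:
  assumes "is_partition la n" "v \<in> iso_gens n (double la)"
  shows "supported n v"
proof -
  interpret young n "double la"
    by unfold_locales (use assms(1) in \<open>simp add: sum_double is_partition_def\<close>)
  show ?thesis using assms(2) act_supported young_op_supported unfolding iso_gens_def by blast
qed

text \<open>Some generator is nonzero, so at most one scalar fits and the description in
  \<open>scalar_on\<close> is determined.\<close>

lemma scalar_on_iso_gens:
  assumes "is_partition la n" "\<And>v. v \<in> iso_gens n (double la) \<Longrightarrow> T v = (\<lambda>B. c * v B)"
  shows "scalar_on (iso_gens n (double la)) T = c"
proof -
  obtain w where w: "supported n w" "young_op (double la) w \<noteq> (\<lambda>_. 0)"
    using young_op_nonzero[OF assms(1)] by blast
  have mem: "young_op (double la) w \<in> iso_gens n (double la)"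
    unfolding iso_gens_def using w(1) permutes_id act_id by (metis (mono_tags, lifting) mem_Collect_eq)
  obtain B where B: "young_op (double la) w B \<noteq> 0" using w(2) by auto
  show ?thesis
    unfolding scalar_on_def
  proof (rule the_equality)
    fix c' assume "\<forall>v\<in>iso_gens n (double la). T v = (\<lambda>B. c' * v B)"
    then have "(\<lambda>B. c' * young_op (double la) w B) = (\<lambda>B. c * young_op (double la) w B)"
      using mem assms(2)[OF mem] by simp
    from fun_cong[OF this, of B] show "c' = c" using B by simp
  qed (use assms(2) in blast)
qed

text \<open>The operator commutes with the Young operator and with relabelling, so it acts on the
  line spanned by \<open>?e w\<close> by some \<open>c\<close>. All generators are translates of
  vectors on this line and get the same \<open>c\<close>.\<close>

lemma Nop_iso_gens:
  assumes "is_partition la n" "v \<in> iso_gens n (double la)"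
  shows "Nop n \<rho> v = (\<lambda>B. theta n la \<rho> * v B)"
proof -
  interpret young n "double la"
    by unfold_locales (use assms(1) in \<open>simp add: sum_double is_partition_def\<close>)
  let ?e = "young_op (double la)"
  obtain w where w: "supported n w" "?e w \<noteq> (\<lambda>_. 0)" using young_op_nonzero[OF assms(1)] by blast
  obtain c where c: "?e (Nop n \<rho> w) = (\<lambda>B. c * ?e w B)"
    using young_op_proportional[OF Nop_supported w] by blast
  have scalar: "Nop n \<rho> v = (\<lambda>B. c * v B)" if "v \<in> iso_gens n (double la)" for v
  proof -
    obtain \<sigma> u where u: "v = act \<sigma> (?e u)" "\<sigma> permutes {..<2*n}" "supported n u"
      using \<open>v \<in> iso_gens n (double la)\<close> unfolding iso_gens_def by blast
    obtain d where d: "?e u = (\<lambda>B. d * ?e w B)" using young_op_proportional[OF u(3) w] by blast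
    show ?thesis
      unfolding u(1) Nop_act[OF u(2)] d Nop_scale Nop_young_op c by (simp add: act_def mult_ac)
  qed
  have "theta n la \<rho> = c" unfolding theta_def by (rule scalar_on_iso_gens[OF assms(1) scalar])
  then show ?thesis using scalar[OF assms(2)] by simp
qed

text \<open>Cycle lengths are positive and add up to \<open>2*n\<close>, so the nontrivial cycles
  determine the number of fixed points.\<close>

lemma class_sum_eq_c_op:
  assumes "\<mu> \<in> P2 n"
  shows "class_sum n (pad1 \<mu> (2*n - sum_mset \<mu>)) = c_op n \<mu>"
proof -
  have "cycle_type (2*n) \<sigma> = pad1 \<mu> (2*n - sum_mset \<mu>) \<longleftrightarrow>
      filter_mset (\<lambda>k. 2 \<le> k) (cycle_type (2*n) \<sigma>) = \<mu>" if "\<sigma> permutes {..<2*n}" for \<sigma>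
    using filter_pad1[OF assms] pad1_filter[of "cycle_type (2*n) \<sigma>"] cycle_type_pos[OF that] sum_cycle_type[OF that]
    by metis
  then have "{\<sigma>. \<sigma> permutes {..<2*n} \<and> cycle_type (2*n) \<sigma> = pad1 \<mu> (2*n - sum_mset \<mu>)} =
      {\<sigma>. \<sigma> permutes {..<2*n} \<and> filter_mset (\<lambda>k. 2 \<le> k) (cycle_type (2*n) \<sigma>) = \<mu>}" by blast
  then show ?thesis by (simp add: fun_eq_iff class_sum_def c_op_def)
qed

lemma phi_eq_sum_theta:
  assumes "is_partition la n" "\<mu> \<in> P2 n"
  shows "phi n la (pad1 \<mu> (2*n - sum_mset \<mu>)) =
    (\<Sum>\<tau>\<in>P2 n. dcoef n \<mu> \<tau> * theta n la (pad1 \<tau> (n - sum_mset \<tau>)))"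
  unfolding phi_def class_sum_eq_c_op[OF assms(2)]
proof (rule scalar_on_iso_gens[OF assms(1)])
  fix v assume v: "v \<in> iso_gens n (double la)"
  show "c_op n \<mu> v = (\<lambda>B. (\<Sum>\<tau>\<in>P2 n. dcoef n \<mu> \<tau> * theta n la (pad1 \<tau> (n - sum_mset \<tau>))) * v B)"
    unfolding dcoef_expansion[OF iso_gens_supported[OF assms(1) v]] sum_distrib_right
    by (intro ext sum.cong refl) (simp add: Mop_eq Nop_iso_gens[OF assms(1) v])
qed

text \<open>In this type no component has more than two vertices, that is, \<open>moved\<close> is
  empty and the mates agree everywhere.\<close>

lemma dmatch_trivial_iff:
  assumes "A \<in> matchings n" "B \<in> matchings n"
  shows "dmatch n A B = double (replicate_mset n 1) \<longleftrightarrow> A = B"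
proof -
  interpret matching_pair n A B using assms by unfold_locales
  obtain \<tau> where \<tau>: "\<tau> \<in> P2 n" "dmatch n A B = double (pad1 \<tau> (n - sum_mset \<tau>))"
    using ex_type_of_pair[OF assms] by blast
  have e: "{#} \<in> P2 n" by (simp add: P2_def)
  have "dmatch n A B = double (replicate_mset n 1) \<longleftrightarrow> \<tau> = {#}"
  proof
    assume "dmatch n A B = double (replicate_mset n 1)"
    then have "double (pad1 \<tau> (n - sum_mset \<tau>)) = double (pad1 {#} n)" using \<tau>(2) by (simp add: pad1_def)
    then show "\<tau> = {#}" by (rule double_pad1_inj[OF \<tau>(1) e])
  qed (simp add: \<tau>(2) pad1_def)
  also have "\<tau> = {#} \<longleftrightarrow> sum_mset \<tau> = 0"
    using \<tau>(1) by (cases \<tau>) (auto simp: P2_def)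
  also have "\<dots> \<longleftrightarrow> card moved = 0"
  proof -
    have "2 * sum_mset \<tau> = card moved"
      using card_moved unfolding \<tau>(2) filter_double_pad1[OF \<tau>(1)] sum_double moved_def .
    then show ?thesis by linarith
  qed
  also have "\<dots> \<longleftrightarrow> A = B"
  proof -
    have "card moved = 0 \<longleftrightarrow> moved = {}" using finite_moved by simp
    also have "\<dots> \<longleftrightarrow> (\<forall>x<2*n. mate A x = mate B x)" by (auto simp: moved_def)
    also have "\<dots> \<longleftrightarrow> A = B" using matching_eqI[OF assms] by blast
    finally show ?thesis .
  qed
  finally show ?thesis .
qed

text \<open>By \<open>dmatch_trivial_iff\<close> the operator is the identity on supported
  vectors.\<close>

lemma theta_trivial:
  assumes "is_partition la n"
  shows "theta n la (replicate_mset n 1) = 1"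
  unfolding theta_def
proof (rule scalar_on_iso_gens[OF assms])
  fix v assume "v \<in> iso_gens n (double la)"
  then have v: "supported n v" by (rule iso_gens_supported[OF assms])
  show "Nop n (replicate_mset n 1) v = (\<lambda>B. 1 * v B)"
  proof
    fix B
    show "Nop n (replicate_mset n 1) v B = 1 * v B"
    proof (cases "B \<in> matchings n")
      case True
      have "Nop n (replicate_mset n 1) v B = (\<Sum>A\<in>matchings n. if A = B then v A else 0)"
        unfolding Nop_def if_P[OF True] by (rule sum.cong[OF refl]) (simp only: dmatch_trivial_iff[OF _ True])
      then show ?thesis using True finite_matchings by simp
    qed (use v in \<open>simp add: Nop_def supported_def\<close>)
  qed
qed

theorem theorem3p4:
  fixes n :: nat
  assumes "1 \<le> n"
  shows "(\<forall>la. is_partition la n \<longrightarrow> theta n la (replicate_mset n 1) = 1) \<and>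
    (\<forall>\<mu>. \<mu> \<in> P2 n \<and> 0 < sum_mset \<mu> \<longrightarrow>
      (\<forall>la. is_partition la n \<longrightarrow>
         theta n la (pad1 \<mu> (n - sum_mset \<mu>)) =
           (1 / 2 ^ size \<mu>) *
           (phi n la (pad1 \<mu> (2*n - sum_mset \<mu>))
            - (\<Sum>\<tau>\<in>P2 (sum_mset \<mu> - 1).
                 dcoef n \<mu> \<tau> * theta n la (pad1 \<tau> (n - sum_mset \<tau>))))))"
proof (intro conjI allI impI)
  fix la assume "is_partition la n"
  then show "theta n la (replicate_mset n 1) = 1" by (rule theta_trivial)
next
  fix \<mu> la assume \<mu>: "\<mu> \<in> P2 n \<and> 0 < sum_mset \<mu>" and la: "is_partition la n"
  let ?f = "\<lambda>\<tau>. dcoef n \<mu> \<tau> * theta n la (pad1 \<tau> (n - sum_mset \<tau>))"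
  let ?L = "P2 (sum_mset \<mu> - 1)"
  \<comment> \<open>Because \<open>sum_mset \<mu>\<close> is positive, the truncated subtraction
    really lowers the bound, and the term of \<open>\<mu>\<close> can be split off from the lower
    ones.\<close>
  have "\<mu> \<notin> ?L" using \<mu> by (auto simp: P2_def)
  moreover have "insert \<mu> ?L \<subseteq> P2 n" using \<mu> by (auto simp: P2_def)
  ultimately have "(\<Sum>\<tau>\<in>P2 n. ?f \<tau>) = (\<Sum>\<tau>\<in>insert \<mu> ?L. ?f \<tau>)"
    by (intro sum.mono_neutral_right finite_P2 ballI) (auto simp: dcoef_eq_0)
  also have "\<dots> = 2 ^ size \<mu> * theta n la (pad1 \<mu> (n - sum_mset \<mu>)) + (\<Sum>\<tau>\<in>?L. ?f \<tau>)"
    using \<open>\<mu> \<notin> ?L\<close> \<mu> by (simp add: finite_P2 dcoef_self)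
  finally have "phi n la (pad1 \<mu> (2*n - sum_mset \<mu>)) =
      2 ^ size \<mu> * theta n la (pad1 \<mu> (n - sum_mset \<mu>)) + (\<Sum>\<tau>\<in>?L. ?f \<tau>)"
    using phi_eq_sum_theta[OF la, of \<mu>] \<mu> by simp
  then show "theta n la (pad1 \<mu> (n - sum_mset \<mu>)) =
      (1 / 2 ^ size \<mu>) * (phi n la (pad1 \<mu> (2*n - sum_mset \<mu>)) - (\<Sum>\<tau>\<in>?L. ?f \<tau>))"
    by simp
qed

end
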